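(* Let $q\in(0,1)$, $\psi\in D_q$, $\beta\in\mathbb{R}$, $n,p\in\mathbb{N}$, $p\leqslant n$, and let $\omega(t)$ be a convex (upwards) modulus of continuity satisfying $\lim_{t\to0}\frac{\omega(t)}{t}=\infty$. Put $\varepsilon_{n-p+1}=\sup_{k\geqslant n-p+1}\left|\frac{\psi(k+1)}{\psi(k)}-q\right|$. Then, as $n-p\to\infty$, $$\mathcal{E}(C^\psi_{\beta}H_\omega;V_{n,p})=\frac{\psi(n-p+1)}{p}\Bigg(\frac{4}{\pi^2}\frac{1-q^{2p}}{1-q^2}\mathbf{K}(q^p)\int_0^{\pi/2}\omega\left(\frac{2t}{n-p+1}\right)\sin t\,dt$$ $$+O(1)\bigg(\frac{\omega(\pi)}{(1-q)^{\gamma(p)}(n-p+1)}+\frac{\varepsilon_{n-p+1}}{(1-q)^2}\min\Big\{p,\frac{1}{1-q}\Big\}\,\omega\Big(\frac{1}{n-p+1}\Big)\bigg)\Bigg),$$ where $\mathbf{K}(\rho)=\int_0^{\pi/2}\frac{dt}{\sqrt{1-\rho^2\sin^2t}}$ is the complete elliptic integral of the first kind, $\gamma(p)=2$ if $p=1$ and $\gamma(p)=3$ if $p=2,3,\ldots,n$, and $O(1)$ is a quantity uniformly bounded in $n$, $p$, $q$, $\psi$, $\omega$ and $\beta$.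
   Context: Spaces. $L_1$ is the space of $2\pi$-periodic functions summable over a period; $C$ is the space of continuous $2\pi$-periodic functions with $\|f\|_C=\max_t|f(t)|$. $(\psi,\beta)$-derivative. Let $f\in L_1$ have Fourier series $\frac{a_0(f)}{2}+\sum_{k=1}^\infty(a_k(f)\cos kx+b_k(f)\sin kx)$, let $\psi(k)$, $k\in\mathbb{N}$, be a sequence of real numbers and $\beta\in\mathbb{R}$. If there is $\varphi\in L_1$ with Fourier series $\sum_{k=1}^\infty\frac{1}{\psi(k)}\left(a_k(f)\cos(kx+\frac{\beta\pi}{2})+b_k(f)\sin(kx+\frac{\beta\pi}{2})\right)$, then $\varphi$ is called the $(\psi,\beta)$-derivative of $f$, denoted $f^\psi_\beta$. For $\mathfrak{N}\subset L_1$, $L^\psi_\beta\mathfrak{N}$ is the set of $f\in L_1$ for which $f^\psi_\beta$ exists and belongs to $\mathfrak{N}$, and $C^\psi_\beta\mathfrak{N}=C\cap L^\psi_\beta\mathfrak{N}$. The set $D_q$, $q\in(0,1)$, consists of the sequences $\psi(k)>0$, $k\in\mathbb{N}$, with $\lim_{k\to\infty}\psi(k+1)/\psi(k)=q$. Class $H_\omega$. For a modulus of continuity $\omega$ (a continuous, nondecreasing, subadditive function on $[0,\infty)$ with $\omega(0)=0$), $H_\omega=\{\varphi\in C:\omega(\varphi;t)\leqslant\omega(t),\ t\geqslant0\}$, where $\omega(\varphi;t)=\sup_{|h|\leqslant t}\|\varphi(\cdot+h)-\varphi(\cdot)\|_C$. "Convex (upwards)" means concave in the usual modern terminology. De la Vallée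 Poussin sums. $V_{n,p}(f;x)=\frac1p\sum_{k=n-p}^{n-1}S_k(f;x)$, where $S_k(f;x)$ is the $k$th partial sum (harmonics of order at most $k$) of the Fourier series of $f$. For a class $\mathfrak{M}\subset C$, $\mathcal{E}(\mathfrak{M};V_{n,p})=\sup_{f\in\mathfrak{M}}\|f(\cdot)-V_{n,p}(f;\cdot)\|_C$. Meaning of the asymptotic notation. The parameter $p=p(n)$ may vary with $n$. "As $n-p\to\infty$, with $O(1)$ uniformly bounded in the listed parameters" means: there is an absolute constant $K$ such that for each $q\in(0,1)$ and $\psi\in D_q$ there is $N=N(\psi,q)$ such that, for all $n,p$ with $p\leqslant n$ and $n-p\geqslant N$ and all values of the other parameters, the formula holds with a quantity $O(1)$ of absolute value at most $K$. *)

theory Defs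
  imports "HOL-Analysis.Analysis"
begin

definition L1_per :: "(real \<Rightarrow> real) set" where
  "L1_per = {f. (\<forall>x. f (x + 2 * pi) = f x) \<and> f absolutely_integrable_on {-pi..pi}}"

definition C_per :: "(real \<Rightarrow> real) set" where
  "C_per = {f. (\<forall>x. f (x + 2 * pi) = f x) \<and> continuous_on UNIV f}"

text \<open>Used only for functions in \<open>C_per\<close>, where the supremum is finite and attained.\<close>

definition norm_C :: "(real \<Rightarrow> real) \<Rightarrow> real" where
  "norm_C f = (SUP t. \<bar>f t\<bar>)"

definition fourier_a :: "(real \<Rightarrow> real) \<Rightarrow> nat \<Rightarrow> real" where
  "fourier_a f k = 1 / pi * integral {-pi..pi} (\<lambda>t. f t * cos (real k * t))"

definition fourier_b :: "(real \<Rightarrow> real) \<Rightarrow> nat \<Rightarrow> real" where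
  "fourier_b f k = 1 / pi * integral {-pi..pi} (\<lambda>t. f t * sin (real k * t))"

definition fourier_sum :: "nat \<Rightarrow> (real \<Rightarrow> real) \<Rightarrow> real \<Rightarrow> real" where
  "fourier_sum m f x = fourier_a f 0 / 2 +
     (\<Sum>k=1..m. fourier_a f k * cos (real k * x) + fourier_b f k * sin (real k * x))"

definition vallee_poussin :: "nat \<Rightarrow> nat \<Rightarrow> (real \<Rightarrow> real) \<Rightarrow> real \<Rightarrow> real" where
  "vallee_poussin n p f x = 1 / real p * (\<Sum>k\<in>{n-p..n-1}. fourier_sum k f x)"

text \<open>The Fourier series of \<open>\<phi>\<close> is the prescribed one: the constant terms agree, and so do the
  harmonics of each order \<open>k \<ge> 1\<close> (an identity in \<open>x\<close> between two combinations of
  \<open>cos (k x)\<close> and \<open>sin (k x)\<close>). A derivative is determined only up to a null set, hence a relation.\<close>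

definition is_psi_beta_deriv ::
  "(nat \<Rightarrow> real) \<Rightarrow> real \<Rightarrow> (real \<Rightarrow> real) \<Rightarrow> (real \<Rightarrow> real) \<Rightarrow> bool" where
  "is_psi_beta_deriv \<psi> \<beta> f \<phi> \<longleftrightarrow>
     f \<in> L1_per \<and> \<phi> \<in> L1_per \<and> fourier_a \<phi> 0 = 0 \<and>
     (\<forall>k\<ge>1. \<forall>x. fourier_a \<phi> k * cos (real k * x) + fourier_b \<phi> k * sin (real k * x) =
        1 / \<psi> k * (fourier_a f k * cos (real k * x + \<beta> * pi / 2) +
                   fourier_b f k * sin (real k * x + \<beta> * pi / 2)))"

definition L_class :: "(nat \<Rightarrow> real) \<Rightarrow> real \<Rightarrow> (real \<Rightarrow> real) set \<Rightarrow> (real \<Rightarrow> real) set" where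
  "L_class \<psi> \<beta> \<NN> = {f \<in> L1_per. \<exists>\<phi>\<in>\<NN>. is_psi_beta_deriv \<psi> \<beta> f \<phi>}"

definition C_class :: "(nat \<Rightarrow> real) \<Rightarrow> real \<Rightarrow> (real \<Rightarrow> real) set \<Rightarrow> (real \<Rightarrow> real) set" where
  "C_class \<psi> \<beta> \<NN> = C_per \<inter> L_class \<psi> \<beta> \<NN>"

text \<open>Sequences are indexed by \<open>k \<ge> 1\<close>; the value at \<open>0\<close> is irrelevant throughout.\<close>

definition D_set :: "real \<Rightarrow> (nat \<Rightarrow> real) set" where
  "D_set q = {\<psi>. (\<forall>k\<ge>1. \<psi> k > 0) \<and> (\<lambda>k. \<psi> (k + 1) / \<psi> k) \<longlonglongrightarrow> q}"

definition modulus_of_continuity :: "(real \<Rightarrow> real) \<Rightarrow> bool" where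
  "modulus_of_continuity \<omega> \<longleftrightarrow>
     continuous_on {0..} \<omega> \<and> mono_on {0..} \<omega> \<and>
     (\<forall>s\<ge>0. \<forall>t\<ge>0. \<omega> (s + t) \<le> \<omega> s + \<omega> t) \<and> \<omega> 0 = 0"

definition modulus_of :: "(real \<Rightarrow> real) \<Rightarrow> real \<Rightarrow> real" where
  "modulus_of \<phi> t = (SUP h\<in>{h. \<bar>h\<bar> \<le> t}. norm_C (\<lambda>x. \<phi> (x + h) - \<phi> x))"

definition H_class :: "(real \<Rightarrow> real) \<Rightarrow> (real \<Rightarrow> real) set" where
  "H_class \<omega> = {\<phi> \<in> C_per. \<forall>t\<ge>0. modulus_of \<phi> t \<le> \<omega> t}"

text \<open>Taken in the extended reals, so that an equation with a real number includes finiteness.\<close>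

definition approx_error :: "(real \<Rightarrow> real) set \<Rightarrow> nat \<Rightarrow> nat \<Rightarrow> ereal" where
  "approx_error \<MM> n p = (SUP f\<in>\<MM>. ereal (norm_C (\<lambda>x. f x - vallee_poussin n p f x)))"

definition ratio_dev :: "(nat \<Rightarrow> real) \<Rightarrow> real \<Rightarrow> nat \<Rightarrow> real" where
  "ratio_dev \<psi> q m = (SUP k\<in>{m..}. \<bar>\<psi> (k + 1) / \<psi> k - q\<bar>)"

definition elliptic_K :: "real \<Rightarrow> real" where
  "elliptic_K \<rho> = integral {0..pi/2} (\<lambda>t. 1 / sqrt (1 - \<rho>\<^sup>2 * (sin t)\<^sup>2))"

definition gamma_exp :: "nat \<Rightarrow> nat" where
  "gamma_exp p = (if p = 1 then 2 else 3)"

end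

theory Submission
  imports Defs
begin

text \<open>Put \<open>N = n - p + 1\<close>. The remainder \<open>f - V\<^bsub>n,p\<^esub> f\<close> is the convolution of \<open>f\<^sup>\<psi>\<^sub>\<beta>\<close> with a
  kernel whose coefficients \<open>min (j + 1) p \<cdot> \<psi> (N + j) / p\<close>, \<open>j \<ge> 0\<close>, may be replaced by those for
  \<open>\<psi> (N + j) = \<psi> N \<cdot> q ^ j\<close>: the harmonics of order \<open>\<ge> N\<close> of a function in \<open>H\<^sub>\<omega>\<close> are
  \<open>O(\<omega> (1 / N))\<close>, which produces the second error term. The geometric kernel is
  \<open>Re (cis (N t + c) \<cdot> g t)\<close> with \<open>g t = (1 - q ^ p cis (p t)) / (1 - q cis t)\<^sup>2\<close>, whose factor \<open>g\<close> has Lipschitz constant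
  \<open>O(1 / (1 - q) ^ \<gamma>(p))\<close>. Freezing \<open>g\<close> on each period of the oscillation costs the first error term.
  Over a period starting at a trough of the frozen kernel, reflection at its two zeros shows that the
  integral is at most \<open>\<bar>g\<bar> \<cdot> (2 / N) \<integral> \<omega> (2 t / N) sin t dt\<close>, and a zigzag function of the distance to the
  peaks attains this on all periods at once up to the same error. Summation over the periods gives
  \<open>\<integral> \<bar>g\<bar>\<close>, which the Poisson kernel expansion and Landen's substitution express through \<open>K (q ^ p)\<close>.\<close>

section \<open>Integrals of periodic functions and uniqueness of Fourier coefficients\<close>

text \<open>The phase of \<open>g\<close> is not constant, so the sign changes of the kernel are
  unevenly spaced and no strictly periodic extremal function fits them. Freezing \<open>g\<close>
  makes each period an exact cosine with a displaced peak. The phase has Lipschitz constant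
  \<open>3 / (1 - q)\<close>, so \<open>N \<ge> 6 / (1 - q)\<close> keeps the peaks ordered and the
  gaps close to \<open>2 * pi / N\<close>. Freezing and uneven spacing both cost
  \<open>O(\<omega> pi / ((1 - q) ^ \<gamma>(p) * N ^ 2))\<close> on one period, and there are
  \<open>N\<close> periods. These errors involve only the size of the derivative, which its zero
  mean bounds by \<open>2 * \<omega> pi\<close>. The exponent \<gamma>(p) reflects the weights
  \<open>min (j + 1) p\<close>: they are 1 for \<open>p = 1\<close> and are estimated by
  \<open>j + 1\<close> otherwise, which makes the bounds uniform in \<open>p\<close>. Concavity of
  \<omega> is what allows the extremal function to cross a zero of the kernel without violating the
  modulus condition.\<close>

lemma integral_affine:
  fixes h :: "real \<Rightarrow> real"
  assumes "continuous_on UNIV h" "m > 0"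
  shows "integral {a..b} (\<lambda>x. h (m * x + c)) = integral {m * a + c..m * b + c} h / m"
proof -
  have "(h has_integral integral {m * a + c..m * b + c} h) (cbox (m * a + c) (m * b + c))"
    using assms(1) by (auto intro!: integrable_integral integrable_continuous_real
        intro: continuous_on_subset)
  from has_integral_affinity'[OF this assms(2), of c] show ?thesis
    using assms(2) by (intro integral_unique) (simp add: field_simps)
qed

lemma integral_reflect_affine:
  fixes h :: "real \<Rightarrow> real"
  assumes "continuous_on UNIV h"
  shows "integral {a..b} (\<lambda>x. h (c - x)) = integral {c - b..c - a} h"
proof -
  have "integral {a..b} (\<lambda>x. h (c - x)) = integral {- b..- a} (\<lambda>x. h (c + x))"
    using Henstock_Kurzweil_Integration.integral_reflect_real[where a = "- b" and b = "- a" and f = "\<lambda>x. h (c + x)"] by simp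
  also have "\<dots> = integral {c - b..c - a} h"
    using integral_affine[OF assms, of 1 "- b" "- a" c] by (simp add: add.commute)
  finally show ?thesis .
qed

lemma continuous_integrable:
  fixes h :: "real \<Rightarrow> real"
  assumes "continuous_on UNIV h"
  shows "h integrable_on {a..b}"
  using assms by (auto intro!: integrable_continuous_real intro: continuous_on_subset)

lemma abs_integral_le:
  fixes h :: "real \<Rightarrow> real"
  assumes "continuous_on UNIV h" "a \<le> b" "\<And>x. a \<le> x \<Longrightarrow> x \<le> b \<Longrightarrow> \<bar>h x\<bar> \<le> M"
  shows "\<bar>integral {a..b} h\<bar> \<le> M * (b - a)"
  using integral_bound[of a b h M] assms
  by (auto intro: continuous_on_subset)

text \<open>Serves to trim or extend a cell of uneven length to one full period of the
  cosine.\<close>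

lemma abs_integral_diff_endpoint:
  fixes h :: "real \<Rightarrow> real"
  assumes "continuous_on UNIV h" "a \<le> b" "a \<le> c" "\<And>x. \<bar>h x\<bar> \<le> M"
  shows "\<bar>integral {a..b} h - integral {a..c} h\<bar> \<le> M * \<bar>b - c\<bar>"
proof -
  have *: "\<bar>integral {a..c} h - integral {a..b} h\<bar> \<le> M * (c - b)" if "a \<le> b" "b \<le> c" for b c
    using Henstock_Kurzweil_Integration.integral_combine[of a b c h] that continuous_integrable[OF assms(1)]
      abs_integral_le[OF assms(1), of b c M] assms(4) by fastforce
  show ?thesis
    using *[of b c] *[of c b] assms by (cases "b \<le> c") (auto simp: abs_minus_commute)
qed

lemma integral_periodic:
  fixes h :: "real \<Rightarrow> real"
  assumes "continuous_on UNIV h" "\<And>x. h (x + T) = h x" "T > 0"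
  shows "integral {a..a + T} h = integral {b..b + T} h"
proof -
  have I: "h integrable_on {u..v}" for u v
    by (rule continuous_integrable[OF assms(1)])
  have sh: "integral {a + T..b + T} h = integral {a..b} h" for a b
    using integral_affine[OF assms(1), of 1 a b T] assms(2) by simp
  have *: "integral {a..a + T} h = integral {b..b + T} h" if "a \<le> b" for a b
  proof -
    have "integral {a..a + T} h + integral {a + T..b + T} h = integral {a..b + T} h"
      using that assms(3) by (intro Henstock_Kurzweil_Integration.integral_combine I) auto
    moreover have "integral {a..b} h + integral {b..b + T} h = integral {a..b + T} h"
      using that assms(3) by (intro Henstock_Kurzweil_Integration.integral_combine I) auto
    ultimately show ?thesis using sh by simp
  qed
  show ?thesis using *[of a b] *[of b a] by linarith
qed

lemma periodic_int:
  fixes h :: "real \<Rightarrow> 'a"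
  assumes "\<And>x. h (x + T) = h x"
  shows "h (x + of_int j * T) = h x"
proof (induction j rule: int_induct[where k = 0])
  case (step1 i)
  then show ?case using assms[of "x + of_int i * T"] by (simp add: algebra_simps)
next
  case (step2 i)
  then show ?case using assms[of "x + of_int (i - 1) * T"] by (simp add: algebra_simps)
qed simp

lemma integral_suminf:
  fixes h :: "nat \<Rightarrow> real \<Rightarrow> real"
  assumes "\<And>j. continuous_on UNIV (h j)" "\<And>j x. \<bar>h j x\<bar> \<le> M j" "summable M"
  shows "(\<lambda>j. integral {a..b} (h j)) sums integral {a..b} (\<lambda>x. \<Sum>j. h j x)"
proof -
  have u: "uniform_limit {a..b} (\<lambda>n x. \<Sum>j<n. h j x) (\<lambda>x. \<Sum>j. h j x) sequentially"
    by (rule Weierstrass_m_test) (use assms in auto)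
  have c: "continuous_on {a..b} (\<lambda>x. \<Sum>j<n. h j x)" for n
    by (intro continuous_on_sum) (use assms(1) in \<open>auto intro: continuous_on_subset\<close>)
  obtain I J where I: "\<And>n. ((\<lambda>x. \<Sum>j<n. h j x) has_integral I n) {a..b}"
    and J: "((\<lambda>x. \<Sum>j. h j x) has_integral J) {a..b}" and IJ: "I \<longlonglongrightarrow> J"
    using uniform_limit_integral[OF u c] by auto
  have "I = (\<lambda>n. \<Sum>j<n. integral {a..b} (h j))"
    using I by (auto simp: continuous_integrable[OF assms(1)] integral_sum[symmetric] intro!: integral_unique[symmetric])
  with IJ J show ?thesis unfolding sums_def by (auto dest: integral_unique)
qed

lemma continuous_on_suminf:
  fixes h :: "nat \<Rightarrow> real \<Rightarrow> real"
  assumes "\<And>j. continuous_on UNIV (h j)" "\<And>j x. \<bar>h j x\<bar> \<le> M j" "summable M"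
  shows "continuous_on UNIV (\<lambda>x. \<Sum>j. h j x)"
proof (rule uniform_limit_theorem)
  show "uniform_limit UNIV (\<lambda>n x. \<Sum>j<n. h j x) (\<lambda>x. \<Sum>j. h j x) sequentially"
    by (rule Weierstrass_m_test) (use assms in auto)
  show "\<forall>\<^sub>F n in sequentially. continuous_on UNIV (\<lambda>x. \<Sum>j<n. h j x)"
    by (intro always_eventually allI continuous_on_sum assms)
qed simp

section \<open>Continuous periodic functions and uniqueness of their Fourier coefficients\<close>

lemma C_per_continuous: "f \<in> C_per \<Longrightarrow> continuous_on UNIV f"
  and C_per_periodic: "f \<in> C_per \<Longrightarrow> f (x + 2 * pi) = f x"
  by (auto simp: C_per_def)

lemma C_per_shift: "f \<in> C_per \<Longrightarrow> (\<lambda>t. f (x + t)) \<in> C_per"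
  unfolding C_per_def
  by (auto simp: add.assoc[symmetric] intro!: continuous_intros intro: continuous_on_compose2)

lemma C_per_subset_L1_per: "C_per \<subseteq> L1_per"
  unfolding C_per_def L1_per_def
  by (auto intro!: absolutely_integrable_continuous_real intro: continuous_on_subset)

lemma C_per_reduce:
  assumes "f \<in> C_per"
  obtains y where "- pi \<le> y" "y \<le> pi" "\<exists>j. y = x + of_int j * (2 * pi)" "f y = f x"
proof -
  define j where "j = - \<lfloor>(x + pi) / (2 * pi)\<rfloor>"
  define y where "y = x + of_int j * (2 * pi)"
  have "of_int \<lfloor>(x + pi) / (2 * pi)\<rfloor> * (2 * pi) \<le> x + pi"
    "x + pi \<le> (of_int \<lfloor>(x + pi) / (2 * pi)\<rfloor> + 1) * (2 * pi)"
    by (simp_all add: pos_le_divide_eq[symmetric] pos_divide_le_eq[symmetric])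
  then have "- pi \<le> y" "y \<le> pi"
    unfolding y_def j_def by (auto simp: algebra_simps)
  moreover have "f y = f x"
    unfolding y_def by (rule periodic_int) (rule C_per_periodic[OF assms])
  ultimately show ?thesis using that y_def by blast
qed

lemma C_per_bounded:
  assumes "f \<in> C_per"
  obtains M where "\<And>x. \<bar>f x\<bar> \<le> M" "M \<ge> 0"
proof -
  have "compact (f ` {-pi..pi})"
    using assms by (intro compact_continuous_image) (auto simp: C_per_def intro: continuous_on_subset)
  then obtain M where M: "\<And>y. y \<in> {-pi..pi} \<Longrightarrow> \<bar>f y\<bar> \<le> M"
    using compact_imp_bounded bounded_iff by (metis image_eqI real_norm_def)
  have "\<bar>f x\<bar> \<le> M" for x
    using C_per_reduce[OF assms, of x] M by (metis atLeastAtMost_iff)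
  with that show ?thesis by (metis abs_ge_zero order_trans)
qed

lemma C_per_integral:
  assumes "f \<in> C_per"
  shows "integral {a..a + 2 * pi} f = integral {-pi..pi} f"
  using integral_periodic[OF C_per_continuous[OF assms] C_per_periodic[OF assms], of a "-pi"] by simp

lemma C_per_trig:
  assumes "f \<in> C_per"
  shows "(\<lambda>t. f t * cos (real k * t - y)) \<in> C_per"
proof -
  have "cos (real k * (t + 2 * pi) - y) = cos (real k * t - y)" for t
  proof -
    have "real k * (t + 2 * pi) - y = (real k * t - y) + 2 * pi * of_int (int k)"
      by (simp add: algebra_simps)
    then show ?thesis by (simp only: cos_add cos_int_2pin sin_int_2pin)
  qed
  with assms show ?thesis by (auto simp: C_per_def intro!: continuous_intros)
qed

text \<open>The factor \<open>((1 + cos (t - x)) / 2) ^ n\<close> concentrates at \<open>t = x\<close>, while multiplication by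
  \<open>cos\<close> preserves the vanishing of all Fourier coefficients.\<close>

lemma fourier_coefficients_zero:
  assumes f: "f \<in> C_per"
    and zero: "\<And>k y. integral {-pi..pi} (\<lambda>t. f t * cos (real k * t - y)) = 0"
  shows "f x = 0"
proof -
  have int: "h integrable_on {-pi..pi}" if "h \<in> C_per" for h
    using that by (intro continuous_integrable) (simp add: C_per_def)
  define w where "w = (\<lambda>t. (1 + cos (t - x)) / 2)"
  have wc: "continuous_on UNIV w" unfolding w_def by (intro continuous_intros) auto
  have wp: "w (t + 2 * pi) = w t" for t
    unfolding w_def using cos_periodic[of "t - x"] by (simp add: algebra_simps)
  have w01: "0 \<le> w t" "w t \<le> 1" for t
    unfolding w_def using cos_ge_minus_one[of "t - x"] cos_le_one[of "t - x"] by (simp_all, linarith+)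
  \<comment> \<open>One more factor \<open>w\<close> mixes the orders \<open>k - 1\<close>,
    \<open>k\<close> and \<open>k + 1\<close> and shifts phases by \<open>x\<close>, so the
    induction needs the vanishing for all orders and phases together.\<close>
  have P: "(\<lambda>t. f t * w t ^ n) \<in> C_per \<and>
     (\<forall>k y. integral {-pi..pi} (\<lambda>t. (f t * w t ^ n) * cos (real k * t - y)) = 0)" for n
  proof (induction n)
    case 0
    then show ?case using f zero by simp
  next
    case (Suc n)
    define F where "F = (\<lambda>t. f t * w t ^ n)"
    have F: "F \<in> C_per" and F0: "\<And>k y. integral {-pi..pi} (\<lambda>t. F t * cos (real k * t - y)) = 0"
      using Suc unfolding F_def by auto
    have "integral {-pi..pi} (\<lambda>t. (F t * w t) * cos (real k * t - y)) = 0" for k y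
    proof -
      \<comment> \<open>Order and phase of the difference frequency. For \<open>k = 0\<close> the
        order -1 is folded to 1 by evenness of the cosine, which negates the phase.\<close>
      define k' where "k' = (if k = 0 then 1 else k - 1)"
      define y' where "y' = (if k = 0 then x - y else y - x)"
      have k': "cos (real k' * t - y') = cos ((real k * t - y) - (t - x))" for t
        unfolding k'_def y'_def using cos_minus[of "t - x + y"] by (auto simp: of_nat_diff algebra_simps)
      have "(F t * w t) * cos (real k * t - y) = (1/2) * (F t * cos (real k * t - y))
          + (1/4) * (F t * cos (real (Suc k) * t - (y + x)))
          + (1/4) * (F t * cos (real k' * t - y'))" for t
      proof -
        have e: "real (Suc k) * t - (y + x) = (real k * t - y) + (t - x)" by (simp add: algebra_simps)
        show ?thesis unfolding k' e cos_add cos_diff[of "real k * t - y"] w_def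
          by (simp add: field_simps)
      qed
      then have "integral {-pi..pi} (\<lambda>t. (F t * w t) * cos (real k * t - y)) =
         integral {-pi..pi} (\<lambda>t. (1/2) * (F t * cos (real k * t - y))
          + (1/4) * (F t * cos (real (Suc k) * t - (y + x))) + (1/4) * (F t * cos (real k' * t - y')))"
        by presburger
      also have "\<dots> = 0"
      proof -
        have i: "(\<lambda>t. F t * cos (real k * t - y)) integrable_on {-pi..pi}" for k y
          by (rule int[OF C_per_trig[OF F]])
        show ?thesis
          using F0 by (simp add: integral_add integrable_add i integrable_on_cmult_left integral_mult_right
            del: of_nat_Suc)
      qed
      finally show ?thesis .
    qed
    moreover have "(\<lambda>t. F t * w t) \<in> C_per"
      using F wc wp by (auto simp: C_per_def intro!: continuous_intros)
    ultimately show ?case by (simp add: F_def mult.assoc mult.commute mult.left_commute)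
  qed
  have wint: "integral {x - pi..x + pi} (\<lambda>t. f t * w t ^ n) = 0" for n
  proof -
    have "integral {-pi..pi} (\<lambda>t. (f t * w t ^ n) * cos (real 0 * t - 0)) = 0" using P by blast
    then show ?thesis using C_per_integral[of "\<lambda>t. f t * w t ^ n" "x - pi"] P[of n]
      by (simp add: algebra_simps)
  qed
  show ?thesis
  proof (rule ccontr)
    assume nz: "f x \<noteq> 0"
    define s where "s = sgn (f x)"
    define c where "c = \<bar>f x\<bar>"
    have c: "c > 0" "s * f x = c" using nz by (auto simp: c_def s_def sgn_if)
    have s1: "\<bar>s\<bar> = 1" using nz by (simp add: s_def)
    obtain d0 where d0: "d0 > 0" "\<And>t. \<bar>t - x\<bar> < d0 \<Longrightarrow> \<bar>f t - f x\<bar> < c / 2"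
      using C_per_continuous[OF f] c(1) unfolding continuous_on_iff dist_real_def
      by (metis UNIV_I half_gt_zero)
    define d where "d = min (d0 / 2) (pi / 2)"
    have d: "d > 0" "d < d0" "d < pi" using d0 pi_gt_zero by (auto simp: d_def min_def)
    have near: "s * f t \<ge> c / 2" if "\<bar>t - x\<bar> \<le> d" for t
    proof -
      have "\<bar>s * f t - c\<bar> < c / 2"
        using d0(2)[of t] that d(2) c(2) s1
        by (metis abs_mult mult_1 order_le_less_trans right_diff_distrib')
      then show ?thesis by linarith
    qed
    obtain M where M: "\<And>t. \<bar>f t\<bar> \<le> M" "M \<ge> 0" using C_per_bounded[OF f] by blast
    \<comment> \<open>The values of \<open>w\<close> at distances \<open>d / 2\<close> and
      \<open>d\<close> from \<open>x\<close>. The core contributes at least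
      \<open>c * d * a ^ n / 2\<close> and the far part at most \<open>2 * M * pi * b ^ n\<close>;
      since \<open>b < a\<close>, a large \<open>n\<close> makes cancellation impossible.\<close>
    define a where "a = (1 + cos (d / 2)) / 2"
    define b where "b = (1 + cos d) / 2"
    have cosmono: "cos v \<le> cos u" if "\<bar>u\<bar> \<le> \<bar>v\<bar>" "\<bar>v\<bar> \<le> pi" for u v :: real
      using cos_monotone_0_pi_le[of "\<bar>u\<bar>" "\<bar>v\<bar>"] that by simp
    have "cos d < cos (d / 2)" using cos_monotone_0_pi[of "d/2" d] d by simp
    moreover have "- 1 \<le> cos d" by (rule cos_ge_minus_one)
    ultimately have "0 \<le> b \<and> b < a" unfolding a_def b_def by argo
    then have ab: "0 \<le> b" "b < a" "0 < a" by auto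
    have "(\<lambda>n. (4 * M * pi / (c * d)) * (b / a) ^ n) \<longlonglongrightarrow> (4 * M * pi / (c * d)) * 0"
      using ab by (intro tendsto_mult_left LIMSEQ_realpow_zero) auto
    then have "\<forall>\<^sub>F n in sequentially. (4 * M * pi / (c * d)) * (b / a) ^ n < 1"
      by (rule order_tendstoD) simp
    then obtain n where n: "(4 * M * pi / (c * d)) * (b / a) ^ n < 1"
      by (meson eventually_happens trivial_limit_sequentially)
    define H where "H = (\<lambda>t. s * (f t * w t ^ n))"
    have Hc: "continuous_on UNIV H"
      using f wc unfolding H_def C_per_def by (auto intro!: continuous_intros)
    have HI: "H integrable_on {u..v}" for u v by (rule continuous_integrable[OF Hc])
    have far: "\<bar>H t\<bar> \<le> M * b ^ n" if "d \<le> \<bar>t - x\<bar>" "\<bar>t - x\<bar> \<le> pi" for t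
    proof -
      have "w t \<le> b" unfolding w_def b_def using cosmono[of d "t - x"] that d by auto
      then have "w t ^ n \<le> b ^ n" using w01 by (intro power_mono) auto
      then show ?thesis unfolding H_def abs_mult s1 using M w01 by (auto intro!: mult_mono)
    qed
    have mid: "H t \<ge> 0" if "\<bar>t - x\<bar> \<le> d" for t
    proof -
      have "H t = (s * f t) * w t ^ n" by (simp add: H_def)
      with near[OF that] c w01 show ?thesis by simp
    qed
    have core: "H t \<ge> (c / 2) * a ^ n" if "\<bar>t - x\<bar> \<le> d / 2" for t
    proof -
      have "a \<le> w t" unfolding w_def a_def using cosmono[of "t - x" "d/2"] that d by auto
      then have "a ^ n \<le> w t ^ n" using ab by (intro power_mono) auto
      moreover have "H t = (s * f t) * w t ^ n" by (simp add: H_def)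
      moreover have "c / 2 \<le> s * f t" using near that d by simp
      ultimately show ?thesis using ab c(1) w01
        using mult_mono[of "c / 2" "s * f t" "a ^ n" "w t ^ n"] by simp
    qed
    have i1: "\<bar>integral {x - pi..x - d} H\<bar> \<le> M * b ^ n * (pi - d)"
      using abs_integral_le[OF Hc, of "x - pi" "x - d" "M * b ^ n"] far d by auto
    have i2: "\<bar>integral {x + d..x + pi} H\<bar> \<le> M * b ^ n * (pi - d)"
      using abs_integral_le[OF Hc, of "x + d" "x + pi" "M * b ^ n"] far d by auto
    have i3: "integral {x - d..x + d} H \<ge> (c / 2) * a ^ n * d"
    proof -
      have "(c / 2) * a ^ n * d = integral {x - d/2..x + d/2} (\<lambda>t. (c / 2) * a ^ n)"
        using d by simp
      also have "\<dots> \<le> integral {x - d/2..x + d/2} H"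
      proof (rule integral_le[OF integrable_const_ivl HI])
        show "c / 2 * a ^ n \<le> H t" if "t \<in> {x - d/2..x + d/2}" for t
          using that by (intro core) (auto simp only: abs_le_iff atLeastAtMost_iff)
      qed
      also have "\<dots> \<le> integral {x - d..x + d} H"
        using d by (intro integral_subset_le HI) (auto simp: abs_le_iff intro!: mid)
      finally show ?thesis .
    qed
    have "integral {x - pi..x - d} H + integral {x - d..x + d} H = integral {x - pi..x + d} H"
      "integral {x - pi..x + d} H + integral {x + d..x + pi} H = integral {x - pi..x + pi} H"
      using d by (auto intro!: Henstock_Kurzweil_Integration.integral_combine HI)
    moreover have "integral {x - pi..x + pi} H = 0"
      unfolding H_def using wint[of n] by (simp only: integral_mult_right)
    ultimately have "(c / 2) * a ^ n * d \<le> 2 * (M * b ^ n * (pi - d))"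
      using i1 i2 i3 by linarith
    also have "\<dots> \<le> 2 * (M * b ^ n * pi)"
      using M ab d by (intro mult_left_mono) auto
    finally have "(c * d) * a ^ n \<le> 4 * M * pi * b ^ n" by (simp add: field_simps)
    moreover have "4 * M * pi * b ^ n < c * d * a ^ n"
    proof -
      have "4 * M * pi * b ^ n / (c * d * a ^ n) < 1"
        using n by (simp add: power_divide)
      then show ?thesis using c d ab by (simp add: divide_less_eq)
    qed
    ultimately show False by linarith
  qed
qed

section \<open>The Fourier expansion of a function with a given derivative\<close>

text \<open>The free phase \<open>y\<close> replaces the pair of coefficients. At
  \<open>y = real k * x\<close> this is the term of order \<open>k \<ge> 1\<close> of the Fourier
  series at \<open>x\<close>; translations of \<open>f\<close> and the parameter \<beta> become
  shifts of \<open>y\<close>.\<close>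

definition harmonic :: "(real \<Rightarrow> real) \<Rightarrow> nat \<Rightarrow> real \<Rightarrow> real" where
  "harmonic f k y = 1 / pi * integral {-pi..pi} (\<lambda>t. f t * cos (real k * t - y))"

lemma harmonic_eq:
  assumes "f \<in> C_per"
  shows "harmonic f k y = fourier_a f k * cos y + fourier_b f k * sin y"
proof -
  have I: "(\<lambda>t. f t * cos (real k * t)) integrable_on {-pi..pi}"
    "(\<lambda>t. f t * sin (real k * t)) integrable_on {-pi..pi}"
    using assms by (auto simp: C_per_def intro!: continuous_integrable continuous_intros)
  have "(\<lambda>t. f t * cos (real k * t - y)) =
      (\<lambda>t. cos y * (f t * cos (real k * t)) + sin y * (f t * sin (real k * t)))"
    by (auto simp: cos_diff algebra_simps)
  then have "integral {-pi..pi} (\<lambda>t. f t * cos (real k * t - y)) =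
      cos y * integral {-pi..pi} (\<lambda>t. f t * cos (real k * t)) +
      sin y * integral {-pi..pi} (\<lambda>t. f t * sin (real k * t))"
    by (simp only:) (intro integral_unique has_integral_add has_integral_mult_right integrable_integral I)
  then show ?thesis
    unfolding harmonic_def fourier_a_def fourier_b_def by (simp add: algebra_simps)
qed

lemma harmonic_abs_le:
  assumes "f \<in> C_per" "\<And>x. \<bar>f x\<bar> \<le> M"
  shows "\<bar>harmonic f k y\<bar> \<le> 2 * M"
proof -
  have "\<bar>integral {-pi..pi} (\<lambda>t. f t * cos (real k * t - y))\<bar> \<le> M * (pi - (-pi))"
  proof (rule abs_integral_le)
    show "continuous_on UNIV (\<lambda>t. f t * cos (real k * t - y))"
      using assms(1) by (auto simp: C_per_def intro!: continuous_intros)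
    show "\<bar>f t * cos (real k * t - y)\<bar> \<le> M" for t
      unfolding abs_mult using mult_mono[OF assms(2)[of t] abs_cos_le_one] assms(2)[of t] by fastforce
  qed auto
  then show ?thesis unfolding harmonic_def abs_mult by (simp add: field_simps)
qed

lemma integral_cos_int:
  "integral {-pi..pi} (\<lambda>t. cos (of_int j * t - z)) = (if j = 0 then 2 * pi * cos z else 0)"
proof (cases "j = 0")
  case False
  have "((\<lambda>t. cos (of_int j * t - z)) has_integral
      (sin (of_int j * pi - z) / of_int j - sin (of_int j * (-pi) - z) / of_int j)) {-pi..pi}"
    using False by (intro fundamental_theorem_of_calculus)
      (auto intro!: derivative_eq_intros simp flip: has_real_derivative_iff_has_vector_derivative)
  moreover have "sin (of_int j * pi - z) = sin (of_int j * (-pi) - z)"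
  proof -
    have "of_int j * pi - z = (of_int j * (-pi) - z) + 2 * pi * of_int j"
      by (simp add: algebra_simps)
    then show ?thesis by (simp only: sin_add cos_int_2pin sin_int_2pin)
  qed
  ultimately show ?thesis using False by (auto dest: integral_unique)
qed simp

text \<open>Product-to-sum formulas, with each sine written as a cosine shifted by
  \<open>pi / 2\<close> so that \<open>integral_cos_int\<close> covers every term. The condition
  \<open>k \<ge> 1\<close> rules out \<open>k + m = 0\<close>.\<close>

lemma harmonic_trig_term:
  assumes "k \<ge> 1"
  shows "harmonic (\<lambda>t. A * cos (real k * t) + B * sin (real k * t)) m y =
    (if k = m then A * cos y + B * sin y else 0)"
proof -
  have e: "(A * cos (real k * t) + B * sin (real k * t)) * cos (real m * t - y) =
     (A / 2) * cos (of_int (int k - int m) * t - (- y)) + (A / 2) * cos (of_int (int k + int m) * t - y)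
   + (B / 2) * cos (of_int (int k + int m) * t - (y + pi / 2))
   + (B / 2) * cos (of_int (int k - int m) * t - (pi / 2 - y))" for t
  proof -
    have s: "sin x = cos (x - pi / 2)" for x :: real by (simp add: cos_diff)
    have "of_int (int k - int m) * t - (- y) = real k * t - (real m * t - y)"
      "of_int (int k + int m) * t - y = real k * t + (real m * t - y)"
      "of_int (int k + int m) * t - (y + pi / 2) = (real k * t + (real m * t - y)) - pi / 2"
      "of_int (int k - int m) * t - (pi / 2 - y) = (real k * t - (real m * t - y)) - pi / 2"
      by (simp_all add: algebra_simps)
    then show ?thesis
      by (simp only: s[symmetric] cos_add cos_diff[of "real k * t"] sin_add sin_diff[of "real k * t"])
        (simp add: field_simps)
  qed
  have c: "(\<lambda>t. C * cos (of_int j * t - z)) integrable_on {-pi..pi}" for C j z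
    by (intro continuous_integrable continuous_intros)
  have "integral {-pi..pi} (\<lambda>t. (A * cos (real k * t) + B * sin (real k * t)) * cos (real m * t - y)) =
    (A / 2) * (if int k - int m = 0 then 2 * pi * cos (- y) else 0)
    + (A / 2) * (if int k + int m = 0 then 2 * pi * cos y else 0)
    + (B / 2) * (if int k + int m = 0 then 2 * pi * cos (y + pi / 2) else 0)
    + (B / 2) * (if int k - int m = 0 then 2 * pi * cos (pi / 2 - y) else 0)"
    unfolding e integral_cos_int[symmetric]
    by (simp only: integral_add integrable_add c integral_mult_right)
  also have "\<dots> = (if k = m then pi * (A * cos y + B * sin y) else 0)"
    using assms by (auto simp: cos_diff algebra_simps)
  finally show ?thesis unfolding harmonic_def by simp
qed

text \<open>Absolutely summable coefficients permit termwise integration, and orthogonality leaves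
  one term. The index \<open>Suc k\<close> sets apart the constant term, which carries the factor
  \<open>1 / 2\<close>.\<close>

lemma trig_series:
  fixes A B M :: "nat \<Rightarrow> real" and a0 :: real
  assumes M: "\<And>k. \<bar>A k\<bar> \<le> M k" "\<And>k. \<bar>B k\<bar> \<le> M k" "summable M"
  defines "S \<equiv> (\<lambda>x. a0 / 2 + (\<Sum>k. A k * cos (real (Suc k) * x) + B k * sin (real (Suc k) * x)))"
  shows "S \<in> C_per" "harmonic S 0 y = a0 * cos y"
    "harmonic S (Suc m) y = A m * cos y + B m * sin y"
proof -
  define h where "h = (\<lambda>k x. A k * cos (real (Suc k) * x) + B k * sin (real (Suc k) * x))"
  have hc: "continuous_on UNIV (h k)" for k unfolding h_def by (intro continuous_intros)
  have hb: "\<bar>h k x\<bar> \<le> 2 * M k" for k x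
  proof -
    have "\<bar>A k * cos (real (Suc k) * x)\<bar> \<le> M k * 1" "\<bar>B k * sin (real (Suc k) * x)\<bar> \<le> M k * 1"
      unfolding abs_mult
      by (intro mult_mono M abs_cos_le_one abs_sin_le_one abs_ge_zero order_trans[OF abs_ge_zero M(1)])+
    then show ?thesis unfolding h_def by linarith
  qed
  have Ms: "summable (\<lambda>k. 2 * M k)" using M(3) by (rule summable_mult)
  have S: "S = (\<lambda>x. a0 / 2 + (\<Sum>k. h k x))" by (simp add: S_def h_def)
  have Sc: "continuous_on UNIV (\<lambda>x. \<Sum>k. h k x)" by (rule continuous_on_suminf[OF hc hb Ms])
  have hper: "h k (x + 2 * pi) = h k x" for k x
  proof -
    have "real (Suc k) * (x + 2 * pi) = real (Suc k) * x + 2 * pi * of_int (int (Suc k))"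
      by (simp add: algebra_simps)
    then show ?thesis unfolding h_def
      by (simp only: cos_add sin_add cos_int_2pin sin_int_2pin) simp
  qed
  show "S \<in> C_per" unfolding S C_per_def using Sc hper by (auto intro!: continuous_intros)
  have sm: "summable (\<lambda>k. h k x)" for x
    by (rule summable_comparison_test'[OF Ms, of 0]) (use hb in auto)
  have main: "(\<lambda>k. harmonic (h k) m y) sums (harmonic S m y - (if m = 0 then a0 * cos y else 0))" for m
  proof -
    have gc: "continuous_on UNIV (\<lambda>t. h k t * cos (real m * t - y))" for k
      using hc by (auto intro!: continuous_intros)
    have gb: "\<bar>h k t * cos (real m * t - y)\<bar> \<le> 2 * M k" for k t
      unfolding abs_mult using mult_mono[OF hb[of k t] abs_cos_le_one] hb[of k t] by fastforce
    have "(\<lambda>k. integral {-pi..pi} (\<lambda>t. h k t * cos (real m * t - y))) sums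
       integral {-pi..pi} (\<lambda>t. \<Sum>k. h k t * cos (real m * t - y))"
      by (rule integral_suminf[OF gc gb Ms])
    also have "(\<lambda>t. \<Sum>k. h k t * cos (real m * t - y)) =
        (\<lambda>t. S t * cos (real m * t - y) - (a0 / 2) * cos (of_int (int m) * t - y))"
    proof
      fix t
      have "(\<Sum>k. h k t * cos (real m * t - y)) = (\<Sum>k. h k t) * cos (real m * t - y)"
        by (rule suminf_mult2[OF sm, symmetric])
      then show "(\<Sum>k. h k t * cos (real m * t - y)) =
          S t * cos (real m * t - y) - (a0 / 2) * cos (of_int (int m) * t - y)"
        unfolding S by (simp add: algebra_simps)
    qed
    also have "integral {-pi..pi} \<dots> = integral {-pi..pi} (\<lambda>t. S t * cos (real m * t - y)) -
        (a0 / 2) * integral {-pi..pi} (\<lambda>t. cos (of_int (int m) * t - y))"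
      using \<open>S \<in> C_per\<close> unfolding C_per_def
      by (subst integral_diff) (auto intro!: continuous_integrable continuous_intros)
    finally have "(\<lambda>k. 1 / pi * integral {-pi..pi} (\<lambda>t. h k t * cos (real m * t - y))) sums
       (1 / pi * (integral {-pi..pi} (\<lambda>t. S t * cos (real m * t - y)) -
        (a0 / 2) * integral {-pi..pi} (\<lambda>t. cos (of_int (int m) * t - y))))"
      by (rule sums_mult)
    then show ?thesis
      unfolding harmonic_def integral_cos_int by (auto simp: algebra_simps)
  qed
  have hk: "harmonic (h k) m y = (if Suc k = m then A k * cos y + B k * sin y else 0)" for k m
    unfolding h_def by (rule harmonic_trig_term) simp
  have "(\<lambda>k. harmonic (h k) 0 y) sums 0" unfolding hk by simp
  with main[of 0] show "harmonic S 0 y = a0 * cos y" by (simp add: sums_iff)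
  have "(\<lambda>k. harmonic (h k) (Suc m) y) sums (A m * cos y + B m * sin y)"
    unfolding hk using sums_single[of m "\<lambda>k. A k * cos y + B k * sin y"]
    by (simp add: eq_commute cong: if_cong)
  with main[of "Suc m"] show "harmonic S (Suc m) y = A m * cos y + B m * sin y"
    by (simp add: sums_iff)
qed

lemma harmonic_minus:
  assumes "f \<in> C_per" "g \<in> C_per"
  shows "harmonic (\<lambda>t. f t - g t) k y = harmonic f k y - harmonic g k y"
proof -
  have "integral {-pi..pi} (\<lambda>t. f t * cos (real k * t - y) - g t * cos (real k * t - y)) =
    integral {-pi..pi} (\<lambda>t. f t * cos (real k * t - y)) - integral {-pi..pi} (\<lambda>t. g t * cos (real k * t - y))"
    using assms by (intro integral_diff) (auto simp: C_per_def intro!: continuous_integrable continuous_intros)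
  then show ?thesis unfolding harmonic_def by (simp only: left_diff_distrib right_diff_distrib)
qed

lemma C_per_eqI:
  assumes "f \<in> C_per" "g \<in> C_per" "\<And>k y. harmonic f k y = harmonic g k y"
  shows "f x = g x"
proof -
  have "f x - g x = 0"
  proof (rule fourier_coefficients_zero[where f = "\<lambda>t. f t - g t"])
    show "(\<lambda>t. f t - g t) \<in> C_per" using assms(1,2) by (auto simp: C_per_def intro!: continuous_intros)
    show "integral {-pi..pi} (\<lambda>t. (f t - g t) * cos (real k * t - y)) = 0" for k y
      using harmonic_minus[OF assms(1,2), of k y] assms(3)[of k y] unfolding harmonic_def[of "\<lambda>t. f t - g t"]
      by simp
  qed
  then show ?thesis by simp
qed

text \<open>The relation \<open>is_psi_beta_deriv\<close> solved for the harmonics of the original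
  function: multiplication by \<psi>, and the phase turned back by \<open>\<beta> * pi / 2\<close>.
  The constant term, which the derivative does not determine, is taken as 0.\<close>

definition psi_beta_integral :: "(nat \<Rightarrow> real) \<Rightarrow> real \<Rightarrow> (real \<Rightarrow> real) \<Rightarrow> real \<Rightarrow> real" where
  "psi_beta_integral \<psi> \<beta> \<phi> x =
     (\<Sum>k. \<psi> (Suc k) * harmonic \<phi> (Suc k) (real (Suc k) * x - \<beta> * pi / 2))"

lemma psi_beta_integral:
  fixes a0 \<beta> :: real
  assumes \<phi>: "\<phi> \<in> C_per" and \<psi>: "summable (\<lambda>k. \<psi> (Suc k))" "\<And>k. k \<ge> 1 \<Longrightarrow> \<psi> k > 0"
  defines "S \<equiv> (\<lambda>x. a0 / 2 + psi_beta_integral \<psi> \<beta> \<phi> x)"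
  shows "S \<in> C_per" "harmonic S 0 y = a0 * cos y"
    "harmonic S (Suc m) y = \<psi> (Suc m) * harmonic \<phi> (Suc m) (y - \<beta> * pi / 2)"
proof -
  obtain M0 where M0: "\<And>x. \<bar>\<phi> x\<bar> \<le> M0" "M0 \<ge> 0" using C_per_bounded[OF \<phi>] by blast
  define g where "g = \<beta> * pi / 2"
  define A where "A = (\<lambda>k. \<psi> (Suc k) * harmonic \<phi> (Suc k) (- g))"
  define B where "B = (\<lambda>k. \<psi> (Suc k) * harmonic \<phi> (Suc k) (pi / 2 - g))"
  have AB: "\<psi> (Suc k) * harmonic \<phi> (Suc k) (y - g) = A k * cos y + B k * sin y" for k y
    unfolding A_def B_def harmonic_eq[OF \<phi>] by (simp add: cos_diff sin_diff algebra_simps)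
  define M where "M = (\<lambda>k. \<psi> (Suc k) * (2 * M0))"
  have M: "summable M" unfolding M_def by (rule summable_mult2[OF \<psi>(1)])
  have A: "\<bar>A k\<bar> \<le> M k" and B: "\<bar>B k\<bar> \<le> M k" for k
    unfolding A_def B_def M_def abs_mult using harmonic_abs_le[OF \<phi> M0(1)] \<psi>(2)[of "Suc k"]
    by (auto intro!: mult_mono)
  have S: "S = (\<lambda>x. a0 / 2 + (\<Sum>k. A k * cos (real (Suc k) * x) + B k * sin (real (Suc k) * x)))"
    unfolding S_def psi_beta_integral_def AB[symmetric] g_def ..
  show "S \<in> C_per" "harmonic S 0 y = a0 * cos y"
    "harmonic S (Suc m) y = \<psi> (Suc m) * harmonic \<phi> (Suc m) (y - \<beta> * pi / 2)"
    unfolding S AB[unfolded g_def] by (intro trig_series[OF A B M])+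
qed

text \<open>Supplies the member of the class for the lower bound, once an extremal derivative of
  mean zero is known.\<close>

lemma is_psi_beta_deriv_integral:
  assumes \<phi>: "\<phi> \<in> C_per" "fourier_a \<phi> 0 = 0"
    and \<psi>: "summable (\<lambda>k. \<psi> (Suc k))" "\<And>k. k \<ge> 1 \<Longrightarrow> \<psi> k > 0"
  shows "psi_beta_integral \<psi> \<beta> \<phi> \<in> C_per"
    "is_psi_beta_deriv \<psi> \<beta> (psi_beta_integral \<psi> \<beta> \<phi>) \<phi>"
proof -
  let ?S = "psi_beta_integral \<psi> \<beta> \<phi>"
  have e: "(\<lambda>x. 0 / 2 + ?S x) = ?S" by simp
  show C: "?S \<in> C_per"
    using psi_beta_integral(1)[OF \<phi>(1) \<psi>, of 0 \<beta>] unfolding e .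
  have S: "harmonic ?S (Suc m) y = \<psi> (Suc m) * harmonic \<phi> (Suc m) (y - \<beta> * pi / 2)" for m y
    using psi_beta_integral(3)[OF \<phi>(1) \<psi>, of 0 \<beta>] unfolding e .
  have "fourier_a \<phi> k * cos (real k * x) + fourier_b \<phi> k * sin (real k * x) =
     1 / \<psi> k * (fourier_a ?S k * cos (real k * x + \<beta> * pi / 2) +
                fourier_b ?S k * sin (real k * x + \<beta> * pi / 2))" if "k \<ge> 1" for k x
  proof -
    obtain m where m: "k = Suc m" using \<open>k \<ge> 1\<close> by (cases k) auto
    have "harmonic \<phi> k (real k * x) = 1 / \<psi> k * harmonic ?S k (real k * x + \<beta> * pi / 2)"
      using \<psi>(2)[OF that] unfolding m S by (simp del: of_nat_Suc)
    then show ?thesis by (simp only: harmonic_eq[OF C] harmonic_eq[OF \<phi>(1)])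
  qed
  then show "is_psi_beta_deriv \<psi> \<beta> ?S \<phi>"
    unfolding is_psi_beta_deriv_def using C \<phi> C_per_subset_L1_per by blast
qed

text \<open>Both sides of the first conclusion are continuous and have the same harmonics, so they
  agree at every point. This takes the place of a convergence theorem for the Fourier series of
  \<open>f\<close>.\<close>

lemma is_psi_beta_deriv_imp_integral:
  assumes f: "f \<in> C_per" and \<phi>: "\<phi> \<in> C_per" and d: "is_psi_beta_deriv \<psi> \<beta> f \<phi>"
    and \<psi>: "summable (\<lambda>k. \<psi> (Suc k))" "\<And>k. k \<ge> 1 \<Longrightarrow> \<psi> k > 0"
  shows "f x = fourier_a f 0 / 2 + psi_beta_integral \<psi> \<beta> \<phi> x"
    and "k \<ge> 1 \<Longrightarrow> harmonic f k y = \<psi> k * harmonic \<phi> k (y - \<beta> * pi / 2)"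
proof -
  have H: "harmonic f k y = \<psi> k * harmonic \<phi> k (y - \<beta> * pi / 2)" if "k \<ge> 1" for k y
  proof -
    \<comment> \<open>The derivative is defined by an identity in \<open>x\<close>; this choice
      turns it into one for an arbitrary phase \<open>y\<close>.\<close>
    define x where "x = (y - \<beta> * pi / 2) / real k"
    have x: "real k * x = y - \<beta> * pi / 2" "real k * x + \<beta> * pi / 2 = y"
      using that by (auto simp: x_def)
    from d that have "harmonic \<phi> k (real k * x) = 1 / \<psi> k * harmonic f k (real k * x + \<beta> * pi / 2)"
      unfolding harmonic_eq[OF f] harmonic_eq[OF \<phi>] is_psi_beta_deriv_def by blast
    with \<psi>(2)[OF that] show ?thesis unfolding x by simp
  qed
  then show "k \<ge> 1 \<Longrightarrow> harmonic f k y = \<psi> k * harmonic \<phi> k (y - \<beta> * pi / 2)" .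
  note S = psi_beta_integral[OF \<phi> \<psi>, of "fourier_a f 0" \<beta>]
  show "f x = fourier_a f 0 / 2 + psi_beta_integral \<psi> \<beta> \<phi> x"
  proof (rule C_per_eqI[OF f S(1)])
    show "harmonic f k y =
      harmonic (\<lambda>x. fourier_a f 0 / 2 + psi_beta_integral \<psi> \<beta> \<phi> x) k y" for k y
    proof (cases k)
      case 0
      have "fourier_b f 0 = 0" by (simp add: fourier_b_def)
      then have "harmonic f 0 y = fourier_a f 0 * cos y" unfolding harmonic_eq[OF f] by simp
      also have "\<dots> = harmonic (\<lambda>x. fourier_a f 0 / 2 + psi_beta_integral \<psi> \<beta> \<phi> x) 0 y"
        by (rule S(2)[symmetric])
      finally show ?thesis unfolding 0 .
    next
      case (Suc m)
      have "harmonic f (Suc m) y = \<psi> (Suc m) * harmonic \<phi> (Suc m) (y - \<beta> * pi / 2)"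
        by (rule H) simp
      also have "\<dots> = harmonic (\<lambda>x. fourier_a f 0 / 2 + psi_beta_integral \<psi> \<beta> \<phi> x) (Suc m) y"
        by (rule S(3)[symmetric])
      finally show ?thesis unfolding Suc .
    qed
  qed
qed

text \<open>\<open>T j\<close> lies in the tail starting at \<open>i\<close> exactly when
  \<open>i \<le> j\<close>, so \<open>min (j + 1) p\<close> of the \<open>p\<close> tails contain
  it. The general type serves both the real harmonics and the complex geometric series.\<close>

lemma sums_min_weight:
  fixes T :: "nat \<Rightarrow> 'a :: {real_normed_algebra_1, banach}"
  assumes "summable T"
  shows "(\<lambda>j. of_nat (min (Suc j) p) * T j) sums (\<Sum>i<p. \<Sum>k. T (k + i))"
proof (induction p)
  case (Suc p)
  have "(\<lambda>j. if j < p then 0 else T j) sums (\<Sum>k. T (k + p))"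
  proof -
    have "(\<lambda>k. (\<lambda>j. if j < p then 0 else T j) (k + p)) sums (\<Sum>k. T (k + p))"
      using summable_ignore_initial_segment[OF assms, of p] by (simp add: summable_sums)
    from sums_iff_shift[THEN iffD1, OF this] show ?thesis by simp
  qed
  from sums_add[OF Suc this]
  have "(\<lambda>j. of_nat (min (Suc j) p) * T j + (if j < p then 0 else T j)) sums (\<Sum>i<Suc p. \<Sum>k. T (k + i))"
    by simp
  moreover have "of_nat (min (Suc j) p) * T j + (if j < p then 0 else T j) =
      of_nat (min (Suc j) (Suc p)) * T j" for j
  proof (cases "j < p")
    case False
    then have "min (Suc j) p = p" "min (Suc j) (Suc p) = Suc p" by auto
    with False show ?thesis by (simp add: algebra_simps)
  qed (simp add: min_def)
  ultimately show ?case by simp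
qed simp

lemma fourier_sum_harmonic:
  assumes "f \<in> C_per"
  shows "fourier_sum m f x = fourier_a f 0 / 2 + (\<Sum>k<m. harmonic f (Suc k) (real (Suc k) * x))"
  unfolding fourier_sum_def harmonic_eq[OF assms] One_nat_def sum.atLeast1_atMost_eq ..

text \<open>Subtracting a mean of partial sums leaves the mean of \<open>p\<close> tails. The
  longest one, left by the partial sum of order \<open>n - p\<close>, begins with the harmonic of
  order \<open>n - p + 1\<close>.\<close>

lemma vallee_poussin_remainder:
  assumes f: "f \<in> C_per" and np: "1 \<le> p" "p \<le> n"
    and T: "summable (\<lambda>k. harmonic f (Suc k) (real (Suc k) * x))"
    and fx: "f x = fourier_a f 0 / 2 + (\<Sum>k. harmonic f (Suc k) (real (Suc k) * x))"
  shows "(\<lambda>j. real (min (Suc j) p) * harmonic f (n - p + 1 + j) (real (n - p + 1 + j) * x)) sums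
    (real p * (f x - vallee_poussin n p f x))"
proof -
  define T where "T = (\<lambda>k. harmonic f (Suc k) (real (Suc k) * x))"
  define m where "m = n - p"
  have sT: "summable T" using T unfolding T_def .
  have d: "f x - fourier_sum j f x = (\<Sum>k. T (k + j))" for j
    unfolding fx fourier_sum_harmonic[OF f] T_def[symmetric]
    using suminf_split_initial_segment[OF sT, of j] by simp
  have "real p * (f x - vallee_poussin n p f x) = (\<Sum>j\<in>{m..n-1}. f x - fourier_sum j f x)"
  proof -
    have "card {m..n-1} = p" using np by (auto simp: m_def)
    then show ?thesis using np
      by (simp add: vallee_poussin_def sum_subtractf m_def right_diff_distrib)
  qed
  also have "\<dots> = (\<Sum>i<p. \<Sum>k. T (k + i + m))"
  proof -
    have "{m..n-1} = (\<lambda>i. i + m) ` {..<p}"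
    proof -
      have "{m..n-1} = {0 + m..<p + m}" using np by (auto simp: m_def)
      then show ?thesis by (simp only: image_add_atLeastLessThan' lessThan_atLeast0)
    qed
    then have "(\<Sum>j\<in>{m..n-1}. f x - fourier_sum j f x) = (\<Sum>i<p. f x - fourier_sum (i + m) f x)"
      by (simp add: sum.reindex)
    then show ?thesis unfolding d by (simp add: add.assoc)
  qed
  finally have "real p * (f x - vallee_poussin n p f x) = (\<Sum>i<p. \<Sum>k. T (k + i + m))" .
  with sums_min_weight[OF summable_ignore_initial_segment[OF sT, of m], of p] show ?thesis
    by (simp add: T_def m_def add_ac)
qed

section \<open>Integrals against an oscillating kernel\<close>

lemma sum_integral_adjacent:
  fixes h :: "real \<Rightarrow> real" and v :: "nat \<Rightarrow> real"
  assumes "continuous_on UNIV h" "\<And>i. v i \<le> v (Suc i)"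
  shows "(\<Sum>i<n. integral {v i..v (Suc i)} h) = integral {v 0..v n} h"
proof (induction n)
  case (Suc n)
  have "v 0 \<le> v n" by (rule lift_Suc_mono_le[of v]) (use assms(2) in auto)
  with Suc show ?case
    using Henstock_Kurzweil_Integration.integral_combine[of "v 0" "v n" "v (Suc n)" h] assms(2)
      continuous_integrable[OF assms(1)] by simp
qed simp

text \<open>Amplitude and phase enter with separate constants so that each error shows its source:
  \<open>L\<close> comes from freezing \<open>g\<close>, and \<open>G * \<kappa>\<close> from the
  uneven spacing of the peaks. \<open>N_large\<close> confines consecutive gaps to between
  \<open>pi / N\<close> and \<open>3 * pi / N\<close>.\<close>

locale oscillating_kernel =
  fixes g :: "real \<Rightarrow> complex" and \<alpha> :: "real \<Rightarrow> real" and L G \<kappa> c :: real and N :: nat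
  assumes N_pos: "N \<ge> 1"
    and g_periodic: "g (t + 2 * pi) = g t"
    and \<alpha>_periodic: "\<alpha> (t + 2 * pi) = \<alpha> t"
    and polar: "g t = of_real (cmod (g t)) * cis (\<alpha> t)"
    and g_lipschitz: "cmod (g t - g s) \<le> L * \<bar>t - s\<bar>"
    and g_bounded: "cmod (g t) \<le> G"
    and \<alpha>_lipschitz: "\<bar>\<alpha> t - \<alpha> s\<bar> \<le> \<kappa> * \<bar>t - s\<bar>"
    and \<alpha>_bounded: "\<bar>\<alpha> t\<bar> \<le> 3 * pi"
    and N_large: "2 * \<kappa> \<le> real N"
begin

definition kernel :: "real \<Rightarrow> real" where
  "kernel t = Re (cis (real N * t + c) * g t)"

text \<open>The points where the carrier \<open>cis (N * t + c)\<close> equals 1; \<open>g\<close>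
  is frozen at them.\<close>

definition node :: "int \<Rightarrow> real" where
  "node i = (2 * pi * of_int i - c) / real N"

text \<open>Up to \<open>O(1 / N)\<close> the phase \<open>N t + c + \<alpha> t\<close> of the kernel equals \<open>2 \<pi> i\<close> at \<open>peak i\<close>.\<close>

definition peak :: "int \<Rightarrow> real" where
  "peak i = node i - \<alpha> (node i) / real N"

definition amp :: "int \<Rightarrow> real" where
  "amp i = cmod (g (node i))"

definition cell :: "(real \<Rightarrow> real) \<Rightarrow> int \<Rightarrow> real" where
  "cell \<phi> i = integral {-pi..pi} (\<lambda>x. \<phi> (peak i + x / real N) * cos x)"

lemma L_nonneg: "L \<ge> 0"
  using order_trans[OF norm_ge_zero g_lipschitz[of 1 0]] by simp

lemma \<kappa>_nonneg: "\<kappa> \<ge> 0"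
  using order_trans[OF abs_ge_zero \<alpha>_lipschitz[of 1 0]] by simp

lemma G_nonneg: "G \<ge> 0"
  using order_trans[OF norm_ge_zero g_bounded[of 0]] .

lemma N0: "real N > 0" using N_pos by simp

lemma g_continuous: "continuous_on UNIV g"
proof (rule continuous_on_iff[THEN iffD2], intro ballI allI impI)
  fix x e :: real assume e: "e > 0"
  show "\<exists>d>0. \<forall>x'\<in>UNIV. dist x' x < d \<longrightarrow> dist (g x') (g x) < e"
  proof (intro exI[of _ "e / (L + 1)"] conjI ballI impI)
    show "e / (L + 1) > 0" using e L_nonneg by simp
    fix x' assume "dist x' x < e / (L + 1)"
    then have "(L + 1) * \<bar>x' - x\<bar> < e"
      using L_nonneg by (simp add: dist_real_def pos_less_divide_eq mult.commute)
    moreover have "cmod (g x' - g x) \<le> (L + 1) * \<bar>x' - x\<bar>"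
      using g_lipschitz[of x' x] by (simp add: distrib_right)
    ultimately show "dist (g x') (g x) < e" by (simp add: dist_norm)
  qed
qed

lemma kernel_C_per: "kernel \<in> C_per"
proof -
  have "cis (real N * (t + 2 * pi) + c) = cis (real N * t + c)" for t
  proof -
    have "real N * (t + 2 * pi) + c = (real N * t + c) + 2 * pi * of_int (int N)"
      by (simp add: algebra_simps)
    then show ?thesis
      by (simp only: complex_eq_iff cis.simps cos_add sin_add cos_int_2pin sin_int_2pin) simp
  qed
  then have "kernel (t + 2 * pi) = kernel t" for t
    unfolding kernel_def by (simp only: g_periodic)
  moreover have "continuous_on UNIV (\<lambda>t. cis (real N * t + c))"
    unfolding cis_conv_exp by (intro continuous_intros)
  then have "continuous_on UNIV kernel"
    unfolding kernel_def using g_continuous by (intro continuous_intros)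
  ultimately show ?thesis by (simp add: C_per_def)
qed

lemma node_diff: "node j - node i = 2 * pi / real N * of_int (j - i)"
  by (simp add: node_def diff_divide_distrib algebra_simps)

lemma node_Suc: "node (i + 1) - node i = 2 * pi / real N"
  by (simp add: node_diff)

lemma peak_diff: "\<bar>(peak j - peak i) - (node j - node i)\<bar> \<le> \<kappa> * \<bar>node j - node i\<bar> / real N"
proof -
  have "(peak j - peak i) - (node j - node i) = (\<alpha> (node i) - \<alpha> (node j)) / real N"
    by (simp add: peak_def diff_divide_distrib)
  then have "\<bar>(peak j - peak i) - (node j - node i)\<bar> = \<bar>\<alpha> (node j) - \<alpha> (node i)\<bar> / real N"
    by (simp add: abs_minus_commute)
  with divide_right_mono[OF \<alpha>_lipschitz[of "node j" "node i"], of "real N"] show ?thesis by simp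
qed

lemma peak_Suc: "\<bar>peak (i + 1) - peak i - 2 * pi / real N\<bar> \<le> 2 * pi * \<kappa> / real N ^ 2"
  using peak_diff[of "i + 1" i] by (simp add: node_Suc power2_eq_square mult_ac)

lemma gap_error: "2 * pi * \<kappa> / real N ^ 2 \<le> pi / real N"
proof -
  have "(2 * \<kappa>) * (pi / real N ^ 2) \<le> real N * (pi / real N ^ 2)"
    by (intro mult_right_mono N_large) auto
  then show ?thesis using N0 by (simp add: power2_eq_square mult_ac)
qed

lemma peak_node: "\<bar>peak i - node i\<bar> \<le> 3 * pi / real N"
  using divide_right_mono[OF \<alpha>_bounded[of "node i"], of "real N"] by (simp add: peak_def)

lemma node_shift: "node (i + int N) = node i + 2 * pi"
  using node_diff[of "i + int N" i] N0 by (simp add: field_simps)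

lemma peak_shift: "peak (i + int N) = peak i + 2 * pi"
  by (simp add: peak_def node_shift \<alpha>_periodic)

lemma amp_bounds: "0 \<le> amp i" "amp i \<le> G"
  by (simp_all add: amp_def g_bounded)

text \<open>The polar form at the node contributes the constant phase
  \<open>\<alpha> (node i)\<close>, and the displacement of \<open>peak i\<close> from
  \<open>node i\<close> is exactly what absorbs it; only a multiple of \<open>2 * pi\<close>
  remains.\<close>

lemma frozen_kernel: "Re (cis (real N * t + c) * g (node i)) = amp i * cos (real N * (t - peak i))"
proof -
  have "real N * (t - peak i) = (real N * t + c + \<alpha> (node i)) + 2 * pi * of_int (- i)"
    unfolding peak_def node_def using N0 by (simp add: field_simps)
  then have "cos (real N * (t - peak i)) = cos (real N * t + c + \<alpha> (node i))"
    by (simp only: cos_add[of "real N * t + c + \<alpha> (node i)"] cos_int_2pin sin_int_2pin)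
  moreover have "Re (cis (real N * t + c) * (of_real r * cis a)) = r * cos (real N * t + c + a)" for r a
    by (simp add: cos_add algebra_simps)
  ultimately show ?thesis unfolding amp_def by (subst polar) simp
qed

lemma integral_frozen:
  assumes "continuous_on UNIV \<phi>"
  shows "integral {peak i - pi / real N..peak i + pi / real N} (\<lambda>t. \<phi> t * cos (real N * (t - peak i)))
    = cell \<phi> i / real N"
proof -
  define h where "h = (\<lambda>x. \<phi> (peak i + x / real N) * cos x)"
  have "continuous_on UNIV h"
    unfolding h_def using N0 by (intro continuous_intros continuous_on_compose2[OF assms]) auto
  from integral_affine[OF this N0, of "peak i - pi / real N" "peak i + pi / real N" "- (real N * peak i)"]
  have "integral {peak i - pi / real N..peak i + pi / real N} (\<lambda>x. h (real N * x - real N * peak i))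
     = integral {-pi..pi} h / real N"
    using N0 N_pos by (simp add: algebra_simps)
  moreover have "h (real N * t - real N * peak i) = \<phi> t * cos (real N * (t - peak i))" for t
    unfolding h_def right_diff_distrib[symmetric] using N0 by simp
  ultimately show ?thesis unfolding cell_def h_def by simp
qed

text \<open>Two replacements are made between consecutive troughs. Freezing \<open>g\<close> costs
  \<open>L\<close> times a distance of at most \<open>5 * pi / N\<close> on an interval of length at
  most \<open>3 * pi / N\<close>, hence the 15. Changing the interval into a full period costs
  \<open>B * G\<close> times the gap error \<open>2 * pi * \<kappa> / N ^ 2\<close>.\<close>

lemma integral_kernel_cell:
  assumes \<phi>: "continuous_on UNIV \<phi>" "\<And>x. \<bar>\<phi> x\<bar> \<le> B"
  defines "v \<equiv> \<lambda>i. peak i - pi / real N"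
  shows "v i \<le> v (i + 1)"
    "\<bar>integral {v i..v (i + 1)} (\<lambda>t. \<phi> t * kernel t) - amp i * cell \<phi> i / real N\<bar>
      \<le> B * (15 * pi\<^sup>2 * L + 2 * pi * (G * \<kappa>)) / real N ^ 2"
proof -
  have B: "B \<ge> 0" using order_trans[OF abs_ge_zero \<phi>(2)] .
  define d where "d = 2 * pi * \<kappa> / real N ^ 2"
  define w where "w = pi / real N"
  have w: "w > 0" using N0 by (simp add: w_def)
  have d: "d \<le> w" unfolding d_def w_def by (rule gap_error)
  have gap: "\<bar>v (i + 1) - v i - 2 * w\<bar> \<le> d"
    using peak_Suc[of i] by (simp add: v_def d_def w_def)
  with d w show mono: "v i \<le> v (i + 1)" by linarith
  define F where "F = (\<lambda>t. \<phi> t * (amp i * cos (real N * (t - peak i))))"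
  have Fc: "continuous_on UNIV F" unfolding F_def by (intro continuous_intros \<phi>)
  have Kc: "continuous_on UNIV (\<lambda>t. \<phi> t * kernel t)"
    using kernel_C_per by (auto simp: C_per_def intro!: continuous_intros \<phi>)
  have Fb: "\<bar>F t\<bar> \<le> B * G" for t
  proof -
    have "\<bar>amp i * cos (real N * (t - peak i))\<bar> \<le> G * 1"
      unfolding abs_mult using amp_bounds[of i] by (intro mult_mono abs_cos_le_one) auto
    then show ?thesis unfolding F_def abs_mult[of "\<phi> t"] using \<phi>(2)[of t] B by (intro mult_mono) auto
  qed
  have "\<bar>integral {v i..v (i + 1)} (\<lambda>t. \<phi> t * kernel t - F t)\<bar>
     \<le> B * (L * (5 * w)) * (v (i + 1) - v i)"
  proof (rule abs_integral_le[OF _ mono])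
    show "continuous_on UNIV (\<lambda>t. \<phi> t * kernel t - F t)" by (intro continuous_intros Fc Kc)
    fix t assume t: "v i \<le> t" "t \<le> v (i + 1)"
    \<comment> \<open>The interval runs from \<open>peak i - w\<close> to at most
      \<open>peak i + 2 * w\<close>, and the peak is within \<open>3 * w\<close> of its
      node.\<close>
    have "\<bar>t - node i\<bar> \<le> 5 * w"
    proof -
      have "v i = peak i - w" by (simp add: v_def w_def)
      moreover have "\<bar>peak i - node i\<bar> \<le> 3 * w" using peak_node[of i] by (simp add: w_def)
      ultimately show ?thesis using t gap d w by linarith
    qed
    then have "cmod (g t - g (node i)) \<le> L * (5 * w)"
      using g_lipschitz[of t "node i"] L_nonneg by (meson mult_left_mono order_trans)
    moreover have "\<phi> t * kernel t - F t = \<phi> t * Re (cis (real N * t + c) * (g t - g (node i)))"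
      unfolding F_def frozen_kernel[symmetric] kernel_def by (simp add: algebra_simps)
    moreover have "\<bar>Re (cis (real N * t + c) * (g t - g (node i)))\<bar> \<le> cmod (g t - g (node i))"
      using abs_Re_le_cmod[of "cis (real N * t + c) * (g t - g (node i))"] by (simp add: norm_mult)
    ultimately show "\<bar>\<phi> t * kernel t - F t\<bar> \<le> B * (L * (5 * w))"
      unfolding abs_mult using \<phi>(2)[of t] B by (simp only: abs_mult) (intro mult_mono, auto)
  qed
  also have "\<dots> \<le> B * (L * (5 * w)) * (3 * w)"
    using gap d w B L_nonneg by (intro mult_left_mono) auto
  finally have 1: "\<bar>integral {v i..v (i + 1)} (\<lambda>t. \<phi> t * kernel t) - integral {v i..v (i + 1)} F\<bar>
     \<le> B * (L * (5 * w)) * (3 * w)"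
    by (simp add: integral_diff continuous_integrable[OF Fc] continuous_integrable[OF Kc])
  have 2: "\<bar>integral {v i..v (i + 1)} F - integral {v i..v i + 2 * w} F\<bar> \<le> B * G * \<bar>v (i + 1) - (v i + 2 * w)\<bar>"
    using w mono by (intro abs_integral_diff_endpoint[OF Fc _ _ Fb]) auto
  have "B * G * \<bar>v (i + 1) - (v i + 2 * w)\<bar> \<le> B * G * d"
    using gap B G_nonneg by (intro mult_left_mono) auto
  moreover have "integral {v i..v i + 2 * w} F = amp i * cell \<phi> i / real N"
  proof -
    have "integral {v i..v i + 2 * w} F =
      integral {peak i - w..peak i + w} (\<lambda>t. amp i * (\<phi> t * cos (real N * (t - peak i))))"
      unfolding F_def v_def w_def by (simp add: mult_ac add.commute)
    also have "\<dots> = amp i * (cell \<phi> i / real N)"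
      using integral_frozen[OF \<phi>(1), of i] unfolding w_def by (simp only: integral_mult_right)
    finally show ?thesis by simp
  qed
  ultimately have "\<bar>integral {v i..v (i + 1)} (\<lambda>t. \<phi> t * kernel t) - amp i * cell \<phi> i / real N\<bar>
     \<le> B * (L * (5 * w)) * (3 * w) + B * G * d"
    using 1 2 by linarith
  also have "\<dots> = B * (15 * pi\<^sup>2 * L + 2 * pi * (G * \<kappa>)) / real N ^ 2"
    unfolding w_def d_def by (simp add: add_divide_distrib algebra_simps power2_eq_square)
  finally show "\<bar>integral {v i..v (i + 1)} (\<lambda>t. \<phi> t * kernel t) - amp i * cell \<phi> i / real N\<bar>
      \<le> B * (15 * pi\<^sup>2 * L + 2 * pi * (G * \<kappa>)) / real N ^ 2" .
qed

text \<open>The \<open>N\<close> cells together cover exactly one period of length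
  \<open>2 * pi\<close>, because raising the index by \<open>N\<close> moves a peak by
  \<open>2 * pi\<close>; \<open>N\<close> errors of order \<open>1 / N ^ 2\<close> add up.\<close>

lemma integral_kernel:
  assumes \<phi>: "\<phi> \<in> C_per" "\<And>x. \<bar>\<phi> x\<bar> \<le> B"
  shows "\<bar>integral {-pi..pi} (\<lambda>t. \<phi> t * kernel t) - (\<Sum>i<N. amp (int i) * cell \<phi> (int i)) / real N\<bar>
      \<le> B * (15 * pi\<^sup>2 * L + 2 * pi * (G * \<kappa>)) / real N"
proof -
  define v where "v = (\<lambda>i. peak (int i) - pi / real N)"
  have c: "continuous_on UNIV \<phi>" using \<phi>(1) by (rule C_per_continuous)
  note cells = integral_kernel_cell[OF c \<phi>(2)]
  have P: "(\<lambda>t. \<phi> t * kernel t) \<in> C_per"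
    using \<phi>(1) kernel_C_per by (auto simp: C_per_def intro!: continuous_intros)
  have "v N = v 0 + 2 * pi" using peak_shift[of 0] by (simp add: v_def)
  then have "integral {-pi..pi} (\<lambda>t. \<phi> t * kernel t) = integral {v 0..v N} (\<lambda>t. \<phi> t * kernel t)"
    using C_per_integral[OF P, of "v 0"] by simp
  also have "\<dots> = (\<Sum>i<N. integral {v i..v (Suc i)} (\<lambda>t. \<phi> t * kernel t))"
    by (rule sum_integral_adjacent[symmetric, OF C_per_continuous[OF P]])
      (use cells(1) in \<open>auto simp: v_def add.commute[of 1]\<close>)
  finally have "\<bar>integral {-pi..pi} (\<lambda>t. \<phi> t * kernel t) - (\<Sum>i<N. amp (int i) * cell \<phi> (int i)) / real N\<bar>
    = \<bar>\<Sum>i<N. integral {v i..v (Suc i)} (\<lambda>t. \<phi> t * kernel t) - amp (int i) * cell \<phi> (int i) / real N\<bar>"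
    by (simp add: sum_subtractf sum_divide_distrib)
  also have "\<dots> \<le> (\<Sum>i<N. \<bar>integral {v i..v (Suc i)} (\<lambda>t. \<phi> t * kernel t) - amp (int i) * cell \<phi> (int i) / real N\<bar>)"
    by (rule sum_abs)
  also have "\<dots> \<le> (\<Sum>i<N. B * (15 * pi\<^sup>2 * L + 2 * pi * (G * \<kappa>)) / real N ^ 2)"
    by (intro sum_mono) (use cells(2) in \<open>simp add: v_def add.commute[of 1]\<close>)
  also have "\<dots> = B * (15 * pi\<^sup>2 * L + 2 * pi * (G * \<kappa>)) / real N"
    using N0 by (simp add: power2_eq_square)
  finally show ?thesis .
qed

text \<open>A Riemann sum of \<open>cmod (g t)\<close> with step \<open>2 * pi / N\<close>; the
  modulus inherits the Lipschitz constant \<open>L\<close>.\<close>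

lemma sum_amp:
  "\<bar>2 * pi / real N * (\<Sum>i<N. amp (int i)) - integral {-pi..pi} (\<lambda>t. cmod (g t))\<bar> \<le> 4 * pi\<^sup>2 * L / real N"
proof -
  define a where "a = (\<lambda>t. cmod (g t))"
  define w where "w = 2 * pi / real N"
  have w: "w > 0" using N0 by (simp add: w_def)
  have ac: "continuous_on UNIV a" unfolding a_def by (intro continuous_intros g_continuous)
  have P: "a \<in> C_per" using ac by (auto simp: C_per_def a_def g_periodic)
  have step: "node (int (Suc i)) = node (int i) + w" for i
    using node_Suc[of "int i"] by (simp add: w_def add.commute)
  have cellerr: "\<bar>integral {node (int i)..node (int (Suc i))} a - w * amp (int i)\<bar> \<le> L * w * w" for i
  proof -
    let ?u = "node (int i)"
    have "\<bar>integral {?u..?u + w} (\<lambda>t. a t - a ?u)\<bar> \<le> L * w * ((?u + w) - ?u)"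
    proof (rule abs_integral_le)
      show "continuous_on UNIV (\<lambda>t. a t - a ?u)" by (intro continuous_intros ac)
      show "\<bar>a t - a ?u\<bar> \<le> L * w" if "?u \<le> t" "t \<le> ?u + w" for t
      proof -
        have "\<bar>a t - a ?u\<bar> \<le> L * \<bar>t - ?u\<bar>"
          unfolding a_def by (rule order_trans[OF norm_triangle_ineq3 g_lipschitz])
        also have "\<dots> \<le> L * w" using that L_nonneg by (intro mult_left_mono) auto
        finally show ?thesis .
      qed
    qed (use w in auto)
    moreover have "integral {?u..?u + w} (\<lambda>t. a t - a ?u) = integral {?u..?u + w} a - w * a ?u"
      using w by (subst integral_diff) (auto intro: continuous_integrable[OF ac])
    ultimately show ?thesis unfolding step by (simp add: amp_def a_def)
  qed
  have "node (int N) = node (int 0) + 2 * pi" using node_shift[of 0] by simp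
  then have "integral {-pi..pi} a = integral {node (int 0)..node (int N)} a"
    using C_per_integral[OF P, of "node (int 0)"] by simp
  also have "\<dots> = (\<Sum>i<N. integral {node (int i)..node (int (Suc i))} a)"
    using w by (intro sum_integral_adjacent[symmetric, OF ac]) (simp add: step less_imp_le del: of_nat_Suc)
  finally have "\<bar>w * (\<Sum>i<N. amp (int i)) - integral {-pi..pi} a\<bar>
    = \<bar>\<Sum>i<N. integral {node (int i)..node (int (Suc i))} a - w * amp (int i)\<bar>"
    by (simp add: sum_subtractf sum_distrib_left abs_minus_commute del: of_nat_Suc)
  also have "\<dots> \<le> (\<Sum>i<N. L * w * w)"
    by (rule order_trans[OF sum_abs sum_mono]) (rule cellerr)
  also have "\<dots> = 4 * pi\<^sup>2 * L / real N"
    using N0 by (simp add: w_def power2_eq_square)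
  finally show ?thesis unfolding a_def w_def .
qed

end

section \<open>Moduli of continuity and the extremal function\<close>

context
  fixes \<omega> :: "real \<Rightarrow> real"
  assumes mod: "modulus_of_continuity \<omega>"
begin

lemma modulus_zero: "\<omega> 0 = 0"
  and modulus_mono: "0 \<le> s \<Longrightarrow> s \<le> t \<Longrightarrow> \<omega> s \<le> \<omega> t"
  and modulus_subadd: "0 \<le> s \<Longrightarrow> 0 \<le> t \<Longrightarrow> \<omega> (s + t) \<le> \<omega> s + \<omega> t"
  and modulus_continuous: "continuous_on {0..} \<omega>"
  using mod by (auto simp: modulus_of_continuity_def mono_on_def)

lemma modulus_nonneg: "0 \<le> t \<Longrightarrow> 0 \<le> \<omega> t"
  using modulus_mono[of 0 t] modulus_zero by simp

lemma modulus_double: "0 \<le> t \<Longrightarrow> \<omega> (2 * t) \<le> 2 * \<omega> t"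
  using modulus_subadd[of t t] by simp

lemma modulus_imp_continuous:
  fixes \<phi> :: "real \<Rightarrow> real"
  assumes "\<And>x y. \<bar>\<phi> x - \<phi> y\<bar> \<le> \<omega> \<bar>x - y\<bar>"
  shows "continuous_on UNIV \<phi>"
proof (rule continuous_on_iff[THEN iffD2], intro ballI allI impI)
  fix x e :: real assume "e > 0"
  then obtain d where d: "d > 0" "\<And>t. t \<ge> 0 \<Longrightarrow> \<bar>t\<bar> < d \<Longrightarrow> \<bar>\<omega> t\<bar> < e"
    using modulus_continuous modulus_zero unfolding continuous_on_iff dist_real_def
    by (metis atLeast_iff diff_zero order_refl)
  show "\<exists>d>0. \<forall>x'\<in>UNIV. dist x' x < d \<longrightarrow> dist (\<phi> x') (\<phi> x) < e"
  proof (intro exI[of _ d] conjI ballI impI d(1))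
    fix x' assume "dist x' x < d"
    then have "\<bar>\<omega> \<bar>x' - x\<bar>\<bar> < e" by (intro d(2)) (auto simp: dist_real_def)
    with assms[of x' x] show "dist (\<phi> x') (\<phi> x) < e" by (simp add: dist_real_def)
  qed
qed

text \<open>A continuous periodic function is bounded, so both suprema in the definition are genuine
  and dominate each single increment.\<close>

lemma H_class_iff:
  "\<phi> \<in> H_class \<omega> \<longleftrightarrow> \<phi> \<in> C_per \<and> (\<forall>x y. \<bar>\<phi> x - \<phi> y\<bar> \<le> \<omega> \<bar>x - y\<bar>)"
proof (intro iffI conjI allI)
  assume H: "\<phi> \<in> H_class \<omega>"
  then show C: "\<phi> \<in> C_per" by (simp add: H_class_def)
  fix x y
  obtain M where M: "\<And>x. \<bar>\<phi> x\<bar> \<le> M" using C_per_bounded[OF C] by blast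
  have b: "\<bar>\<phi> (x + h) - \<phi> x\<bar> \<le> 2 * M" for x h using M[of "x + h"] M[of x] by linarith
  have nb: "norm_C (\<lambda>x. \<phi> (x + h) - \<phi> x) \<le> 2 * M" for h
    unfolding norm_C_def by (rule cSUP_least) (use b in auto)
  have "\<bar>\<phi> x - \<phi> y\<bar> \<le> norm_C (\<lambda>z. \<phi> (z + (x - y)) - \<phi> z)"
    unfolding norm_C_def
    by (rule cSUP_upper2[where x = y]) (use b[of _ "x - y"] in \<open>auto intro!: bdd_aboveI[of _ "2 * M"]\<close>)
  also have "\<dots> \<le> modulus_of \<phi> \<bar>x - y\<bar>"
    unfolding modulus_of_def
    by (rule cSUP_upper2[where x = "x - y"]) (use nb in \<open>auto intro!: bdd_aboveI[of _ "2 * M"]\<close>)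
  also have "\<dots> \<le> \<omega> \<bar>x - y\<bar>" using H by (simp add: H_class_def)
  finally show "\<bar>\<phi> x - \<phi> y\<bar> \<le> \<omega> \<bar>x - y\<bar>" .
next
  assume a: "\<phi> \<in> C_per \<and> (\<forall>x y. \<bar>\<phi> x - \<phi> y\<bar> \<le> \<omega> \<bar>x - y\<bar>)"
  have "modulus_of \<phi> t \<le> \<omega> t" if "t \<ge> 0" for t
    unfolding modulus_of_def norm_C_def
  proof (intro cSUP_least)
    fix h x assume "h \<in> {h. \<bar>h\<bar> \<le> t}"
    then have "\<omega> \<bar>h\<bar> \<le> \<omega> t" by (intro modulus_mono) auto
    moreover have "\<bar>\<phi> (x + h) - \<phi> x\<bar> \<le> \<omega> \<bar>x + h - x\<bar>" using a by blast
    ultimately show "\<bar>\<phi> (x + h) - \<phi> x\<bar> \<le> \<omega> t" by simp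
  qed (use that in \<open>auto intro: exI[of _ 0]\<close>)
  with a show "\<phi> \<in> H_class \<omega>" by (simp add: H_class_def)
qed

text \<open>With mean zero, a value is the average of its differences to all values on a period.
  These are taken over distances of at most \<open>2 * pi\<close>, and
  \<open>\<omega> (2 * pi) \<le> 2 * \<omega> pi\<close>.\<close>

lemma mean_zero_abs_le:
  assumes \<phi>: "\<phi> \<in> C_per" "\<And>x y. \<bar>\<phi> x - \<phi> y\<bar> \<le> \<omega> \<bar>x - y\<bar>" "integral {-pi..pi} \<phi> = 0"
  shows "\<bar>\<phi> x\<bar> \<le> 2 * \<omega> pi"
proof -
  have c: "continuous_on UNIV \<phi>" by (rule C_per_continuous[OF \<phi>(1)])
  obtain y where y: "- pi \<le> y" "y \<le> pi" "\<phi> y = \<phi> x" using C_per_reduce[OF \<phi>(1)] by metis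
  have "\<bar>integral {-pi..pi} (\<lambda>t. \<phi> y - \<phi> t)\<bar> \<le> 2 * \<omega> pi * (pi - (- pi))"
  proof (rule abs_integral_le)
    show "continuous_on UNIV (\<lambda>t. \<phi> y - \<phi> t)" by (intro continuous_intros c)
    fix t assume "- pi \<le> t" "t \<le> pi"
    then have "\<omega> \<bar>y - t\<bar> \<le> \<omega> (2 * pi)" using y by (intro modulus_mono) auto
    with \<phi>(2)[of y t] modulus_double[of pi] show "\<bar>\<phi> y - \<phi> t\<bar> \<le> 2 * \<omega> pi" by simp
  qed auto
  moreover have "integral {-pi..pi} (\<lambda>t. \<phi> y - \<phi> t) = 2 * pi * \<phi> y"
    using \<phi>(3) by (subst integral_diff) (auto intro: continuous_integrable[OF c])
  ultimately show ?thesis using y(3) by (simp add: abs_mult)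
qed

text \<open>The shift by half a period of \<open>cos (k t)\<close> changes its sign.\<close>

lemma harmonic_modulus_le:
  assumes \<phi>: "\<phi> \<in> C_per" "\<And>x y. \<bar>\<phi> x - \<phi> y\<bar> \<le> \<omega> \<bar>x - y\<bar>" and k: "k \<ge> 1"
  shows "\<bar>harmonic \<phi> k y\<bar> \<le> \<omega> (pi / real k)"
proof -
  define d where "d = pi / real k"
  have d: "d > 0" "real k * d = pi" using k by (auto simp: d_def)
  define h where "h = (\<lambda>t. \<phi> t * cos (real k * t - y))"
  have hC: "h \<in> C_per" unfolding h_def by (rule C_per_trig[OF \<phi>(1)])
  have c: "continuous_on UNIV \<phi>" by (rule C_per_continuous[OF \<phi>(1)])
  have hc: "continuous_on UNIV h" by (rule C_per_continuous[OF hC])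
  have cs: "continuous_on UNIV (\<lambda>t. h (1 * t + d))"
    by (rule continuous_on_compose2[OF hc]) (auto intro!: continuous_intros)
  have sh: "integral {-pi..pi} (\<lambda>t. h (1 * t + d)) = integral {-pi..pi} h"
    using integral_affine[OF hc, of 1 "-pi" pi d] C_per_integral[OF hC, of "-pi + d"]
    by (simp add: algebra_simps)
  have hd: "h (1 * t + d) = - (\<phi> (t + d) * cos (real k * t - y))" for t
  proof -
    have "real k * (t + d) - y = (real k * t - y) + pi" using d(2) by (simp add: algebra_simps)
    then have "cos (real k * (t + d) - y) = - cos (real k * t - y)" by (simp only: cos_add) simp
    then show ?thesis by (simp add: h_def)
  qed
  have "2 * integral {-pi..pi} h = integral {-pi..pi} (\<lambda>t. h t + h (1 * t + d))"
    using sh by (simp add: integral_add continuous_integrable[OF hc] continuous_integrable[OF cs, simplified])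
  moreover have "\<bar>integral {-pi..pi} (\<lambda>t. h t + h (1 * t + d))\<bar> \<le> \<omega> d * (pi - (-pi))"
  proof (rule abs_integral_le)
    show "continuous_on UNIV (\<lambda>t. h t + h (1 * t + d))" by (intro continuous_on_add hc cs)
    fix t
    have "h t + h (1 * t + d) = (\<phi> t - \<phi> (t + d)) * cos (real k * t - y)"
      unfolding hd by (simp add: h_def algebra_simps)
    moreover have "\<bar>\<phi> t - \<phi> (t + d)\<bar> \<le> \<omega> d" using \<phi>(2)[of t "t + d"] d(1) by simp
    ultimately show "\<bar>h t + h (1 * t + d)\<bar> \<le> \<omega> d"
      using mult_mono[of "\<bar>\<phi> t - \<phi> (t + d)\<bar>" "\<omega> d" "\<bar>cos (real k * t - y)\<bar>" 1] modulus_nonneg[of d] d(1)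
      by (simp add: abs_mult)
  qed auto
  ultimately have "\<bar>2 * integral {-pi..pi} h\<bar> \<le> \<omega> d * (pi - (-pi))" by simp
  then have "\<bar>integral {-pi..pi} h\<bar> \<le> \<omega> d * pi" by (simp add: abs_mult)
  then show ?thesis unfolding harmonic_def h_def[symmetric] abs_mult d_def[symmetric]
    by (simp add: field_simps)
qed

end

text \<open>Each quarter of the period is parametrised by the distance \<open>r\<close> to its zero
  \<open>pi / 2\<close> or \<open>- pi / 2\<close> of the cosine, whose value there is
  \<open>sin r\<close> or \<open>- sin r\<close>. Points at equal distance on both sides of a zero
  pair up into differences, to which a modulus of continuity applies.\<close>

lemma integral_cos_fold:
  fixes \<eta> :: "real \<Rightarrow> real"
  assumes c: "continuous_on UNIV \<eta>"
  shows "integral {-pi..pi} (\<lambda>x. \<eta> x * cos x) =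
    integral {0..pi/2} (\<lambda>r. (\<eta> (pi/2 - r) - \<eta> (pi/2 + r) + \<eta> (r - pi/2) - \<eta> (- r - pi/2)) * sin r)"
proof -
  define h where "h = (\<lambda>x. \<eta> x * cos x)"
  have hc: "continuous_on UNIV h" unfolding h_def by (intro continuous_intros c)
  have I: "h integrable_on {a..b}" for a b by (rule continuous_integrable[OF hc])
  have cc: "continuous_on UNIV (\<lambda>r. h (m * r + b))" for m b
    by (rule continuous_on_compose2[OF hc]) (auto intro!: continuous_intros)
  have i: "(\<lambda>r. h (m * r + b)) integrable_on {0..pi/2}" for m b
    by (rule continuous_integrable[OF cc])
  have 1: "integral {0..pi/2} (\<lambda>r. h (-1 * r + pi/2)) = integral {0..pi/2} h"
    using integral_reflect_affine[OF hc, of 0 "pi/2" "pi/2"] by (simp add: algebra_simps)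
  have 2: "integral {0..pi/2} (\<lambda>r. h (1 * r + pi/2)) = integral {pi/2..pi} h"
    using integral_affine[OF hc, of 1 0 "pi/2" "pi/2"] by simp
  have 3: "integral {0..pi/2} (\<lambda>r. h (1 * r + (-pi/2))) = integral {-pi/2..0} h"
    using integral_affine[OF hc, of 1 0 "pi/2" "-pi/2"] by simp
  have 4: "integral {0..pi/2} (\<lambda>r. h (-1 * r + (-pi/2))) = integral {-pi..-pi/2} h"
    using integral_reflect_affine[OF hc, of 0 "pi/2" "-pi/2"] by (simp add: minus_diff_commute)
  have "integral {-pi..pi} h = integral {0..pi/2} (\<lambda>r. h (-1 * r + pi/2)) + integral {0..pi/2} (\<lambda>r. h (1 * r + pi/2))
     + integral {0..pi/2} (\<lambda>r. h (1 * r + (-pi/2))) + integral {0..pi/2} (\<lambda>r. h (-1 * r + (-pi/2)))"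
    unfolding 1 2 3 4
    using order_trans[OF _ pi_ge_zero, of "- (pi/2)"] Henstock_Kurzweil_Integration.integral_combine[OF _ _ I, of "-pi" "-pi/2" pi]
      Henstock_Kurzweil_Integration.integral_combine[OF _ _ I, of "-pi/2" 0 pi]
      Henstock_Kurzweil_Integration.integral_combine[OF _ _ I, of 0 "pi/2" pi] by simp
  also have "\<dots> = integral {0..pi/2} (\<lambda>r. h (-1 * r + pi/2) + h (1 * r + pi/2)
      + h (1 * r + (-pi/2)) + h (-1 * r + (-pi/2)))"
    by (simp only: integral_add integrable_add i)
  also have "(\<lambda>r. h (-1 * r + pi/2) + h (1 * r + pi/2) + h (1 * r + (-pi/2)) + h (-1 * r + (-pi/2))) =
     (\<lambda>r. (\<eta> (pi/2 - r) - \<eta> (pi/2 + r) + \<eta> (r - pi/2) - \<eta> (- r - pi/2)) * sin r)"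
    by (auto simp: h_def cos_add cos_diff algebra_simps)
  finally show ?thesis unfolding h_def .
qed

text \<open>The restriction to \<open>x \<ge> 0\<close> of one period of the extremal function of \<open>H_\<omega>\<close>
  (Korneichuk's standard function), rescaled so that the period is \<open>2 \<pi>\<close>.\<close>

definition zigzag :: "(real \<Rightarrow> real) \<Rightarrow> real \<Rightarrow> real \<Rightarrow> real" where
  "zigzag \<omega> m x = \<omega> (max 0 (pi - 2 * x) / m) / 2 - \<omega> (max 0 (2 * x - pi) / m) / 2"

text \<open>On one side of \<open>pi / 2\<close> only one of the two terms of \<open>zigzag\<close>
  is nonzero and subadditivity suffices; across \<open>pi / 2\<close> the two terms add, and
  midpoint concavity is needed. In both cases the doubled argument compensates the factor
  \<open>1 / 2\<close>.\<close>

lemma zigzag_modulus: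
  assumes mod: "modulus_of_continuity \<omega>" and conc: "concave_on {0..} \<omega>" and m: "m > 0"
  shows "\<bar>zigzag \<omega> m x - zigzag \<omega> m y\<bar> \<le> \<omega> (\<bar>x - y\<bar> / m)"
proof -
  note mono = modulus_mono[OF mod]
  have sub: "\<omega> (a / m) - \<omega> (b / m) \<le> 2 * \<omega> ((a - b) / 2 / m)" if "0 \<le> b" "b \<le> a" for a b
  proof -
    have e: "b / m + 2 * ((a - b) / 2 / m) = a / m" by (simp add: diff_divide_distrib)
    have "\<omega> (a / m) \<le> \<omega> (b / m) + \<omega> (2 * ((a - b) / 2 / m))"
      using modulus_subadd[OF mod, of "b / m" "2 * ((a - b) / 2 / m)"] that m unfolding e by simp
    also have "\<omega> (2 * ((a - b) / 2 / m)) \<le> 2 * \<omega> ((a - b) / 2 / m)"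
      by (rule modulus_double[OF mod]) (use that m in auto)
    finally show ?thesis by simp
  qed
  have mid: "\<omega> (a / m) / 2 + \<omega> (b / m) / 2 \<le> \<omega> ((a + b) / 2 / m)" if "0 \<le> a" "0 \<le> b" for a b
  proof -
    have "\<omega> ((1 - 1/2) *\<^sub>R (a / m) + (1/2) *\<^sub>R (b / m)) \<ge> (1 - 1/2) * \<omega> (a / m) + 1/2 * \<omega> (b / m)"
      by (rule concave_onD[OF conc]) (use that m in auto)
    then show ?thesis by (simp add: add_divide_distrib[symmetric] mult.commute)
  qed
  have *: "\<bar>zigzag \<omega> m x - zigzag \<omega> m y\<bar> \<le> \<omega> (\<bar>x - y\<bar> / m)" if xy: "x \<le> y" for x y
  proof -
    have z: "\<omega> 0 = 0" by (rule modulus_zero[OF mod])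
    have "\<omega> (max 0 (pi - 2 * y) / m) \<le> \<omega> (max 0 (pi - 2 * x) / m)"
      "\<omega> (max 0 (2 * x - pi) / m) \<le> \<omega> (max 0 (2 * y - pi) / m)"
      using xy m by (auto intro!: mono divide_right_mono)
    then have pos: "zigzag \<omega> m x - zigzag \<omega> m y \<ge> 0" unfolding zigzag_def by linarith
    have ab: "\<bar>x - y\<bar> = y - x" using xy by simp
    have "zigzag \<omega> m x - zigzag \<omega> m y \<le> \<omega> ((y - x) / m)"
    proof -
      have e: "(2 * y - 2 * x) / (2 * m) = (y - x) / m"
        using m by (simp add: field_simps)
      consider "y \<le> pi/2" | "pi/2 \<le> x" | "x \<le> pi/2" "pi/2 \<le> y" by linarith
      then show ?thesis
      proof cases
        case 1
        then show ?thesis using sub[of "pi - 2 * y" "pi - 2 * x"] xy z e by (simp add: zigzag_def)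
      next
        case 2
        then show ?thesis using sub[of "2 * x - pi" "2 * y - pi"] xy z e by (simp add: zigzag_def)
      next
        case 3
        then show ?thesis using mid[of "pi - 2 * x" "2 * y - pi"] z e by (simp add: zigzag_def)
      qed
    qed
    with pos show ?thesis unfolding ab by simp
  qed
  show ?thesis using *[of x y] *[of y x] by (cases "x \<le> y") (auto simp: abs_minus_commute)
qed

section \<open>Sharp upper and lower bounds for integrals against the kernel\<close>

context oscillating_kernel
begin

context
  fixes \<omega> :: "real \<Rightarrow> real"
  assumes mod: "modulus_of_continuity \<omega>" and conc: "concave_on {0..} \<omega>"
begin

definition main_integral :: real where
  "main_integral = integral {0..pi/2} (\<lambda>t. \<omega> (2 * t / real N) * sin t)"

lemma main_integrable: "(\<lambda>t. \<omega> (2 * t / real N) * sin t) integrable_on {0..pi/2}"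
  by (intro integrable_continuous_real continuous_intros
      continuous_on_compose2[OF modulus_continuous[OF mod]]) (use N0 in auto)

lemma main_integral_bounds: "0 \<le> main_integral" "main_integral \<le> \<omega> pi"
proof -
  have b: "0 \<le> \<omega> (2 * t / real N) * sin t" "\<omega> (2 * t / real N) * sin t \<le> \<omega> pi * sin t"
    if "t \<in> {0..pi/2}" for t
  proof -
    have s: "0 \<le> sin t" using that by (intro sin_ge_zero) auto
    have t: "0 \<le> 2 * t / real N" using that by simp
    have "2 * t / real N \<le> 2 * t / 1" using that N_pos by (intro frac_le) auto
    then have "2 * t / real N \<le> pi" using that by simp
    then have "\<omega> (2 * t / real N) \<le> \<omega> pi" by (rule modulus_mono[OF mod t])
    then show "\<omega> (2 * t / real N) * sin t \<le> \<omega> pi * sin t" using s by (rule mult_right_mono)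
    show "0 \<le> \<omega> (2 * t / real N) * sin t" using s modulus_nonneg[OF mod t] by simp
  qed
  have s: "(sin has_integral 1) {0..pi/2}"
  proof -
    have "(sin has_integral (- cos (pi/2) - (- cos 0))) {0..pi/2}"
      by (intro fundamental_theorem_of_calculus)
        (auto intro!: derivative_eq_intros simp flip: has_real_derivative_iff_has_vector_derivative)
    then show ?thesis by simp
  qed
  show "0 \<le> main_integral" unfolding main_integral_def
    by (rule integral_nonneg[OF main_integrable b(1)])
  have "main_integral \<le> integral {0..pi/2} (\<lambda>t. \<omega> pi * sin t)"
    unfolding main_integral_def
    by (rule integral_le[OF main_integrable _ b(2)]) (use s in \<open>auto simp: integrable_on_def intro: has_integral_mult_right\<close>)
  also have "\<dots> = \<omega> pi" using s by (simp add: integral_unique)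
  finally show "main_integral \<le> \<omega> pi" .
qed

text \<open>After folding at the zeros, each of the two differences joins points at distance
  \<open>2 * r / N\<close> in the original scale.\<close>

lemma cell_le:
  assumes \<phi>: "\<And>x y. \<bar>\<phi> x - \<phi> y\<bar> \<le> \<omega> \<bar>x - y\<bar>"
  shows "\<bar>cell \<phi> i\<bar> \<le> 2 * main_integral"
proof -
  define \<eta> where "\<eta> = (\<lambda>x. \<phi> (peak i + x / real N))"
  have c: "continuous_on UNIV \<phi>" by (rule modulus_imp_continuous[OF mod \<phi>])
  have \<eta>c: "continuous_on UNIV \<eta>" unfolding \<eta>_def using N0
    by (intro continuous_on_compose2[OF c] continuous_intros) auto
  have \<eta>l: "\<bar>\<eta> x - \<eta> y\<bar> \<le> \<omega> (\<bar>x - y\<bar> / real N)" for x y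
    using \<phi>[of "peak i + x / real N" "peak i + y / real N"]
    by (simp add: \<eta>_def diff_divide_distrib[symmetric])
  define J where "J = (\<lambda>r. (\<eta> (pi/2 - r) - \<eta> (pi/2 + r) + \<eta> (r - pi/2) - \<eta> (- r - pi/2)) * sin r)"
  have Jc: "continuous_on UNIV J" unfolding J_def
    by (intro continuous_intros continuous_on_compose2[OF \<eta>c]) auto
  have Jb: "\<bar>J r\<bar> \<le> 2 * (\<omega> (2 * r / real N) * sin r)" if "r \<in> {0..pi/2}" for r
  proof -
    have s: "0 \<le> sin r" using that by (intro sin_ge_zero) auto
    have r: "\<bar>(pi/2 - r) - (pi/2 + r)\<bar> = 2 * r" "\<bar>(r - pi/2) - (- r - pi/2)\<bar> = 2 * r" using that by auto
    have "\<bar>\<eta> (pi/2 - r) - \<eta> (pi/2 + r)\<bar> \<le> \<omega> (2 * r / real N)"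
      using \<eta>l[of "pi/2 - r" "pi/2 + r"] unfolding r .
    moreover have "\<bar>\<eta> (r - pi/2) - \<eta> (- r - pi/2)\<bar> \<le> \<omega> (2 * r / real N)"
      using \<eta>l[of "r - pi/2" "- r - pi/2"] unfolding r .
    ultimately have "\<bar>\<eta> (pi/2 - r) - \<eta> (pi/2 + r) + \<eta> (r - pi/2) - \<eta> (- r - pi/2)\<bar> \<le> 2 * \<omega> (2 * r / real N)"
      by linarith
    from mult_right_mono[OF this s] s show ?thesis unfolding J_def abs_mult by simp
  qed
  have "norm (integral {0..pi/2} J) \<le> integral {0..pi/2} (\<lambda>r. 2 * (\<omega> (2 * r / real N) * sin r))"
    by (rule integral_norm_bound_integral[OF continuous_integrable[OF Jc]])
      (use Jb main_integrable in \<open>auto intro: integrable_on_mult_right\<close>)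
  also have "\<dots> = 2 * main_integral" unfolding main_integral_def by (rule integral_mult_right)
  finally show ?thesis
    unfolding cell_def \<eta>_def[symmetric] using integral_cos_fold[OF \<eta>c] unfolding J_def
    by (simp add: \<eta>_def)
qed

text \<open>The bound \<open>B = 2 * \<omega> pi\<close> doubles the constants of
  \<open>integral_kernel\<close>. The additional \<open>4 * pi * L\<close> is the error of
  \<open>sum_amp\<close> times \<open>main_integral / pi\<close>, with
  \<open>main_integral \<le> \<omega> pi\<close>.\<close>

lemma integral_kernel_upper:
  assumes \<phi>: "\<phi> \<in> C_per" "\<And>x y. \<bar>\<phi> x - \<phi> y\<bar> \<le> \<omega> \<bar>x - y\<bar>" "integral {-pi..pi} \<phi> = 0"
  shows "\<bar>integral {-pi..pi} (\<lambda>t. \<phi> t * kernel t)\<bar> \<le>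
    main_integral / pi * integral {-pi..pi} (\<lambda>t. cmod (g t))
     + \<omega> pi * (4 * pi * L + 30 * pi\<^sup>2 * L + 4 * pi * (G * \<kappa>)) / real N"
proof -
  define A where "A = integral {-pi..pi} (\<lambda>t. cmod (g t))"
  define \<Sigma> where "\<Sigma> = (\<Sum>i<N. amp (int i))"
  have "\<bar>\<Sum>i<N. amp (int i) * cell \<phi> (int i)\<bar> \<le> (\<Sum>i<N. amp (int i) * (2 * main_integral))"
    using cell_le[OF \<phi>(2)] amp_bounds
    by (intro order_trans[OF sum_abs sum_mono]) (auto simp: abs_mult intro!: mult_left_mono)
  also have "\<dots> = \<Sigma> * (2 * main_integral)" by (simp add: \<Sigma>_def sum_distrib_right)
  finally have "\<bar>(\<Sum>i<N. amp (int i) * cell \<phi> (int i)) / real N\<bar> \<le> \<Sigma> * (2 * main_integral) / real N"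
    using N0 by (simp add: divide_right_mono)
  also have "\<Sigma> * (2 * main_integral) / real N = main_integral / pi * (2 * pi / real N * \<Sigma>)"
    by simp
  also have "\<dots> \<le> main_integral / pi * (A + 4 * pi\<^sup>2 * L / real N)"
    using sum_amp main_integral_bounds unfolding A_def \<Sigma>_def by (intro mult_left_mono) auto
  also have "\<dots> = main_integral / pi * A + main_integral * (4 * pi * L / real N)"
    by (simp add: distrib_left power2_eq_square)
  also have "\<dots> \<le> main_integral / pi * A + \<omega> pi * (4 * pi * L / real N)"
    using main_integral_bounds L_nonneg by (intro add_left_mono mult_right_mono) auto
  finally have 1: "\<bar>(\<Sum>i<N. amp (int i) * cell \<phi> (int i)) / real N\<bar>
      \<le> main_integral / pi * A + \<omega> pi * (4 * pi * L / real N)" .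
  have "\<bar>\<phi> x\<bar> \<le> 2 * \<omega> pi" for x by (rule mean_zero_abs_le[OF mod \<phi>])
  from integral_kernel[OF \<phi>(1) this]
  have "\<bar>integral {-pi..pi} (\<lambda>t. \<phi> t * kernel t)\<bar> \<le> main_integral / pi * A + \<omega> pi * (4 * pi * L / real N)
    + 2 * \<omega> pi * (15 * pi\<^sup>2 * L + 2 * pi * (G * \<kappa>)) / real N"
    using 1 by linarith
  also have "\<dots> = main_integral / pi * A
     + \<omega> pi * (4 * pi * L + 30 * pi\<^sup>2 * L + 4 * pi * (G * \<kappa>)) / real N"
    by (simp add: add_divide_distrib algebra_simps)
  finally show ?thesis unfolding A_def .
qed

text \<open>The distance to the set of all peaks is a contraction, so the modulus condition passes
  from \<open>zigzag\<close> to the whole line. Pasting one copy per cell would leave mismatches at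
  the troughs, where the uneven gaps meet.\<close>

definition comb :: "real \<Rightarrow> real" where
  "comb t = zigzag \<omega> (real N) (real N * infdist t (range peak))"

lemma comb_modulus: "\<bar>comb x - comb y\<bar> \<le> \<omega> \<bar>x - y\<bar>"
proof -
  let ?d = "\<lambda>t. infdist t (range peak)"
  have "\<bar>comb x - comb y\<bar> \<le> \<omega> (\<bar>real N * ?d x - real N * ?d y\<bar> / real N)"
    unfolding comb_def by (rule zigzag_modulus[OF mod conc N0])
  also have "\<bar>real N * ?d x - real N * ?d y\<bar> / real N = \<bar>?d x - ?d y\<bar>"
    unfolding right_diff_distrib[symmetric] abs_mult using N0 by simp
  also have "\<omega> \<bar>?d x - ?d y\<bar> \<le> \<omega> \<bar>x - y\<bar>"
    using infdist_triangle_abs[of x "range peak" y] by (intro modulus_mono[OF mod]) (auto simp: dist_real_def)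
  finally show ?thesis .
qed

lemma comb_C_per: "comb \<in> C_per"
proof -
  have "range peak = (\<lambda>x. x + 2 * pi) ` range peak"
  proof -
    have "peak i \<in> (\<lambda>x. x + 2 * pi) ` range peak" for i
      using peak_shift[of "i - int N"] by (intro image_eqI[of _ _ "peak (i - int N)"]) auto
    moreover have "peak i + 2 * pi \<in> range peak" for i
      using peak_shift[of i] by (metis rangeI)
    ultimately show ?thesis by auto
  qed
  then have "infdist (t + 2 * pi) (range peak) = infdist (t + 2 * pi) ((\<lambda>x. x + 2 * pi) ` range peak)" for t
    by simp
  also have "infdist (t + 2 * pi) ((\<lambda>x. x + 2 * pi) ` range peak) = infdist t (range peak)" for t
    by (simp add: infdist_def image_image dist_real_def)
  finally have "comb (t + 2 * pi) = comb t" for t by (simp add: comb_def)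
  then show ?thesis
    using modulus_imp_continuous[OF mod comb_modulus] by (simp add: C_per_def)
qed

text \<open>Nodes are at least \<open>2 * pi / N\<close> apart, and the phase displacement shrinks a
  distance at worst by the factor \<open>1 - \<kappa> / N\<close>. Half of this separation is the
  radius in which a peak is certainly the nearest one.\<close>

lemma peak_separated:
  assumes "i \<noteq> j"
  shows "\<bar>peak j - peak i\<bar> \<ge> 2 * (pi - pi * \<kappa> / real N) / real N"
proof -
  define D where "D = \<bar>node j - node i\<bar>"
  have "D = 2 * pi / real N * \<bar>of_int (j - i)\<bar>" unfolding D_def node_diff abs_mult by simp
  moreover have "1 \<le> \<bar>of_int (j - i) :: real\<bar>" using assms by linarith
  then have "2 * pi / real N * 1 \<le> 2 * pi / real N * \<bar>of_int (j - i)\<bar>"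
    by (intro mult_left_mono) auto
  ultimately have D: "2 * pi / real N \<le> D" by simp
  have "\<kappa> / real N \<le> 1" using N_large \<kappa>_nonneg N0 by simp
  have "\<bar>peak j - peak i\<bar> \<ge> D - \<kappa> * D / real N"
    using peak_diff[of j i] unfolding D_def by linarith
  also have "D - \<kappa> * D / real N = (1 - \<kappa> / real N) * D" by (simp add: left_diff_distrib)
  also have "\<dots> \<ge> (1 - \<kappa> / real N) * (2 * pi / real N)"
    using D \<open>\<kappa> / real N \<le> 1\<close> by (intro mult_left_mono) auto
  also have "(1 - \<kappa> / real N) * (2 * pi / real N) = 2 * (pi - pi * \<kappa> / real N) / real N"
    by (simp add: algebra_simps diff_divide_distrib)
  finally show ?thesis .
qed

lemma infdist_peak:
  assumes "\<bar>x\<bar> \<le> pi - pi * \<kappa> / real N"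
  shows "infdist (peak i + x / real N) (range peak) = \<bar>x\<bar> / real N"
proof (rule antisym)
  show "infdist (peak i + x / real N) (range peak) \<le> \<bar>x\<bar> / real N"
    by (rule infdist_le2[of "peak i"]) (use N0 in \<open>auto simp: dist_real_def\<close>)
  have "\<bar>x\<bar> / real N \<le> dist (peak i + x / real N) (peak j)" for j
  proof (cases "i = j")
    case False
    have "2 * (\<bar>x\<bar> / real N) \<le> 2 * (pi - pi * \<kappa> / real N) / real N"
      using assms N0 by (simp add: divide_right_mono)
    also have "\<dots> \<le> \<bar>peak j - peak i\<bar>" by (rule peak_separated[OF False])
    finally have "2 * \<bar>x / real N\<bar> \<le> \<bar>peak j - peak i\<bar>" by simp
    then have "\<bar>x / real N\<bar> \<le> \<bar>peak i + x / real N - peak j\<bar>" by linarith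
    then show ?thesis by (simp add: dist_real_def)
  qed (simp add: dist_real_def)
  then show "\<bar>x\<bar> / real N \<le> infdist (peak i + x / real N) (range peak)"
    unfolding infdist_def by (auto intro!: cINF_greatest)
qed

text \<open>For \<open>\<bar>x\<bar> \<le> R\<close> the function is an exact zigzag, for which
  folding gives equality in \<open>cell_le\<close>. The two remaining strips have length
  \<open>pi * \<kappa> / N\<close> each, and there the deviation is at most
  \<open>2 * \<omega> pi\<close>.\<close>

lemma cell_comb: "cell comb i \<ge> 2 * main_integral - 4 * pi * \<kappa> * \<omega> pi / real N"
proof -
  define \<eta> where "\<eta> = (\<lambda>x. comb (peak i + x / real N))"
  define \<zeta> where "\<zeta> = (\<lambda>x. zigzag \<omega> (real N) \<bar>x\<bar>)"
  define R where "R = pi - pi * \<kappa> / real N"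
  have cc: "continuous_on UNIV comb" by (rule modulus_imp_continuous[OF mod comb_modulus])
  have \<eta>c: "continuous_on UNIV \<eta>" unfolding \<eta>_def using N0
    by (intro continuous_on_compose2[OF cc] continuous_intros) auto
  have \<zeta>l: "\<bar>\<zeta> x - \<zeta> y\<bar> \<le> \<omega> (\<bar>x - y\<bar> / real N)" for x y
  proof -
    have "\<omega> (\<bar>\<bar>x\<bar> - \<bar>y\<bar>\<bar> / real N) \<le> \<omega> (\<bar>x - y\<bar> / real N)"
      by (intro modulus_mono[OF mod] divide_right_mono) auto
    with zigzag_modulus[OF mod conc N0, of "\<bar>x\<bar>" "\<bar>y\<bar>"] show ?thesis unfolding \<zeta>_def by linarith
  qed
  have \<eta>l: "\<bar>\<eta> x - \<eta> y\<bar> \<le> \<omega> (\<bar>x - y\<bar> / real N)" for x y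
    using comb_modulus[of "peak i + x / real N" "peak i + y / real N"]
    by (simp add: \<eta>_def diff_divide_distrib[symmetric])
  have \<zeta>c: "continuous_on UNIV \<zeta>"
    unfolding \<zeta>_def zigzag_def using N0
    by (intro continuous_intros continuous_on_compose2[OF modulus_continuous[OF mod]]) auto
  have half: "pi * \<kappa> / real N \<le> pi / 2" using N_large N0 by (simp add: field_simps)
  have "0 \<le> pi * \<kappa> / real N" using \<kappa>_nonneg by simp
  then have R: "pi / 2 \<le> R" "R \<le> pi" using half unfolding R_def by auto
  have eq: "\<eta> x = \<zeta> x" if "\<bar>x\<bar> \<le> R" for x
    unfolding \<eta>_def comb_def \<zeta>_def infdist_peak[OF that[unfolded R_def]] using N0 by simp
  define H where "H = (\<lambda>x. \<eta> x * cos x - \<zeta> x * cos x)"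
  have Hc: "continuous_on UNIV H" unfolding H_def by (intro continuous_intros \<eta>c \<zeta>c)
  have I: "H integrable_on {a..b}" for a b by (rule continuous_integrable[OF Hc])
  have Hb: "\<bar>H x\<bar> \<le> 2 * \<omega> pi" if x: "R \<le> \<bar>x\<bar>" "\<bar>x\<bar> \<le> pi" for x
  proof -
    \<comment> \<open>The end point of the interval of agreement on the side of \<open>x\<close>:
      both functions start there from a common value and differ by at most two increments.\<close>
    define y where "y = sgn x * R"
    have "\<bar>x - y\<bar> \<le> pi" "\<bar>y\<bar> \<le> R"
      using x R by (auto simp: y_def sgn_if abs_if split: if_splits)
    then have "\<bar>x - y\<bar> / real N \<le> pi / 1"
      using N_pos by (intro frac_le) auto
    then have w: "\<omega> (\<bar>x - y\<bar> / real N) \<le> \<omega> pi" by (intro modulus_mono[OF mod]) auto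
    have "\<bar>\<eta> x - \<zeta> x\<bar> \<le> 2 * \<omega> pi"
      using \<eta>l[of x y] \<zeta>l[of x y] eq[OF \<open>\<bar>y\<bar> \<le> R\<close>] w by linarith
    moreover have "\<bar>H x\<bar> \<le> \<bar>\<eta> x - \<zeta> x\<bar> * 1"
      unfolding H_def left_diff_distrib[symmetric] abs_mult by (intro mult_left_mono abs_cos_le_one) auto
    ultimately show ?thesis by simp
  qed
  have "integral {-R..R} H = integral {-R..R} (\<lambda>x. 0)"
    by (rule integral_cong) (simp add: H_def eq abs_le_iff)
  then have 0: "integral {-R..R} H = 0" by simp
  have 1: "\<bar>integral {-pi..-R} H\<bar> \<le> 2 * \<omega> pi * (-R - (-pi))"
    by (rule abs_integral_le[OF Hc _ Hb]) (use R in auto)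
  have 2: "\<bar>integral {R..pi} H\<bar> \<le> 2 * \<omega> pi * (pi - R)"
    by (rule abs_integral_le[OF Hc _ Hb]) (use R in auto)
  have "integral {-pi..pi} H = integral {-pi..-R} H + integral {-R..R} H + integral {R..pi} H"
    using R Henstock_Kurzweil_Integration.integral_combine[OF _ _ I, of "-pi" "-R" pi]
      Henstock_Kurzweil_Integration.integral_combine[OF _ _ I, of "-R" R pi] by simp
  with 0 1 2 have "\<bar>integral {-pi..pi} H\<bar> \<le> 4 * \<omega> pi * (pi - R)" by (simp add: algebra_simps)
  then have err: "\<bar>integral {-pi..pi} H\<bar> \<le> 4 * pi * \<kappa> * \<omega> pi / real N"
    by (simp add: R_def mult_ac)
  have "cell comb i = integral {-pi..pi} (\<lambda>x. \<eta> x * cos x)" by (simp add: cell_def \<eta>_def)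
  then have "integral {-pi..pi} H = cell comb i - integral {-pi..pi} (\<lambda>x. \<zeta> x * cos x)"
    unfolding H_def
    by (subst integral_diff) (auto intro!: continuous_integrable continuous_intros \<eta>c \<zeta>c)
  moreover have "integral {-pi..pi} (\<lambda>x. \<zeta> x * cos x) = 2 * main_integral"
  proof -
    have "integral {-pi..pi} (\<lambda>x. \<zeta> x * cos x) = integral {0..pi/2} (\<lambda>r. 2 * (\<omega> (2 * r / real N) * sin r))"
      unfolding integral_cos_fold[OF \<zeta>c]
    proof (rule integral_cong)
      fix r assume r: "r \<in> {0..pi/2}"
      have a: "\<bar>pi/2 - r\<bar> = pi/2 - r" "\<bar>pi/2 + r\<bar> = pi/2 + r" "\<bar>r - pi/2\<bar> = pi/2 - r"
        "\<bar>- r - pi/2\<bar> = pi/2 + r" using r by auto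
      have b: "max 0 (pi - 2 * (pi/2 - r)) = 2 * r" "max 0 (2 * (pi/2 - r) - pi) = 0"
        "max 0 (pi - 2 * (pi/2 + r)) = 0" "max 0 (2 * (pi/2 + r) - pi) = 2 * r" using r by auto
      show "(\<zeta> (pi/2 - r) - \<zeta> (pi/2 + r) + \<zeta> (r - pi/2) - \<zeta> (- r - pi/2)) * sin r =
        2 * (\<omega> (2 * r / real N) * sin r)"
        unfolding \<zeta>_def a zigzag_def b using modulus_zero[OF mod] by simp
    qed
    also have "\<dots> = 2 * main_integral" unfolding main_integral_def by (rule integral_mult_right)
    finally show ?thesis .
  qed
  ultimately show ?thesis using err by linarith
qed

text \<open>The witness is \<open>comb\<close> minus its mean. A cell integrates against a full
  period of the cosine, so subtracting a constant changes no cell. The factor 8 in place of 4 before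
  \<open>G * \<kappa>\<close> pays for the loss in \<open>cell_comb\<close>.\<close>

lemma integral_kernel_lower:
  obtains \<phi> where "\<phi> \<in> C_per" "\<And>x y. \<bar>\<phi> x - \<phi> y\<bar> \<le> \<omega> \<bar>x - y\<bar>" "integral {-pi..pi} \<phi> = 0"
    "integral {-pi..pi} (\<lambda>t. \<phi> t * kernel t) \<ge> main_integral / pi * integral {-pi..pi} (\<lambda>t. cmod (g t))
     - \<omega> pi * (4 * pi * L + 30 * pi\<^sup>2 * L + 8 * pi * (G * \<kappa>)) / real N"
proof -
  define m where "m = integral {-pi..pi} comb / (2 * pi)"
  define \<phi> where "\<phi> = (\<lambda>t. comb t - m)"
  define A where "A = integral {-pi..pi} (\<lambda>t. cmod (g t))"
  define \<Sigma> where "\<Sigma> = (\<Sum>i<N. amp (int i))"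
  define e where "e = 4 * pi * \<kappa> * \<omega> pi / real N"
  have w: "\<omega> pi \<ge> 0" by (rule modulus_nonneg[OF mod]) simp
  have e: "e \<ge> 0" unfolding e_def using \<kappa>_nonneg w by simp
  have cc: "continuous_on UNIV comb" by (rule C_per_continuous[OF comb_C_per])
  have \<phi>1: "\<phi> \<in> C_per" using comb_C_per by (auto simp: \<phi>_def C_per_def intro!: continuous_intros)
  have \<phi>2: "\<bar>\<phi> x - \<phi> y\<bar> \<le> \<omega> \<bar>x - y\<bar>" for x y using comb_modulus[of x y] by (simp add: \<phi>_def)
  have \<phi>3: "integral {-pi..pi} \<phi> = 0"
    unfolding \<phi>_def by (subst integral_diff) (auto simp: m_def intro: continuous_integrable[OF cc])
  have cell: "cell \<phi> i = cell comb i" for i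
  proof -
    have c: "continuous_on UNIV (\<lambda>x. comb (peak i + x / real N) * cos x)" using N0
      by (intro continuous_intros continuous_on_compose2[OF cc]) auto
    have d: "continuous_on UNIV (\<lambda>x. m * cos x)" by (intro continuous_intros)
    have "cell \<phi> i = cell comb i - integral {-pi..pi} (\<lambda>x. m * cos x)"
      unfolding cell_def \<phi>_def left_diff_distrib
      by (rule integral_diff[OF continuous_integrable[OF c] continuous_integrable[OF d]])
    also have "integral {-pi..pi} (\<lambda>x. m * cos x) = m * integral {-pi..pi} (\<lambda>x. cos (of_int 1 * x - 0))"
      by (simp add: integral_mult_right)
    also have "\<dots> = 0" unfolding integral_cos_int by simp
    finally show ?thesis by simp
  qed
  have \<Sigma>: "0 \<le> \<Sigma>" "\<Sigma> \<le> real N * G"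
    unfolding \<Sigma>_def using amp_bounds sum_bounded_above[of "{..<N}" "\<lambda>i. amp (int i)" G]
    by (auto intro!: sum_nonneg)
  have "main_integral / pi * A - \<omega> pi * (4 * pi * L / real N)
      \<le> main_integral / pi * A - main_integral * (4 * pi * L / real N)"
    using main_integral_bounds L_nonneg by (intro diff_left_mono mult_right_mono) auto
  also have "\<dots> = main_integral / pi * (A - 4 * pi\<^sup>2 * L / real N)"
    by (simp add: right_diff_distrib power2_eq_square)
  also have "\<dots> \<le> main_integral / pi * (2 * pi / real N * \<Sigma>)"
    using sum_amp main_integral_bounds unfolding A_def \<Sigma>_def by (intro mult_left_mono) auto
  also have "\<dots> = \<Sigma> * (2 * main_integral - e) / real N + \<Sigma> * e / real N"
    by (simp add: right_diff_distrib diff_divide_distrib)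
  also have "\<Sigma> * (2 * main_integral - e) / real N \<le> (\<Sum>i<N. amp (int i) * cell \<phi> (int i)) / real N"
    unfolding \<Sigma>_def sum_distrib_right cell using amp_bounds cell_comb
    by (intro divide_right_mono sum_mono mult_left_mono) (auto simp: e_def)
  also have "\<Sigma> * e / real N \<le> real N * G * e / real N"
    using \<Sigma> e by (intro divide_right_mono mult_right_mono) auto
  also have "real N * G * e / real N = \<omega> pi * (4 * pi * (G * \<kappa>)) / real N"
    using N0 by (simp add: e_def)
  finally have 1: "main_integral / pi * A - \<omega> pi * (4 * pi * L / real N) - \<omega> pi * (4 * pi * (G * \<kappa>)) / real N
      \<le> (\<Sum>i<N. amp (int i) * cell \<phi> (int i)) / real N" by simp
  have "\<bar>\<phi> x\<bar> \<le> 2 * \<omega> pi" for x by (rule mean_zero_abs_le[OF mod \<phi>1 \<phi>2 \<phi>3])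
  note 2 = integral_kernel[OF \<phi>1 this]
  have "x - e \<le> y" if "\<bar>y - z\<bar> \<le> e" "x \<le> z" for x y z e :: real using that by linarith
  from this[OF 2 1]
  have "integral {-pi..pi} (\<lambda>t. \<phi> t * kernel t) \<ge> main_integral / pi * A - \<omega> pi * (4 * pi * L / real N)
    - \<omega> pi * (4 * pi * (G * \<kappa>)) / real N - 2 * \<omega> pi * (15 * pi\<^sup>2 * L + 2 * pi * (G * \<kappa>)) / real N" .
  also have "main_integral / pi * A - \<omega> pi * (4 * pi * L / real N)
    - \<omega> pi * (4 * pi * (G * \<kappa>)) / real N - 2 * \<omega> pi * (15 * pi\<^sup>2 * L + 2 * pi * (G * \<kappa>)) / real N =
     main_integral / pi * A - \<omega> pi * (4 * pi * L + 30 * pi\<^sup>2 * L + 8 * pi * (G * \<kappa>)) / real N"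
    by (simp add: add_divide_distrib diff_divide_distrib algebra_simps)
  finally show ?thesis using that[OF \<phi>1 \<phi>2 \<phi>3] unfolding A_def by blast
qed

end

end

section \<open>The kernel of the de la Vallee Poussin sums\<close>

lemma cis_diff_le: "cmod (cis a - cis b) \<le> \<bar>a - b\<bar>"
proof (rule power2_le_imp_le)
  have half: "cos d = 1 - 2 * (sin (d / 2))\<^sup>2" for d :: real
    using cos_double_sin[of "d / 2"] by simp
  have "(cmod (cis a - cis b))\<^sup>2 = (cos a - cos b)\<^sup>2 + (sin a - sin b)\<^sup>2"
    by (simp add: cmod_power2)
  also have "\<dots> = ((cos a)\<^sup>2 + (sin a)\<^sup>2) + ((cos b)\<^sup>2 + (sin b)\<^sup>2) - 2 * cos (a - b)"
    unfolding cos_diff by (simp add: power2_eq_square algebra_simps)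
  also have "\<dots> = 2 - 2 * cos (a - b)" by simp
  also have "cos (a - b) = 1 - 2 * (sin ((a - b) / 2))\<^sup>2" by (rule half)
  also have "2 - 2 * (1 - 2 * (sin ((a - b) / 2))\<^sup>2) = (2 * \<bar>sin ((a - b) / 2)\<bar>)\<^sup>2"
    by (simp add: power_mult_distrib)
  also have "\<dots> \<le> (2 * \<bar>(a - b) / 2\<bar>)\<^sup>2"
    by (intro power_mono mult_left_mono abs_sin_x_le_abs_x) auto
  finally show "(cmod (cis a - cis b))\<^sup>2 \<le> \<bar>a - b\<bar>\<^sup>2" by simp
qed simp

text \<open>Multiplication by \<open>1 - x\<close> lowers the degree of the weight by one and leaves
  behind only a nonpositive boundary term.\<close>

lemma sum_power_le:
  fixes x :: real
  assumes "0 \<le> x" "x < 1"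
  shows "(\<Sum>j<n. x ^ j) \<le> 1 / (1 - x)"
    "(\<Sum>j<n. real (j + 1) * x ^ j) \<le> 1 / (1 - x)\<^sup>2"
    "(\<Sum>j<n. real (j + 1) * real (j + 2) * x ^ j) \<le> 2 / (1 - x) ^ 3"
proof -
  have 1: "(1 - x) * (\<Sum>j<n. x ^ j) = 1 - x ^ n"
    by (rule one_diff_power_eq[symmetric])
  have 2: "(1 - x) * (\<Sum>j<n. real (j + 1) * x ^ j) = (\<Sum>j<n. x ^ j) - real n * x ^ n"
  proof (induction n)
    case (Suc n)
    show ?case unfolding sum.lessThan_Suc distrib_left Suc by (simp add: algebra_simps)
  qed simp
  have 3: "(1 - x) * (\<Sum>j<n. real (j + 1) * real (j + 2) * x ^ j) =
      2 * (\<Sum>j<n. real (j + 1) * x ^ j) - real n * real (n + 1) * x ^ n"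
  proof (induction n)
    case (Suc n)
    show ?case unfolding sum.lessThan_Suc distrib_left Suc by (simp add: algebra_simps)
  qed simp
  have d: "a \<le> b / (1 - x)" if "(1 - x) * a \<le> b" for a b
    using that assms by (simp add: pos_le_divide_eq mult.commute)
  have x: "0 \<le> x ^ n" using assms by simp
  then have x': "0 \<le> real n * x ^ n" "0 \<le> real n * real (n + 1) * x ^ n" by simp_all
  show a: "(\<Sum>j<n. x ^ j) \<le> 1 / (1 - x)" by (rule d) (use 1 x in simp)
  have "(\<Sum>j<n. real (j + 1) * x ^ j) \<le> 1 / (1 - x) / (1 - x)"
    by (rule d) (unfold 2, use a x' in linarith)
  then show b: "(\<Sum>j<n. real (j + 1) * x ^ j) \<le> 1 / (1 - x)\<^sup>2" by (simp add: power2_eq_square)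
  have "(\<Sum>j<n. real (j + 1) * real (j + 2) * x ^ j) \<le> 2 * (1 / (1 - x)\<^sup>2) / (1 - x)"
    by (rule d) (unfold 3, use b x' in linarith)
  then show "(\<Sum>j<n. real (j + 1) * real (j + 2) * x ^ j) \<le> 2 / (1 - x) ^ 3"
    by (simp add: power2_eq_square power3_eq_cube)
qed

text \<open>Origin of \<gamma>(p): the weight is 1 for \<open>p = 1\<close> and at most
  \<open>j + 1\<close> otherwise, and an additional factor \<open>j\<close> costs one more power of
  \<open>1 / (1 - q)\<close>.\<close>

lemma weighted_power_sums:
  fixes q :: real
  assumes q: "0 < q" "q < 1" and p: "p \<ge> 1"
  defines "b \<equiv> 1 / (1 - q)"
  shows "summable (\<lambda>j. real (min (Suc j) p) * q ^ j)"
    "(\<Sum>j. real (min (Suc j) p) * q ^ j) \<le> b ^ (gamma_exp p - 1)"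
    "summable (\<lambda>j. real (min (Suc j) p) * q ^ j * real j)"
    "(\<Sum>j. real (min (Suc j) p) * q ^ j * real j) \<le> 2 * b ^ gamma_exp p"
proof -
  have g: "(\<Sum>j<n. real (min (Suc j) p) * q ^ j) \<le> b ^ (gamma_exp p - 1)" for n
  proof (cases "p = 1")
    case True
    then show ?thesis using sum_power_le(1)[of q n] q by (simp add: gamma_exp_def b_def)
  next
    case False
    have "(\<Sum>j<n. real (min (Suc j) p) * q ^ j) \<le> (\<Sum>j<n. real (j + 1) * q ^ j)"
      using q by (intro sum_mono mult_right_mono) auto
    also have "\<dots> \<le> 1 / (1 - q)\<^sup>2" using q by (intro sum_power_le) auto
    finally show ?thesis using False by (simp add: gamma_exp_def b_def power_divide)
  qed
  have l: "(\<Sum>j<n. real (min (Suc j) p) * q ^ j * real j) \<le> 2 * b ^ gamma_exp p" for n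
  proof (cases "p = 1")
    case True
    have "(\<Sum>j<n. real (min (Suc j) p) * q ^ j * real j) \<le> (\<Sum>j<n. real (j + 1) * q ^ j)"
      using q True by (intro sum_mono) (simp add: mult.commute[of _ "real _"] mult_right_mono)
    also have "\<dots> \<le> 1 / (1 - q)\<^sup>2" using q by (intro sum_power_le) auto
    also have "\<dots> \<le> 2 * (1 / (1 - q)\<^sup>2)" by (simp add: divide_right_mono)
    finally show ?thesis using True by (simp add: gamma_exp_def b_def power_divide)
  next
    case False
    have "(\<Sum>j<n. real (min (Suc j) p) * q ^ j * real j) \<le> (\<Sum>j<n. real (j + 1) * real (j + 2) * q ^ j)"
    proof (rule sum_mono)
      fix j
      have "(real (min (Suc j) p) * real j) * q ^ j \<le> (real (j + 1) * real (j + 2)) * q ^ j"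
        using q by (intro mult_right_mono mult_mono) auto
      then show "real (min (Suc j) p) * q ^ j * real j \<le> real (j + 1) * real (j + 2) * q ^ j"
        by (simp add: mult_ac)
    qed
    also have "\<dots> \<le> 2 / (1 - q) ^ 3" using q by (intro sum_power_le) auto
    finally show ?thesis using False by (simp add: gamma_exp_def b_def power_divide)
  qed
  show 1: "summable (\<lambda>j. real (min (Suc j) p) * q ^ j)"
    by (rule summableI_nonneg_bounded[OF _ g]) (use q in auto)
  show 2: "summable (\<lambda>j. real (min (Suc j) p) * q ^ j * real j)"
    by (rule summableI_nonneg_bounded[OF _ l]) (use q in auto)
  show "(\<Sum>j. real (min (Suc j) p) * q ^ j) \<le> b ^ (gamma_exp p - 1)"
    by (rule suminf_le_const[OF 1 g])
  show "(\<Sum>j. real (min (Suc j) p) * q ^ j * real j) \<le> 2 * b ^ gamma_exp p"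
    by (rule suminf_le_const[OF 2 l])
qed

definition vp_factor :: "real \<Rightarrow> nat \<Rightarrow> real \<Rightarrow> complex" where
  "vp_factor q p t = (1 - of_real (q ^ p) * cis (real p * t)) / (1 - of_real q * cis t)\<^sup>2"

lemma one_minus_cis_nonzero:
  assumes "0 \<le> r" "r < 1"
  shows "1 - of_real r * cis t \<noteq> 0" "0 < Re (1 - of_real r * cis t)"
proof -
  have "r * cos t \<le> r * 1" using assms by (intro mult_left_mono) auto
  then show "0 < Re (1 - of_real r * cis t)" using assms by simp
  then show "1 - of_real r * cis t \<noteq> 0" by (metis order_less_irrefl zero_complex.simps(1))
qed

text \<open>With \<open>z = q * cis t\<close> the \<open>p\<close> geometric tails
  \<open>z ^ i / (1 - z)\<close>, \<open>i < p\<close>, add up to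
  \<open>(1 - z ^ p) / (1 - z)^2\<close>.\<close>

lemma vp_factor_sums:
  assumes q: "0 < q" "q < 1"
  shows "(\<lambda>j. of_real (real (min (Suc j) p) * q ^ j) * cis (real j * t)) sums vp_factor q p t"
proof -
  define z where "z = of_real q * cis t"
  have z: "norm z < 1" using q by (simp add: z_def norm_mult)
  have z1: "1 - z \<noteq> 0" unfolding z_def using one_minus_cis_nonzero[of q t] q by simp
  have zj: "z ^ j = of_real (q ^ j) * cis (real j * t)" for j
    by (simp add: z_def power_mult_distrib Complex.DeMoivre)
  have "(\<Sum>k. z ^ (k + i)) = z ^ i * (1 / (1 - z))" for i
    using suminf_mult[OF summable_geometric[OF z], of "z ^ i"] suminf_geometric[OF z]
    by (simp add: power_add mult.commute)
  then have "(\<Sum>i<p. \<Sum>k. z ^ (k + i)) = (\<Sum>i<p. z ^ i) * (1 / (1 - z))"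
    by (simp add: sum_divide_distrib)
  also have "(\<Sum>i<p. z ^ i) = (1 - z ^ p) / (1 - z)"
    using one_diff_power_eq[of z p] z1 by simp
  also have "(1 - z ^ p) / (1 - z) * (1 / (1 - z)) = vp_factor q p t"
    unfolding vp_factor_def zj by (simp add: z_def power2_eq_square)
  finally have "(\<lambda>j. of_nat (min (Suc j) p) * z ^ j) sums vp_factor q p t"
    using sums_min_weight[OF summable_geometric[OF z], of p] by simp
  moreover have "of_nat (min (Suc j) p) * z ^ j = of_real (real (min (Suc j) p) * q ^ j) * cis (real j * t)" for j
    unfolding zj by (simp only: of_real_mult of_real_of_nat_eq mult.assoc)
  ultimately show ?thesis by simp
qed

text \<open>Termwise estimates of the series; the term of order \<open>j\<close> has Lipschitz
  constant \<open>j\<close> times its weight.\<close>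

lemma vp_factor_bounds:
  assumes q: "0 < q" "q < 1" and p: "p \<ge> 1"
  defines "b \<equiv> 1 / (1 - q)"
  shows "cmod (vp_factor q p t) \<le> b ^ (gamma_exp p - 1)"
    "cmod (vp_factor q p t - vp_factor q p s) \<le> 2 * b ^ gamma_exp p * \<bar>t - s\<bar>"
proof -
  note W = weighted_power_sums[OF q p, folded b_def]
  define w where "w = (\<lambda>j. real (min (Suc j) p) * q ^ j)"
  have w0: "w j \<ge> 0" for j using q by (simp add: w_def)
  have "cmod (vp_factor q p t) \<le> (\<Sum>j. w j)"
    unfolding w_def
    by (rule norm_sums_le[OF vp_factor_sums[OF q] summable_sums[OF W(1)]])
      (simp only: norm_mult norm_of_real norm_cis mult_1_right, use w0 in \<open>simp add: w_def\<close>)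
  with W(2) show "cmod (vp_factor q p t) \<le> b ^ (gamma_exp p - 1)" by (simp add: w_def)
  have "(\<lambda>j. of_real (w j) * (cis (real j * t) - cis (real j * s))) sums (vp_factor q p t - vp_factor q p s)"
    using sums_diff[OF vp_factor_sums[OF q, of p t] vp_factor_sums[OF q, of p s]]
    by (simp add: w_def right_diff_distrib)
  moreover have "(\<lambda>j. w j * real j * \<bar>t - s\<bar>) sums ((\<Sum>j. w j * real j) * \<bar>t - s\<bar>)"
    using sums_mult2[OF summable_sums[OF W(3)]] by (simp add: w_def)
  ultimately have "cmod (vp_factor q p t - vp_factor q p s) \<le> (\<Sum>j. w j * real j) * \<bar>t - s\<bar>"
  proof (rule norm_sums_le)
    fix j
    have "cmod (of_real (w j) * (cis (real j * t) - cis (real j * s))) = w j * cmod (cis (real j * t) - cis (real j * s))"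
      using w0 by (simp add: norm_mult)
    also have "\<dots> \<le> w j * \<bar>real j * t - real j * s\<bar>" by (intro mult_left_mono cis_diff_le w0)
    also have "\<dots> = w j * real j * \<bar>t - s\<bar>"
      unfolding right_diff_distrib[symmetric] abs_mult by simp
    finally show "cmod (of_real (w j) * (cis (real j * t) - cis (real j * s))) \<le> w j * real j * \<bar>t - s\<bar>" .
  qed
  also have "\<dots> \<le> 2 * b ^ gamma_exp p * \<bar>t - s\<bar>"
    using W(4) by (intro mult_right_mono) (auto simp: w_def)
  finally show "cmod (vp_factor q p t - vp_factor q p s) \<le> 2 * b ^ gamma_exp p * \<bar>t - s\<bar>" .
qed

text \<open>For \<open>r < 1\<close> the argument has positive real part, so the principal branch is
  smooth there. This yields a phase that is both Lipschitz and periodic, without following an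
  argument along the circle.\<close>

definition log_factor :: "real \<Rightarrow> nat \<Rightarrow> real \<Rightarrow> complex" where
  "log_factor r m t = Ln (1 - of_real r * cis (real m * t))"

text \<open>\<open>Ln (1 - w)\<close> has derivative at most \<open>1 / (1 - r)\<close> in the disc
  of radius \<open>r\<close>, and \<open>w\<close> moves on its boundary with speed
  \<open>m * r\<close>. The factor \<open>r\<close> has to be kept: with \<open>r = q ^ p\<close> it
  compensates \<open>m = p\<close>.\<close>

lemma log_factor_lipschitz:
  assumes r: "0 \<le> r" "r < 1"
  shows "cmod (log_factor r m t - log_factor r m s) \<le> real m * r / (1 - r) * \<bar>t - s\<bar>"
proof -
  define w where "w = (\<lambda>t. of_real r * cis (real m * t))"
  have "cmod (Ln (1 - w t) - Ln (1 - w s)) \<le> 1 / (1 - r) * cmod (w t - w s)"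
  proof (rule field_differentiable_bound[where f' = "\<lambda>w. - 1 / (1 - w)"])
    show "convex (cball (0 :: complex) r)" by simp
    show "w t \<in> cball 0 r" "w s \<in> cball 0 r" using r by (auto simp: w_def norm_mult)
    fix z assume z: "z \<in> cball (0 :: complex) r"
    have "Re z \<le> r" using z complex_Re_le_cmod[of z] by simp
    then have "1 - z \<notin> \<real>\<^sub>\<le>\<^sub>0" using r by (auto simp: complex_nonpos_Reals_iff)
    then show "((\<lambda>w. Ln (1 - w)) has_field_derivative - 1 / (1 - z)) (at z within cball 0 r)"
      by (auto intro!: derivative_eq_intros simp: divide_inverse)
    have "1 - r \<le> cmod (1 - z)" using norm_triangle_ineq2[of 1 z] z by simp
    then show "cmod (- 1 / (1 - z)) \<le> 1 / (1 - r)"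
      unfolding norm_divide norm_minus_cancel norm_one using r by (intro frac_le) auto
  qed
  also have "cmod (w t - w s) = r * cmod (cis (real m * t) - cis (real m * s))"
    unfolding w_def right_diff_distrib[symmetric] norm_mult using r by simp
  also have "1 / (1 - r) * (r * cmod (cis (real m * t) - cis (real m * s)))
      \<le> 1 / (1 - r) * (r * \<bar>real m * t - real m * s\<bar>)"
    using r by (intro mult_left_mono cis_diff_le) auto
  also have "\<dots> = real m * r / (1 - r) * \<bar>t - s\<bar>"
    unfolding right_diff_distrib[symmetric] abs_mult by simp
  finally show ?thesis unfolding log_factor_def w_def .
qed

lemma log_factor_periodic: "log_factor r m (t + 2 * pi) = log_factor r m t"
proof -
  have "real m * (t + 2 * pi) = real m * t + 2 * pi * of_int (int m)" by (simp add: algebra_simps)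
  then have "cis (real m * (t + 2 * pi)) = cis (real m * t)"
    by (simp only: complex_eq_iff cis.simps cos_add sin_add cos_int_2pin sin_int_2pin) simp
  then show ?thesis by (simp add: log_factor_def)
qed

text \<open>Makes the phase of the numerator Lipschitz uniformly in \<open>p\<close>: each of the
  \<open>p\<close> summands \<open>q ^ p\<close> is at most \<open>q ^ j\<close> with
  \<open>j < p\<close>, and those form a geometric sum.\<close>

lemma power_ratio_le:
  fixes q :: real
  assumes q: "0 < q" "q < 1" and p: "p \<ge> 1"
  shows "real p * q ^ p / (1 - q ^ p) \<le> 1 / (1 - q)"
proof -
  have qp: "q ^ p < 1" using q p by (intro power_less_one_iff[THEN iffD2]) auto
  have "real p * q ^ p = (\<Sum>j<p. q ^ p)" by simp
  also have "\<dots> \<le> (\<Sum>j<p. q ^ j)" using q by (intro sum_mono power_decreasing) auto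
  also have "\<dots> = (1 - q ^ p) / (1 - q)" using one_diff_power_eq[of q p] q by simp
  finally show ?thesis using qp by (simp add: pos_divide_le_eq)
qed

definition vp_phase :: "real \<Rightarrow> nat \<Rightarrow> real \<Rightarrow> real" where
  "vp_phase q p t = Im (log_factor (q ^ p) p t) - 2 * Im (log_factor q 1 t)"

text \<open>The numerator contributes one logarithm and the squared denominator two, each with
  Lipschitz constant at most \<open>b\<close> and imaginary part at most \<open>pi\<close> in
  modulus. Hence \<open>3 * b\<close>, \<open>3 * pi\<close>, and the threshold
  \<open>6 / (1 - q) = 2 * (3 * b)\<close>.\<close>

lemma vp_oscillating_kernel:
  assumes q: "0 < q" "q < 1" and p: "p \<ge> 1" and N: "6 / (1 - q) \<le> real N"
  defines "b \<equiv> 1 / (1 - q)"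
  shows "oscillating_kernel (vp_factor q p) (vp_phase q p)
    (2 * b ^ gamma_exp p) (b ^ (gamma_exp p - 1)) (3 * b) N"
proof
  have qp: "0 \<le> q ^ p" "q ^ p < 1" using q p by (auto intro: power_less_one_iff[THEN iffD2])
  have "0 < 6 / (1 - q)" using q by simp
  with N have "0 < real N" by linarith
  then show "1 \<le> N" by simp
  show "2 * (3 * b) \<le> real N" using N by (simp add: b_def)
  fix t s
  show "vp_phase q p (t + 2 * pi) = vp_phase q p t" by (simp add: vp_phase_def log_factor_periodic)
  show "cmod (vp_factor q p t) \<le> b ^ (gamma_exp p - 1)"
    "cmod (vp_factor q p t - vp_factor q p s) \<le> 2 * b ^ gamma_exp p * \<bar>t - s\<bar>"
    unfolding b_def by (rule vp_factor_bounds[OF q p])+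
  have e: "exp (log_factor r m t) = 1 - of_real r * cis (real m * t)" if "0 \<le> r" "r < 1" for r m t
    unfolding log_factor_def using one_minus_cis_nonzero[OF that] by simp
  have f: "vp_factor q p t = exp (log_factor (q ^ p) p t - 2 * log_factor q 1 t)" for t
  proof -
    have "exp (log_factor (q ^ p) p t - 2 * log_factor q 1 t) =
      exp (log_factor (q ^ p) p t) / (exp (log_factor q 1 t))\<^sup>2"
      by (simp add: exp_diff exp_double)
    then show ?thesis unfolding vp_factor_def using e[OF qp] e[of q 1 t] q by simp
  qed
  show "vp_factor q p (t + 2 * pi) = vp_factor q p t" unfolding f log_factor_periodic ..
  show "vp_factor q p t = of_real (cmod (vp_factor q p t)) * cis (vp_phase q p t)"
  proof -
    define W where "W = log_factor (q ^ p) p t - 2 * log_factor q 1 t"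
    have "Im W = vp_phase q p t" by (simp add: W_def vp_phase_def)
    then show ?thesis unfolding f W_def[symmetric] by (metis exp_eq_polar norm_exp_eq_Re)
  qed
  have I: "\<bar>Im (log_factor r m t)\<bar> \<le> pi" if "0 \<le> r" "r < 1" for r m
    unfolding log_factor_def
    using mpi_less_Im_Ln[OF one_minus_cis_nonzero(1)[OF that]] Im_Ln_le_pi[OF one_minus_cis_nonzero(1)[OF that]]
    by (simp add: abs_le_iff less_imp_le minus_le_iff)
  show "\<bar>vp_phase q p t\<bar> \<le> 3 * pi"
    using I[OF qp, of p] I[of q 1] q unfolding vp_phase_def by simp
  have "\<bar>Im (log_factor (q ^ p) p t) - Im (log_factor (q ^ p) p s)\<bar> \<le> b * \<bar>t - s\<bar>"
  proof -
    have "\<bar>Im (log_factor (q ^ p) p t) - Im (log_factor (q ^ p) p s)\<bar>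
        \<le> cmod (log_factor (q ^ p) p t - log_factor (q ^ p) p s)"
      using abs_Im_le_cmod[of "log_factor (q ^ p) p t - log_factor (q ^ p) p s"] by simp
    also have "\<dots> \<le> real p * q ^ p / (1 - q ^ p) * \<bar>t - s\<bar>" by (rule log_factor_lipschitz[OF qp])
    also have "\<dots> \<le> b * \<bar>t - s\<bar>"
      unfolding b_def using power_ratio_le[OF q p] by (intro mult_right_mono) auto
    finally show ?thesis .
  qed
  moreover have "\<bar>Im (log_factor q 1 t) - Im (log_factor q 1 s)\<bar> \<le> b * \<bar>t - s\<bar>"
  proof -
    have "\<bar>Im (log_factor q 1 t) - Im (log_factor q 1 s)\<bar> \<le> cmod (log_factor q 1 t - log_factor q 1 s)"
      using abs_Im_le_cmod[of "log_factor q 1 t - log_factor q 1 s"] by simp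
    also have "\<dots> \<le> real 1 * q / (1 - q) * \<bar>t - s\<bar>" by (rule log_factor_lipschitz) (use q in auto)
    also have "\<dots> \<le> b * \<bar>t - s\<bar>"
      unfolding b_def using q by (intro mult_right_mono divide_right_mono) auto
    finally show ?thesis .
  qed
  ultimately show "\<bar>vp_phase q p t - vp_phase q p s\<bar> \<le> 3 * b * \<bar>t - s\<bar>"
    unfolding vp_phase_def by (simp add: algebra_simps)
qed

section \<open>The elliptic integral\<close>

text \<open>Landen's substitution \<open>\<theta> = \<phi> + arcsin (\<rho> sin \<phi>)\<close>.\<close>

lemma landen:
  assumes r: "0 \<le> \<rho>" "\<rho> < 1"
  shows "integral {0..pi} (\<lambda>t. 1 / sqrt (1 + 2 * \<rho> * cos t + \<rho>\<^sup>2)) =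
    integral {0..pi} (\<lambda>t. 1 / sqrt (1 - \<rho>\<^sup>2 * (sin t)\<^sup>2))"
proof -
  define f where "f = (\<lambda>t. 1 / sqrt (1 + 2 * \<rho> * cos t + \<rho>\<^sup>2))"
  define \<theta> where "\<theta> = (\<lambda>x. x + arcsin (\<rho> * sin x))"
  define C where "C = (\<lambda>x. sqrt (1 - \<rho>\<^sup>2 * (sin x)\<^sup>2))"
  have s: "- 1 < \<rho> * sin x" "\<rho> * sin x < 1" for x
  proof -
    have "\<bar>\<rho> * sin x\<bar> \<le> \<rho> * 1" unfolding abs_mult using r by (intro mult_mono) auto
    with r show "- 1 < \<rho> * sin x" "\<rho> * sin x < 1" by auto
  qed
  have pos: "0 < 1 + 2 * \<rho> * cos t + \<rho>\<^sup>2" for t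
  proof -
    have "\<rho> * (- 1) \<le> \<rho> * cos t" using r by (intro mult_left_mono) auto
    then have "1 + 2 * \<rho> * cos t + \<rho>\<^sup>2 \<ge> (1 - \<rho>)\<^sup>2" by (simp add: power2_eq_square algebra_simps)
    moreover have "0 < (1 - \<rho>)\<^sup>2" using r by simp
    ultimately show ?thesis by linarith
  qed
  have fc: "continuous_on A f" for A
    unfolding f_def using pos by (intro continuous_intros) (auto simp: less_imp_neq[OF pos, symmetric])
  have d: "(\<theta> has_field_derivative 1 + \<rho> * cos x / C x) (at x within A)" for x A
    unfolding \<theta>_def C_def using s
    by (auto intro!: derivative_eq_intros simp: divide_inverse power_mult_distrib mult_ac)
  have "((\<lambda>x. (1 + \<rho> * cos x / C x) *\<^sub>R f (\<theta> x)) has_integral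
     (integral {\<theta> 0..\<theta> pi} f - integral {\<theta> pi..\<theta> 0} f)) {0..pi}"
  proof (rule has_integral_substitution_general[where s = "{}" and c = "-pi" and d = "2 * pi"])
    have "\<bar>arcsin (\<rho> * sin x)\<bar> \<le> pi / 2" for x
      using arcsin_lbound[of "\<rho> * sin x"] arcsin_ubound[of "\<rho> * sin x"] s[of x] by linarith
    then have "- pi \<le> \<theta> x \<and> \<theta> x \<le> 2 * pi" if "0 \<le> x" "x \<le> pi" for x
      using that pi_ge_zero unfolding \<theta>_def abs_le_iff by (smt (verit) field_sum_of_halves)
    then show "\<theta> ` {0..pi} \<subseteq> {-pi..2 * pi}" by auto
    show "continuous_on {0..pi} \<theta>"
      using d by (meson DERIV_continuous continuous_on_eq_continuous_within)
  qed (use d fc in auto)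
  moreover have "\<theta> 0 = 0" "\<theta> pi = pi" by (auto simp: \<theta>_def)
  \<comment> \<open>The radicand at \<open>\<theta> x\<close> is the square of the positive number
    \<open>C x + \<rho> * cos x\<close>, and the derivative of \<theta> is that number divided by
    \<open>C x\<close>, so it cancels.\<close>
  moreover have "(1 + \<rho> * cos x / C x) *\<^sub>R f (\<theta> x) = 1 / C x" for x
  proof -
    define a where "a = arcsin (\<rho> * sin x)"
    have sa: "sin a = \<rho> * sin x" unfolding a_def using s[of x] by (intro sin_arcsin) auto
    have ca: "cos a = C x" unfolding a_def C_def using s[of x] by (subst cos_arcsin) (auto simp: power_mult_distrib)
    have C2: "(C x)\<^sup>2 = 1 - \<rho>\<^sup>2 * (sin x)\<^sup>2"
      using sa ca by (metis cos_squared_eq power_mult_distrib)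
    have "(\<rho> * cos x)\<^sup>2 < (C x)\<^sup>2"
    proof -
      have "\<rho>\<^sup>2 < 1" using r by (simp add: power_less_one_iff)
      moreover have "(C x)\<^sup>2 - (\<rho> * cos x)\<^sup>2 = 1 - \<rho>\<^sup>2 * ((sin x)\<^sup>2 + (cos x)\<^sup>2)"
        unfolding C2 by algebra
      ultimately show ?thesis by simp
    qed
    moreover have C0: "0 \<le> C x" using C2 s[of x] unfolding C_def
      by (simp add: power_mult_distrib[symmetric] abs_square_le_1 abs_le_iff less_imp_le)
    ultimately have ab: "\<bar>\<rho> * cos x\<bar> < C x" by (metis abs_of_nonneg power2_less_imp_less power2_abs)
    have "1 + 2 * \<rho> * cos (x + a) + \<rho>\<^sup>2 = (C x + \<rho> * cos x)\<^sup>2"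
    proof -
      have "1 + 2 * \<rho> * cos (x + a) + \<rho>\<^sup>2 = 1 + 2 * \<rho> * cos x * C x - 2 * \<rho>\<^sup>2 * (sin x)\<^sup>2 + \<rho>\<^sup>2 * ((sin x)\<^sup>2 + (cos x)\<^sup>2)"
        unfolding cos_add sa ca sin_cos_squared_add by algebra
      also have "\<dots> = (C x)\<^sup>2 + 2 * \<rho> * cos x * C x + \<rho>\<^sup>2 * (cos x)\<^sup>2"
        unfolding C2 by algebra
      finally show ?thesis by (simp add: power2_eq_square algebra_simps)
    qed
    then have "f (\<theta> x) = 1 / (C x + \<rho> * cos x)"
      using ab unfolding f_def \<theta>_def a_def[symmetric] by simp
    then show ?thesis using ab by (simp add: field_simps)
  qed
  ultimately have "((\<lambda>x. 1 / C x) has_integral (integral {0..pi} f - integral {pi..0} f)) {0..pi}" by simp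
  moreover have "integral {pi..0} f = 0" using pi_gt_zero by simp
  ultimately show ?thesis unfolding f_def C_def by (simp add: integral_unique)
qed

text \<open>Reflecting \<open>t\<close> to \<open>pi - t\<close> flips the sign of the cosine to fit
  \<open>landen\<close>. The 4 comes from two symmetries: about \<open>pi\<close> before Landen's
  substitution and about \<open>pi / 2\<close> after it.\<close>

lemma elliptic_K_landen:
  assumes r: "0 \<le> \<rho>" "\<rho> < 1"
  shows "integral {-pi..pi} (\<lambda>t. 1 / cmod (1 - of_real \<rho> * cis t)) = 4 * elliptic_K \<rho>"
proof -
  have cm: "cmod (1 - of_real \<rho> * cis t) = sqrt (1 + 2 * \<rho> * cos (pi - t) + \<rho>\<^sup>2)" for t
  proof -
    have "(1 - \<rho> * cos t)\<^sup>2 + (\<rho> * sin t)\<^sup>2 = 1 - 2 * \<rho> * cos t + \<rho>\<^sup>2 * ((sin t)\<^sup>2 + (cos t)\<^sup>2)"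
      by algebra
    then show ?thesis by (simp add: cmod_def)
  qed
  define f where "f = (\<lambda>t. 1 / sqrt (1 + 2 * \<rho> * cos t + \<rho>\<^sup>2))"
  define K where "K = (\<lambda>t. 1 / sqrt (1 - \<rho>\<^sup>2 * (sin t)\<^sup>2))"
  have "0 < cmod (1 - of_real \<rho> * cis t)" for t using one_minus_cis_nonzero[OF r] by simp
  then have "0 < 1 + 2 * \<rho> * cos (pi - (pi - t)) + \<rho>\<^sup>2" for t unfolding cm by (metis real_sqrt_gt_0_iff)
  then have pos: "0 < 1 + 2 * \<rho> * cos t + \<rho>\<^sup>2" for t by simp
  have fc: "continuous_on UNIV f"
    unfolding f_def using pos by (intro continuous_intros) (auto simp: less_imp_neq[OF pos, symmetric])
  have "0 < 1 - \<rho>\<^sup>2 * (sin t)\<^sup>2" for t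
  proof -
    have "\<rho>\<^sup>2 * (sin t)\<^sup>2 \<le> \<rho>\<^sup>2 * 1" by (intro mult_left_mono) (auto simp: abs_square_le_1)
    moreover have "\<rho>\<^sup>2 < 1" using r by (simp add: power_less_one_iff)
    ultimately show ?thesis by linarith
  qed
  then have Kc: "continuous_on UNIV K"
    unfolding K_def by (intro continuous_intros) (auto simp: less_imp_neq[symmetric])
  have "integral {-pi..pi} (\<lambda>t. 1 / cmod (1 - of_real \<rho> * cis t)) = integral {-pi..pi} (\<lambda>t. f (pi - t))"
    unfolding cm f_def ..
  also have "\<dots> = integral {0..2 * pi} f" using integral_reflect_affine[OF fc, of "-pi" pi pi] by simp
  also have "\<dots> = integral {0..pi} f + integral {pi..2 * pi} f"
    by (intro Henstock_Kurzweil_Integration.integral_combine[symmetric] continuous_integrable[OF fc]) auto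
  also have "integral {pi..2 * pi} f = integral {pi..2 * pi} (\<lambda>t. f (2 * pi - t))"
    unfolding f_def by (simp add: cos_diff)
  also have "\<dots> = integral {0..pi} f" using integral_reflect_affine[OF fc, of pi "2 * pi" "2 * pi"] by simp
  also have "integral {0..pi} f = integral {0..pi} K" unfolding f_def K_def by (rule landen[OF r])
  also have "integral {0..pi} K = integral {0..pi/2} K + integral {pi/2..pi} K"
    by (intro Henstock_Kurzweil_Integration.integral_combine[symmetric] continuous_integrable[OF Kc]) auto
  also have "integral {pi/2..pi} K = integral {pi/2..pi} (\<lambda>t. K (pi - t))" by (simp add: K_def)
  also have "\<dots> = integral {0..pi/2} K" using integral_reflect_affine[OF Kc, of "pi/2" pi pi] by simp
  finally show ?thesis unfolding elliptic_K_def K_def by simp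
qed

section \<open>Dilation, the Poisson kernel and the mean modulus of the kernel\<close>

lemma C_per_integral_multiple:
  assumes f: "f \<in> C_per"
  shows "integral {a..a + 2 * pi * real p} f = real p * integral {-pi..pi} f"
proof (induction p)
  case (Suc p)
  have c: "continuous_on UNIV f" by (rule C_per_continuous[OF f])
  have "integral {a..a + 2 * pi * real p} f + integral {a + 2 * pi * real p..a + 2 * pi * real p + 2 * pi} f
     = integral {a..a + 2 * pi * real p + 2 * pi} f"
    by (intro Henstock_Kurzweil_Integration.integral_combine continuous_integrable[OF c]) auto
  then show ?case unfolding Suc C_per_integral[OF f] by (simp add: algebra_simps)
qed simp

lemma C_per_dilate:
  assumes "f \<in> C_per"
  shows "(\<lambda>t. f (real p * t)) \<in> C_per"
proof -
  have "f (real p * (t + 2 * pi)) = f (real p * t)" for t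
    using periodic_int[of f "2 * pi" "real p * t" "int p"] C_per_periodic[OF assms]
    by (simp add: algebra_simps)
  moreover have "continuous_on UNIV (\<lambda>t. f (real p * t))"
    by (rule continuous_on_compose2[OF C_per_continuous[OF assms]]) (auto intro!: continuous_intros)
  ultimately show ?thesis by (simp add: C_per_def)
qed

text \<open>The dilated function has period \<open>d = 2 * pi / p\<close>, so its harmonic of order
  \<open>m\<close> is unchanged when the phase moves by \<open>m * d\<close>. The sum of the two
  opposite moves is \<open>2 * cos (m * d)\<close> times the harmonic, which forces zero unless
  \<open>cos (m * d) = 1\<close>, that is, unless \<open>p\<close> divides \<open>m\<close>.\<close>

lemma harmonic_dilate:
  assumes f: "f \<in> C_per" and p: "p \<ge> 1"
  shows "harmonic (\<lambda>t. f (real p * t)) (p * l) y = harmonic f l y"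
    "\<not> p dvd m \<Longrightarrow> harmonic (\<lambda>t. f (real p * t)) m y = 0"
proof -
  define F where "F = (\<lambda>t. f (real p * t))"
  have F: "F \<in> C_per" unfolding F_def by (rule C_per_dilate[OF f])
  have p0: "real p > 0" using p by simp
  have h: "(\<lambda>s. f s * cos (real l * s - y)) \<in> C_per" by (rule C_per_trig[OF f])
  have "integral {-pi..pi} (\<lambda>t. F t * cos (real (p * l) * t - y)) =
     integral {-pi..pi} (\<lambda>t. (\<lambda>s. f s * cos (real l * s - y)) (real p * t + 0))"
    by (simp add: F_def mult_ac)
  also have "\<dots> = integral {real p * (-pi) + 0..real p * pi + 0} (\<lambda>s. f s * cos (real l * s - y)) / real p"
    by (rule integral_affine[OF C_per_continuous[OF h] p0])
  also have "real p * pi + 0 = (real p * (-pi) + 0) + 2 * pi * real p" by (simp add: algebra_simps)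
  also have "integral {real p * (-pi) + 0..(real p * (-pi) + 0) + 2 * pi * real p} (\<lambda>s. f s * cos (real l * s - y))
     / real p = integral {-pi..pi} (\<lambda>s. f s * cos (real l * s - y))"
    unfolding C_per_integral_multiple[OF h] using p0 by simp
  finally show "harmonic (\<lambda>t. f (real p * t)) (p * l) y = harmonic f l y"
    unfolding harmonic_def F_def by simp
  assume m: "\<not> p dvd m"
  define d where "d = 2 * pi / real p"
  have Fd: "F (t + d) = F t" for t
    using C_per_periodic[OF f, of "real p * t"] p0 by (simp add: F_def d_def distrib_left)
  have rot: "harmonic F m (y + real m * d) = harmonic F m y" for y
  proof -
    define h where "h = (\<lambda>t. F t * cos (real m * t - (y + real m * d)))"
    have h: "h \<in> C_per" unfolding h_def by (rule C_per_trig[OF F])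
    have "integral {-pi..pi} h = integral {-pi + d..-pi + d + 2 * pi} h" by (rule C_per_integral[OF h, symmetric])
    also have "\<dots> = integral {-pi..pi} (\<lambda>t. h (1 * t + d))"
      using integral_affine[OF C_per_continuous[OF h], of 1 "-pi" pi d] by (simp add: algebra_simps)
    also have "(\<lambda>t. h (1 * t + d)) = (\<lambda>t. F t * cos (real m * t - y))"
      unfolding h_def by (simp add: Fd algebra_simps)
    finally show ?thesis by (simp add: harmonic_def h_def)
  qed
  have "harmonic F m (y + real m * d) + harmonic F m (y - real m * d) = 2 * cos (real m * d) * harmonic F m y"
    unfolding harmonic_eq[OF F] cos_add cos_diff sin_add sin_diff by (simp add: algebra_simps)
  then have "(1 - cos (real m * d)) * harmonic F m y = 0"
    using rot[of y] rot[of "y - real m * d"] by (simp add: algebra_simps)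
  moreover have "cos (real m * d) \<noteq> 1"
  proof
    assume "cos (real m * d) = 1"
    then obtain n :: int where "real m * d = of_int n * 2 * pi" unfolding cos_one_2pi_int by blast
    then have "real m = of_int n * real p" using p0 by (simp add: d_def field_simps)
    then have "int m = n * int p" by (metis of_int_eq_iff of_int_mult of_int_of_nat_eq)
    then have "int p dvd int m" by simp
    with m show False by simp
  qed
  ultimately show "harmonic (\<lambda>t. f (real p * t)) m y = 0" by (simp add: F_def)
qed

text \<open>Normalised to mean value 1, so its expansion is
  \<open>1 + 2 * r * cos t + 2 * r^2 * cos (2 * t) + ...\<close>. For \<open>r = q\<close> the
  squared modulus is that of the denominator of \<open>vp_factor\<close>.\<close>

definition poisson :: "real \<Rightarrow> real \<Rightarrow> real" where
  "poisson r t = (1 - r\<^sup>2) / (cmod (1 - of_real r * cis t))\<^sup>2"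

lemma poisson_sums:
  assumes r: "0 \<le> r" "r < 1"
  shows "(\<lambda>k. r ^ Suc k * cos (real (Suc k) * t)) sums ((poisson r t - 1) / 2)"
proof -
  define z where "z = of_real r * cis t"
  have z: "norm z < 1" using r by (simp add: z_def norm_mult)
  have z1: "1 - z \<noteq> 0" unfolding z_def by (rule one_minus_cis_nonzero[OF r])
  have "(\<lambda>k. z * z ^ k) sums (z * (1 / (1 - z)))" by (intro sums_mult geometric_sums z)
  then have "(\<lambda>k. Re (z ^ Suc k)) sums Re (z / (1 - z))" by (intro sums_Re) simp
  moreover have "Re (z ^ Suc k) = r ^ Suc k * cos (real (Suc k) * t)" for k
    unfolding z_def power_mult_distrib Complex.DeMoivre by (simp del: power_Suc of_nat_Suc flip: of_real_power)
  moreover have "Re (z / (1 - z)) = (poisson r t - 1) / 2"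
  proof -
    have n: "(cmod (1 - z))\<^sup>2 > 0" using z1 by simp
    have "z / (1 - z) = z * cnj (1 - z) / of_real ((cmod (1 - z))\<^sup>2)"
      by (subst complex_div_cnj) simp
    then have "Re (z / (1 - z)) = Re (z * cnj (1 - z)) / (cmod (1 - z))\<^sup>2" by (simp only: Re_divide_of_real)
    also have "Re (z * cnj (1 - z)) = ((1 - r\<^sup>2) - (cmod (1 - z))\<^sup>2) / 2"
    proof -
      have s: "(Re z)\<^sup>2 + (Im z)\<^sup>2 = r\<^sup>2"
        using sin_cos_squared_add[of t] unfolding z_def by (simp add: power_mult_distrib distrib_left[symmetric])
      have R: "Re (z * cnj (1 - z)) = Re z - ((Re z)\<^sup>2 + (Im z)\<^sup>2)"
        by (simp add: power2_eq_square algebra_simps)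
      have C: "(cmod (1 - z))\<^sup>2 = 1 - 2 * Re z + ((Re z)\<^sup>2 + (Im z)\<^sup>2)"
        unfolding cmod_power2 by (simp add: power2_eq_square algebra_simps)
      show ?thesis unfolding R C s by (simp add: field_simps)
    qed
    finally show ?thesis using n by (simp add: poisson_def z_def[symmetric] diff_divide_distrib)
  qed
  ultimately show ?thesis by simp
qed

lemma integral_poisson:
  assumes f: "f \<in> C_per" and r: "0 \<le> r" "r < 1"
  shows "(\<lambda>k. r ^ Suc k * harmonic f (Suc k) 0) sums
    ((1 / pi) * (integral {-pi..pi} (\<lambda>t. f t * poisson r t) - integral {-pi..pi} f) / 2)"
proof -
  obtain M where M: "\<And>x. \<bar>f x\<bar> \<le> M" "M \<ge> 0" using C_per_bounded[OF f] by blast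
  have c: "continuous_on UNIV f" by (rule C_per_continuous[OF f])
  have "(cmod (1 - of_real r * cis t))\<^sup>2 \<noteq> 0" for t using one_minus_cis_nonzero[OF r] by simp
  then have pc: "continuous_on UNIV (poisson r)"
    unfolding poisson_def cis_conv_exp by (intro continuous_intros) (auto simp: cis_conv_exp)
  define h where "h = (\<lambda>k t. r ^ Suc k * (f t * cos (real (Suc k) * t - 0)))"
  have "(\<lambda>k. integral {-pi..pi} (h k)) sums integral {-pi..pi} (\<lambda>t. \<Sum>k. h k t)"
  proof (rule integral_suminf)
    show "continuous_on UNIV (h k)" for k unfolding h_def by (intro continuous_intros c)
    show "\<bar>h k t\<bar> \<le> M * r ^ k" for k t
    proof -
      have "\<bar>f t * cos (real (Suc k) * t - 0)\<bar> \<le> M * 1"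
        unfolding abs_mult using M by (intro mult_mono abs_cos_le_one) auto
      moreover have "r ^ Suc k \<le> r ^ k" using r by (intro power_decreasing) auto
      ultimately have "\<bar>h k t\<bar> \<le> r ^ k * (M * 1)"
        unfolding h_def abs_mult[of "r ^ _"] using r by (intro mult_mono) auto
      then show ?thesis by (simp add: mult.commute)
    qed
    show "summable (\<lambda>k. M * r ^ k)" using r by (intro summable_mult summable_geometric) auto
  qed
  also have "(\<lambda>t. \<Sum>k. h k t) = (\<lambda>t. (1/2) * (f t * poisson r t - f t))"
  proof
    fix t
    have "(\<lambda>k. f t * (r ^ Suc k * cos (real (Suc k) * t))) sums (f t * ((poisson r t - 1) / 2))"
      by (intro sums_mult poisson_sums r)
    then show "(\<Sum>k. h k t) = (1/2) * (f t * poisson r t - f t)"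
      by (simp add: h_def sums_iff mult_ac right_diff_distrib del: of_nat_Suc)
  qed
  also have "integral {-pi..pi} (\<lambda>t. (1/2) * (f t * poisson r t - f t)) =
      (1/2) * (integral {-pi..pi} (\<lambda>t. f t * poisson r t) - integral {-pi..pi} f)"
    unfolding integral_mult_right
    by (subst integral_diff) (auto intro!: continuous_integrable continuous_intros c pc)
  finally have "(\<lambda>k. (1 / pi) * integral {-pi..pi} (h k)) sums
     ((1 / pi) * ((1/2) * (integral {-pi..pi} (\<lambda>t. f t * poisson r t) - integral {-pi..pi} f)))"
    by (rule sums_mult)
  moreover have "(1 / pi) * integral {-pi..pi} (h k) = r ^ Suc k * harmonic f (Suc k) 0" for k
    unfolding h_def integral_mult_right harmonic_def by simp
  ultimately show ?thesis by simp
qed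

text \<open>A function of \<open>p * t\<close> meets only the orders divisible by \<open>p\<close>
  in the Poisson series, and their coefficients \<open>r ^ (p * k)\<close> are those of the Poisson
  kernel with parameter \<open>r ^ p\<close>.\<close>

lemma integral_poisson_dilate:
  assumes f: "f \<in> C_per" and p: "p \<ge> 1" and r: "0 \<le> r" "r < 1"
  shows "integral {-pi..pi} (\<lambda>t. f (real p * t) * poisson r t) = integral {-pi..pi} (\<lambda>t. f t * poisson (r ^ p) t)"
proof -
  define F where "F = (\<lambda>t. f (real p * t))"
  have F: "F \<in> C_per" unfolding F_def by (rule C_per_dilate[OF f])
  have rp: "0 \<le> r ^ p" "r ^ p < 1" using r p by (auto intro: power_less_one_iff[THEN iffD2])
  define a where "a = (\<lambda>k. r ^ Suc k * harmonic F (Suc k) 0)"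
  \<comment> \<open>The series is indexed from order 1, so the order \<open>p * (j + 1)\<close> sits
    at index \<open>p * (j + 1) - 1\<close>.\<close>
  define g where "g = (\<lambda>j. p * Suc j - 1)"
  have g: "Suc (g j) = p * Suc j" for j using p by (simp add: g_def)
  have "strict_mono g"
  proof (rule strict_monoI_Suc)
    show "g j < g (Suc j)" for j using g[of j] g[of "Suc j"] p by simp
  qed
  moreover have "a n = 0" if "n \<notin> range g" for n
  proof -
    have "\<not> p dvd Suc n"
    proof
      assume "p dvd Suc n"
      then obtain l where l: "Suc n = p * l" by (auto simp: dvd_def)
      then obtain j where "l = Suc j" by (cases l) auto
      with l g[of j] have "n = g j" by simp
      with that show False by simp
    qed
    then show ?thesis unfolding a_def F_def by (simp add: harmonic_dilate(2)[OF f p])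
  qed
  ultimately have "(\<lambda>j. a (g j)) sums c \<longleftrightarrow> a sums c" for c by (rule sums_mono_reindex)
  moreover have "a (g j) = (r ^ p) ^ Suc j * harmonic f (Suc j) 0" for j
    unfolding a_def g F_def harmonic_dilate(1)[OF f p] by (simp only: power_mult)
  ultimately have "a sums ((1 / pi) * (integral {-pi..pi} (\<lambda>t. f t * poisson (r ^ p) t) - integral {-pi..pi} f) / 2)"
    using integral_poisson[OF f rp] by simp
  moreover have "a sums ((1 / pi) * (integral {-pi..pi} (\<lambda>t. F t * poisson r t) - integral {-pi..pi} F) / 2)"
    unfolding a_def by (rule integral_poisson[OF F r])
  moreover have "integral {-pi..pi} F = integral {-pi..pi} f"
    using harmonic_dilate(1)[OF f p, of 0 0] by (simp add: harmonic_def F_def)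
  ultimately have "(1 / pi) * (integral {-pi..pi} (\<lambda>t. F t * poisson r t) - integral {-pi..pi} F) / 2 =
     (1 / pi) * (integral {-pi..pi} (\<lambda>t. f t * poisson (r ^ p) t) - integral {-pi..pi} F) / 2"
    by (metis sums_unique2)
  then show ?thesis by (simp add: F_def)
qed

text \<open>The squared denominator turns the modulus into \<open>f (p * t)\<close> times a Poisson
  kernel. Undilating replaces \<open>q\<close> by \<open>\<rho> = q ^ p\<close> in the kernel, whose
  denominator \<open>(f t)^2\<close> then cancels against \<open>f t\<close> down to
  \<open>1 / f t\<close>.\<close>

lemma integral_vp_factor:
  assumes q: "0 < q" "q < 1" and p: "p \<ge> 1"
  shows "integral {-pi..pi} (\<lambda>t. cmod (vp_factor q p t)) = 4 * ((1 - q ^ (2 * p)) / (1 - q\<^sup>2)) * elliptic_K (q ^ p)"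
proof -
  define \<rho> where "\<rho> = q ^ p"
  have \<rho>: "0 \<le> \<rho>" "\<rho> < 1" using q p by (auto simp: \<rho>_def intro: power_less_one_iff[THEN iffD2])
  have q2: "1 - q\<^sup>2 > 0" using q by (simp add: power_less_one_iff)
  define f where "f = (\<lambda>t. cmod (1 - of_real \<rho> * cis t))"
  have f: "f \<in> C_per"
  proof -
    have "cis (t + 2 * pi) = cis t" for t by (simp add: complex_eq_iff)
    moreover have "continuous_on UNIV f"
      unfolding f_def cis_conv_exp by (intro continuous_intros)
    ultimately show ?thesis by (simp add: C_per_def f_def)
  qed
  have "cmod (vp_factor q p t) = (1 / (1 - q\<^sup>2)) * (f (real p * t) * poisson q t)" for t
    unfolding vp_factor_def f_def poisson_def \<rho>_def norm_divide norm_power using q2 by simp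
  then have "integral {-pi..pi} (\<lambda>t. cmod (vp_factor q p t)) =
     (1 / (1 - q\<^sup>2)) * integral {-pi..pi} (\<lambda>t. f (real p * t) * poisson q t)"
    by (simp only: integral_mult_right)
  also have "integral {-pi..pi} (\<lambda>t. f (real p * t) * poisson q t) = integral {-pi..pi} (\<lambda>t. f t * poisson \<rho> t)"
    unfolding \<rho>_def using q by (intro integral_poisson_dilate f p) auto
  also have "(\<lambda>t. f t * poisson \<rho> t) = (\<lambda>t. (1 - \<rho>\<^sup>2) * (1 / cmod (1 - of_real \<rho> * cis t)))"
    using one_minus_cis_nonzero(1)[OF \<rho>] by (auto simp: f_def poisson_def power2_eq_square)
  also have "integral {-pi..pi} \<dots> = (1 - \<rho>\<^sup>2) * (4 * elliptic_K \<rho>)"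
    unfolding integral_mult_right elliptic_K_landen[OF \<rho>] ..
  also have "\<rho>\<^sup>2 = q ^ (2 * p)" by (simp add: \<rho>_def power_mult[symmetric] mult.commute)
  finally show ?thesis unfolding \<rho>_def by simp
qed

section \<open>The asymptotic formula\<close>

lemma D_set_summable:
  assumes "\<psi> \<in> D_set q" "q < 1"
  shows "summable (\<lambda>k. \<psi> (Suc k))"
proof -
  have pos: "\<psi> k > 0" if "k \<ge> 1" for k using assms(1) that by (simp add: D_set_def)
  obtain r where r: "q < r" "r < 1" using dense[OF assms(2)] by blast
  have "(\<lambda>k. \<psi> (k + 1) / \<psi> k) \<longlonglongrightarrow> q" using assms(1) by (simp add: D_set_def)
  then have "\<forall>\<^sub>F k in sequentially. \<psi> (k + 1) / \<psi> k < r" by (rule order_tendstoD) (rule r)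
  then obtain M where M: "\<And>k. k \<ge> M \<Longrightarrow> \<psi> (k + 1) / \<psi> k < r"
    unfolding eventually_sequentially by blast
  show ?thesis
  proof (rule summable_ratio_test[OF r(2)])
    fix k assume "k \<ge> M"
    then have "\<psi> (Suc k + 1) / \<psi> (Suc k) < r" by (intro M) simp
    then show "norm (\<psi> (Suc (Suc k))) \<le> r * norm (\<psi> (Suc k))"
      using pos[of "Suc k"] pos[of "Suc (Suc k)"] by (simp add: pos_divide_less_eq)
  qed
qed

text \<open>Induction through \<open>P (j + 1) - q ^ (j + 1) = P j * (r j - q) + q * (P j - q ^
  j)\<close>, where \<open>P j \<le> (q + \<epsilon>) ^ j\<close>. The truncated exponent at
  \<open>j = 0\<close> is harmless because of the factor \<open>real j\<close>.\<close>

lemma ratio_product_error: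
  fixes \<psi> :: "nat \<Rightarrow> real"
  assumes \<psi>: "\<And>k. k \<ge> N \<Longrightarrow> \<psi> k > 0" and q: "q \<ge> 0"
    and dev: "\<And>k. k \<ge> N \<Longrightarrow> \<bar>\<psi> (k + 1) / \<psi> k - q\<bar> \<le> \<epsilon>"
  shows "\<bar>\<psi> (N + j) / \<psi> N - q ^ j\<bar> \<le> real j * \<epsilon> * (q + \<epsilon>) ^ (j - 1)"
proof -
  define P where "P = (\<lambda>j. \<psi> (N + j) / \<psi> N)"
  have e: "\<epsilon> \<ge> 0" using dev[of N] by linarith
  have P0: "P j > 0" for j using \<psi>[of N] \<psi>[of "N + j"] by (simp add: P_def)
  define r where "r = (\<lambda>j. \<psi> (N + j + 1) / \<psi> (N + j))"
  have r: "\<bar>r j - q\<bar> \<le> \<epsilon>" for j using dev[of "N + j"] by (simp add: r_def)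
  have PS: "P (Suc j) = P j * r j" for j using \<psi>[of "N + j"] by (simp add: P_def r_def)
  have Px: "P j \<le> (q + \<epsilon>) ^ j" for j
  proof (induction j)
    case 0
    then show ?case using \<psi>[of N] by (simp add: P_def)
  next
    case (Suc j)
    have "P (Suc j) \<le> (q + \<epsilon>) ^ j * (q + \<epsilon>)"
      unfolding PS using Suc r[of j] P0[of j] P0[of "Suc j"] q e
      by (intro mult_mono') (auto simp: PS zero_less_mult_iff abs_le_iff)
    then show ?case by (simp add: mult.commute)
  qed
  have "\<bar>P j - q ^ j\<bar> \<le> real j * \<epsilon> * (q + \<epsilon>) ^ (j - 1)"
  proof (induction j)
    case 0
    then show ?case using \<psi>[of N] by (simp add: P_def)
  next
    case (Suc j)
    have "P (Suc j) - q ^ Suc j = P j * (r j - q) + q * (P j - q ^ j)" by (simp add: PS algebra_simps)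
    then have "\<bar>P (Suc j) - q ^ Suc j\<bar> \<le> P j * \<bar>r j - q\<bar> + q * \<bar>P j - q ^ j\<bar>"
      using abs_triangle_ineq[of "P j * (r j - q)" "q * (P j - q ^ j)"] P0[of j] q by (simp add: abs_mult)
    also have "\<dots> \<le> (q + \<epsilon>) ^ j * \<epsilon> + q * (real j * \<epsilon> * (q + \<epsilon>) ^ (j - 1))"
      using Px[of j] r[of j] P0[of j] q e Suc by (intro add_mono mult_mono) auto
    also have "q * (real j * \<epsilon> * (q + \<epsilon>) ^ (j - 1)) \<le> (q + \<epsilon>) * (real j * \<epsilon> * (q + \<epsilon>) ^ (j - 1))"
      using q e by (intro mult_right_mono) auto
    also have "\<dots> = real j * \<epsilon> * (q + \<epsilon>) ^ j" by (cases j) auto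
    finally show ?case by (simp add: algebra_simps)
  qed
  then show ?thesis by (simp add: P_def)
qed

text \<open>The assumption on \<epsilon> gives
  \<open>1 - (q + \<epsilon>) \<ge> (1 - q) / 2\<close>. Bounding the weight by \<open>p\<close>
  leaves a second-order sum, bounding it by \<open>j + 1\<close> a third-order one; the latter sets
  the constant, as \<open>2 / ((1 - q) / 2) ^ 3 = 16 / (1 - q) ^ 3\<close>.\<close>

lemma weighted_ratio_error:
  fixes q \<epsilon> :: real and p :: nat
  assumes q: "0 < q" "q < 1" and e: "0 \<le> \<epsilon>" "\<epsilon> \<le> (1 - q) / 2"
  defines "m \<equiv> (\<lambda>j. real (min (Suc j) p) * (real j * \<epsilon> * (q + \<epsilon>) ^ (j - 1)))"
  shows "summable m" "(\<Sum>j. m j) \<le> 16 * (\<epsilon> / (1 - q)\<^sup>2 * min (real p) (1 / (1 - q)))"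
proof -
  define x where "x = q + \<epsilon>"
  have x: "0 \<le> x" "x < 1" "(1 - q) / 2 \<le> 1 - x" using q e by (auto simp: x_def)
  have m0: "0 \<le> m j" for j using x e unfolding m_def x_def[symmetric] by simp
  have "(\<Sum>j<n. m j) \<le> 16 * (\<epsilon> / (1 - q)\<^sup>2 * min (real p) (1 / (1 - q)))" for n
  proof (cases n)
    case 0
    then show ?thesis using q e by simp
  next
    case (Suc k)
    have mS: "m (Suc i) = \<epsilon> * (real (min (i + 2) p) * (real (i + 1) * x ^ i))" for i
      unfolding m_def x_def[symmetric] by (simp add: mult_ac)
    have "(\<Sum>j<n. m j) = (\<Sum>i<k. m (Suc i))"
      unfolding Suc sum.lessThan_Suc_shift by (simp add: m_def)
    also have "\<dots> = \<epsilon> * (\<Sum>i<k. real (min (i + 2) p) * (real (i + 1) * x ^ i))"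
      unfolding mS sum_distrib_left ..
    also have "\<dots> \<le> \<epsilon> * (16 / (1 - q)\<^sup>2 * min (real p) (1 / (1 - q)))"
    proof (rule mult_left_mono[OF _ e(1)])
      have "(\<Sum>i<k. real (min (i + 2) p) * (real (i + 1) * x ^ i)) \<le> (\<Sum>i<k. real p * (real (i + 1) * x ^ i))"
        using x by (intro sum_mono mult_right_mono) auto
      also have "\<dots> = real p * (\<Sum>i<k. real (i + 1) * x ^ i)" by (simp add: sum_distrib_left)
      also have "\<dots> \<le> real p * (1 / (1 - x)\<^sup>2)" using x by (intro mult_left_mono sum_power_le) auto
      also have "1 / (1 - x)\<^sup>2 \<le> 1 / ((1 - q) / 2)\<^sup>2"
        using x q by (intro divide_left_mono power_mono) auto
      also have "\<dots> \<le> 16 / (1 - q)\<^sup>2" by (simp add: power_divide divide_right_mono)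
      finally have 1: "(\<Sum>i<k. real (min (i + 2) p) * (real (i + 1) * x ^ i)) \<le> real p * (16 / (1 - q)\<^sup>2)"
        by (simp add: mult_left_mono)
      have "(\<Sum>i<k. real (min (i + 2) p) * (real (i + 1) * x ^ i))
          \<le> (\<Sum>i<k. real (i + 2) * (real (i + 1) * x ^ i))"
        using x by (intro sum_mono mult_right_mono) auto
      also have "\<dots> = (\<Sum>i<k. real (i + 1) * real (i + 2) * x ^ i)" by (simp only: mult_ac)
      also have "\<dots> \<le> 2 / (1 - x) ^ 3" using x by (intro sum_power_le) auto
      also have "\<dots> \<le> 2 / ((1 - q) / 2) ^ 3"
        using x q by (intro divide_left_mono power_mono) auto
      also have "\<dots> = 1 / (1 - q) * (16 / (1 - q)\<^sup>2)"
        by (simp add: power_divide power2_eq_square power3_eq_cube)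
      finally have 2: "(\<Sum>i<k. real (min (i + 2) p) * (real (i + 1) * x ^ i)) \<le> 1 / (1 - q) * (16 / (1 - q)\<^sup>2)" .
      show "(\<Sum>i<k. real (min (i + 2) p) * (real (i + 1) * x ^ i))
          \<le> 16 / (1 - q)\<^sup>2 * min (real p) (1 / (1 - q))"
        using 1 2 by (simp add: min_def mult.commute)
    qed
    finally show ?thesis by (simp add: mult_ac)
  qed
  note b = this
  show s: "summable m" by (rule summableI_nonneg_bounded[OF m0 b])
  show "(\<Sum>j. m j) \<le> 16 * (\<epsilon> / (1 - q)\<^sup>2 * min (real p) (1 / (1 - q)))"
    by (rule suminf_le_const[OF s b])
qed

lemma harmonic_shift:
  assumes f: "f \<in> C_per"
  shows "harmonic f k (real k * x - g) = harmonic (\<lambda>t. f (x + t)) k (- g)"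
proof -
  define h where "h = (\<lambda>t. f t * cos (real k * t - (real k * x - g)))"
  have h: "h \<in> C_per" unfolding h_def by (rule C_per_trig[OF f])
  have "integral {-pi..pi} h = integral {-pi + x..-pi + x + 2 * pi} h" by (rule C_per_integral[OF h, symmetric])
  also have "\<dots> = integral {-pi..pi} (\<lambda>t. h (1 * t + x))"
    using integral_affine[OF C_per_continuous[OF h], of 1 "-pi" pi x] by (simp add: algebra_simps)
  also have "(\<lambda>t. h (1 * t + x)) = (\<lambda>t. f (x + t) * cos (real k * t - (- g)))"
    unfolding h_def by (simp add: algebra_simps)
  finally show ?thesis by (simp add: harmonic_def h_def)
qed

text \<open>The \<open>kernel\<close> of the locale for this factor, kept outside it so that the
  expansion holds without a size condition on \<open>N\<close>.\<close>

definition vp_kernel :: "real \<Rightarrow> nat \<Rightarrow> real \<Rightarrow> nat \<Rightarrow> real \<Rightarrow> real" where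
  "vp_kernel q p c N t = Re (cis (real N * t + c) * vp_factor q p t)"

lemma vp_kernel_sums:
  assumes q: "0 < q" "q < 1"
  shows "(\<lambda>j. real (min (Suc j) p) * q ^ j * cos (real (N + j) * t + c)) sums vp_kernel q p c N t"
proof -
  have "Re (cis (real N * t + c) * (of_real w * cis (real j * t))) = w * cos (real (N + j) * t + c)" for w j
  proof -
    have "cis (real N * t + c) * (of_real w * cis (real j * t)) = of_real w * cis (real (N + j) * t + c)"
      by (simp add: cis_mult algebra_simps)
    then have "Re (cis (real N * t + c) * (of_real w * cis (real j * t))) = Re (of_real w * cis (real (N + j) * t + c))"
      by (rule arg_cong)
    then show ?thesis by simp
  qed
  with sums_Re[OF sums_mult[OF vp_factor_sums[OF q, of p t], of "cis (real N * t + c)"]]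
  show ?thesis unfolding vp_kernel_def by simp
qed

lemma vp_kernel_integral:
  assumes q: "0 < q" "q < 1" and p: "p \<ge> 1" and f: "f \<in> C_per"
  shows "(\<lambda>j. real (min (Suc j) p) * q ^ j * harmonic f (N + j) (- c)) sums
    (1 / pi * integral {-pi..pi} (\<lambda>t. f t * vp_kernel q p c N t))"
proof -
  obtain M where M: "\<And>x. \<bar>f x\<bar> \<le> M" "M \<ge> 0" using C_per_bounded[OF f] by blast
  define w where "w = (\<lambda>j. real (min (Suc j) p) * q ^ j)"
  have w: "w j \<ge> 0" for j using q by (simp add: w_def)
  define h where "h = (\<lambda>j t. w j * (f t * cos (real (N + j) * t - (- c))))"
  have "(\<lambda>j. integral {-pi..pi} (h j)) sums integral {-pi..pi} (\<lambda>t. \<Sum>j. h j t)"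
  proof (rule integral_suminf)
    show "continuous_on UNIV (h j)" for j
      unfolding h_def by (intro continuous_intros C_per_continuous[OF f])
    show "\<bar>h j t\<bar> \<le> w j * M" for j t
    proof -
      have "\<bar>f t * cos (real (N + j) * t - (- c))\<bar> \<le> M * 1"
        unfolding abs_mult using M by (intro mult_mono abs_cos_le_one) auto
      then show ?thesis unfolding h_def abs_mult[of "w j"] using w[of j] by (intro mult_mono) auto
    qed
    show "summable (\<lambda>j. w j * M)"
      unfolding w_def by (rule summable_mult2[OF weighted_power_sums(1)[OF q p]])
  qed
  also have "(\<lambda>t. \<Sum>j. h j t) = (\<lambda>t. f t * vp_kernel q p c N t)"
  proof
    fix t
    have "(\<lambda>j. f t * (w j * cos (real (N + j) * t + c))) sums (f t * vp_kernel q p c N t)"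
      unfolding w_def by (rule sums_mult[OF vp_kernel_sums[OF q]])
    then show "(\<Sum>j. h j t) = f t * vp_kernel q p c N t"
      by (simp add: h_def sums_iff mult_ac)
  qed
  finally have "(\<lambda>j. 1 / pi * integral {-pi..pi} (h j)) sums
     (1 / pi * integral {-pi..pi} (\<lambda>t. f t * vp_kernel q p c N t))" by (rule sums_mult)
  moreover have "1 / pi * integral {-pi..pi} (h j) = w j * harmonic f (N + j) (- c)" for j
    unfolding h_def integral_mult_right harmonic_def by simp
  ultimately show ?thesis by (simp add: w_def)
qed

text \<open>Both quantities are series in the same harmonics of the derivative and differ only in
  the coefficients, by the deviation of \<open>\<psi> (N + j) / \<psi> N\<close> from
  \<open>q ^ j\<close>. The constant is \<open>16 * 4\<close>: since \<open>pi < 4\<close>, doubling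
  twice bounds each harmonic by \<open>4 * \<omega> (1 / N)\<close>.\<close>

lemma vallee_poussin_error:
  assumes q: "0 < q" "q < 1" and \<psi>: "\<psi> \<in> D_set q" and np: "1 \<le> p" "p \<le> n"
    and mod: "modulus_of_continuity \<omega>"
    and e: "\<And>k. k \<ge> n - p + 1 \<Longrightarrow> \<bar>\<psi> (k + 1) / \<psi> k - q\<bar> \<le> \<epsilon>" "\<epsilon> \<le> (1 - q) / 2"
    and f: "f \<in> C_per" and \<phi>: "\<phi> \<in> H_class \<omega>" and d: "is_psi_beta_deriv \<psi> \<beta> f \<phi>"
  defines "N \<equiv> n - p + 1"
  shows "\<bar>real p / \<psi> N * (f x - vallee_poussin n p f x) -
      1 / pi * integral {-pi..pi} (\<lambda>t. \<phi> (x + t) * vp_kernel q p (\<beta> * pi / 2) N t)\<bar>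
    \<le> 64 * (\<epsilon> / (1 - q)\<^sup>2 * min (real p) (1 / (1 - q)) * \<omega> (1 / real N))"
proof -
  define g where "g = \<beta> * pi / 2"
  have \<phi>C: "\<phi> \<in> C_per" and \<phi>l: "\<And>x y. \<bar>\<phi> x - \<phi> y\<bar> \<le> \<omega> \<bar>x - y\<bar>"
    using \<phi> H_class_iff[OF mod] by auto
  have pos: "\<psi> k > 0" if "k \<ge> 1" for k using \<psi> that by (simp add: D_set_def)
  have N: "N \<ge> 1" by (simp add: N_def)
  have sm: "summable (\<lambda>k. \<psi> (Suc k))" by (rule D_set_summable[OF \<psi> q(2)])
  note F = is_psi_beta_deriv_imp_integral[OF f \<phi>C d sm pos, folded g_def]
  obtain M where M: "\<And>x. \<bar>\<phi> x\<bar> \<le> M" using C_per_bounded[OF \<phi>C] by blast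
  define H where "H = (\<lambda>j. harmonic \<phi> (N + j) (real (N + j) * x - g))"
  define w where "w = (\<lambda>j. real (min (Suc j) p))"
  have coeff: "harmonic f (Suc k) (real (Suc k) * x) = \<psi> (Suc k) * harmonic \<phi> (Suc k) (real (Suc k) * x - g)" for k
    by (rule F(2)) simp_all
  have "(\<lambda>j. w j * harmonic f (n - p + 1 + j) (real (n - p + 1 + j) * x)) sums
      (real p * (f x - vallee_poussin n p f x))"
    unfolding w_def
  proof (rule vallee_poussin_remainder[OF f np])
    show "f x = fourier_a f 0 / 2 + (\<Sum>k. harmonic f (Suc k) (real (Suc k) * x))"
      unfolding coeff using F(1)[of x] by (simp add: psi_beta_integral_def g_def)
    show "summable (\<lambda>k. harmonic f (Suc k) (real (Suc k) * x))"
      unfolding coeff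
    proof (rule summable_comparison_test')
      show "summable (\<lambda>k. \<psi> (Suc k) * (2 * M))" by (rule summable_mult2[OF sm])
      show "norm (\<psi> (Suc k) * harmonic \<phi> (Suc k) (real (Suc k) * x - g)) \<le> \<psi> (Suc k) * (2 * M)"
        if "k \<ge> 0" for k
        unfolding real_norm_def abs_mult using pos[of "Suc k"] harmonic_abs_le[OF \<phi>C M]
        by (intro mult_mono) auto
    qed
  qed
  moreover have "harmonic f (n - p + 1 + j) (real (n - p + 1 + j) * x) = \<psi> (N + j) * H j" for j
    unfolding H_def N_def by (rule F(2)) simp_all
  ultimately have "(\<lambda>j. w j * (\<psi> (N + j) * H j)) sums (real p * (f x - vallee_poussin n p f x))"
    by simp
  from sums_mult[OF this, of "1 / \<psi> N"]
  have 1: "(\<lambda>j. w j * (\<psi> (N + j) / \<psi> N) * H j) sums (real p / \<psi> N * (f x - vallee_poussin n p f x))"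
    by (simp add: mult_ac)
  have 2: "(\<lambda>j. w j * q ^ j * H j) sums
      (1 / pi * integral {-pi..pi} (\<lambda>t. \<phi> (x + t) * vp_kernel q p g N t))"
    using vp_kernel_integral[OF q np(1) C_per_shift[OF \<phi>C], of x N g]
    unfolding H_def harmonic_shift[OF \<phi>C] w_def .
  have Hb: "\<bar>H j\<bar> \<le> 4 * \<omega> (1 / real N)" for j
  proof -
    have "\<bar>H j\<bar> \<le> \<omega> (pi / real (N + j))"
      unfolding H_def using N by (intro harmonic_modulus_le[OF mod \<phi>C \<phi>l]) simp
    also have "\<dots> \<le> \<omega> (2 * (2 * (1 / real N)))"
    proof (rule modulus_mono[OF mod])
      have "pi / real (N + j) \<le> 4 / real N" using pi_less_4 N by (intro frac_le) auto
      then show "pi / real (N + j) \<le> 2 * (2 * (1 / real N))" by simp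
    qed simp
    also have "\<dots> \<le> 2 * \<omega> (2 * (1 / real N))" by (rule modulus_double[OF mod]) simp
    also have "\<dots> \<le> 2 * (2 * \<omega> (1 / real N))" by (intro mult_left_mono modulus_double[OF mod]) auto
    finally show ?thesis by simp
  qed
  have e0: "0 \<le> \<epsilon>" using e(1)[of "n - p + 1"] by linarith
  define m where "m = (\<lambda>j. w j * (real j * \<epsilon> * (q + \<epsilon>) ^ (j - 1)))"
  have m: "summable m" "(\<Sum>j. m j) \<le> 16 * (\<epsilon> / (1 - q)\<^sup>2 * min (real p) (1 / (1 - q)))"
    unfolding m_def w_def by (rule weighted_ratio_error[OF q e0 e(2)])+
  have w1: "0 \<le> \<omega> (1 / real N)" by (rule modulus_nonneg[OF mod]) simp
  have "norm (real p / \<psi> N * (f x - vallee_poussin n p f x) -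
      1 / pi * integral {-pi..pi} (\<lambda>t. \<phi> (x + t) * vp_kernel q p g N t)) \<le> (\<Sum>j. m j) * (4 * \<omega> (1 / real N))"
  proof (rule norm_sums_le[OF sums_diff[OF 1 2] sums_mult2[OF summable_sums[OF m(1)]]])
    fix j
    have "\<bar>\<psi> (N + j) / \<psi> N - q ^ j\<bar> \<le> real j * \<epsilon> * (q + \<epsilon>) ^ (j - 1)"
      by (rule ratio_product_error) (use N q e(1) in \<open>auto intro!: pos simp: N_def\<close>)
    then have "w j * \<bar>\<psi> (N + j) / \<psi> N - q ^ j\<bar> * \<bar>H j\<bar> \<le> m j * (4 * \<omega> (1 / real N))"
      unfolding m_def using Hb[of j] e0 q by (intro mult_mono) (auto simp: w_def)
    moreover have "w j * (\<psi> (N + j) / \<psi> N) * H j - w j * q ^ j * H j = w j * (\<psi> (N + j) / \<psi> N - q ^ j) * H j"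
      by (simp add: algebra_simps)
    ultimately show "norm (w j * (\<psi> (N + j) / \<psi> N) * H j - w j * q ^ j * H j) \<le> m j * (4 * \<omega> (1 / real N))"
      by (simp add: abs_mult w_def)
  qed
  also have "\<dots> \<le> 16 * (\<epsilon> / (1 - q)\<^sup>2 * min (real p) (1 / (1 - q))) * (4 * \<omega> (1 / real N))"
    using m(2) w1 by (intro mult_right_mono) auto
  finally show ?thesis by (simp add: g_def mult_ac)
qed

text \<open>A uniform upper bound and a single good element already make the extended supremum a
  real number between the two bounds.\<close>

lemma ereal_SUP_between:
  fixes F :: "'a \<Rightarrow> real"
  assumes "\<And>f. f \<in> A \<Longrightarrow> F f \<le> U" and "f0 \<in> A" "l \<le> F f0"
  obtains e where "(SUP f\<in>A. ereal (F f)) = ereal e" "l \<le> e" "e \<le> U"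
proof -
  let ?S = "SUP f\<in>A. ereal (F f)"
  have "?S \<le> ereal U" by (rule SUP_least) (use assms(1) in simp)
  moreover have "ereal l \<le> ?S" using assms(2,3) by (intro SUP_upper2[of f0]) auto
  ultimately show ?thesis using that by (cases ?S) auto
qed

theorem theorem3:
  "\<exists>K::real. \<forall>q::real. 0 < q \<and> q < 1 \<longrightarrow> (\<forall>\<psi>\<in>D_set q. \<exists>N::nat. \<forall>n p::nat.
     1 \<le> p \<and> p \<le> n \<and> N \<le> n - p \<longrightarrow>
     (\<forall>(\<beta>::real) (\<omega>::real \<Rightarrow> real).
        modulus_of_continuity \<omega> \<and> concave_on {0..} \<omega> \<and>
        filterlim (\<lambda>t. \<omega> t / t) at_top (at_right 0) \<longrightarrow>
        (\<exists>\<theta>::real. \<bar>\<theta>\<bar> \<le> K \<and>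
           approx_error (C_class \<psi> \<beta> (H_class \<omega>)) n p =
           ereal (\<psi> (n - p + 1) / real p *
             (4 / pi\<^sup>2 * ((1 - q ^ (2 * p)) / (1 - q\<^sup>2)) * elliptic_K (q ^ p) *
                integral {0..pi/2} (\<lambda>t. \<omega> (2 * t / real (n - p + 1)) * sin t)
              + \<theta> * (\<omega> pi / ((1 - q) ^ gamma_exp p * real (n - p + 1))
                   + ratio_dev \<psi> q (n - p + 1) / (1 - q)\<^sup>2 * min (real p) (1 / (1 - q))
                       * \<omega> (1 / real (n - p + 1))))))))"
proof (rule exI[of _ "300 :: real"], intro allI impI ballI, elim conjE)
  \<comment> \<open>The constant 300 covers the coefficients 272 of the first error term
    (\<open>Y\<close> below) and 64 of the second (\<open>Z\<close>).\<close>
  fix q :: real and \<psi>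
  assume q: "0 < q" "q < 1" and \<psi>: "\<psi> \<in> D_set q"
  have "(\<lambda>k. \<psi> (k + 1) / \<psi> k) \<longlonglongrightarrow> q" using \<psi> by (simp add: D_set_def)
  moreover have "(1 - q) / 2 > 0" using q by simp
  \<comment> \<open>\<open>N1\<close> keeps \<open>q + \<epsilon>\<close> away from 1, as
    \<open>weighted_ratio_error\<close> requires; \<open>N2\<close> is the separation threshold for
    the peaks. Both depend on \<psi> and \<open>q\<close> only.\<close>
  ultimately obtain N1 where N1: "\<And>k. k \<ge> N1 \<Longrightarrow> \<bar>\<psi> (k + 1) / \<psi> k - q\<bar> < (1 - q) / 2"
    unfolding LIMSEQ_def dist_real_def by blast
  obtain N2 where N2: "6 / (1 - q) \<le> real N2" using real_arch_simple by blast
  show "\<exists>N. \<forall>n p. 1 \<le> p \<and> p \<le> n \<and> N \<le> n - p \<longrightarrow>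
     (\<forall>(\<beta>::real) (\<omega>::real \<Rightarrow> real).
        modulus_of_continuity \<omega> \<and> concave_on {0..} \<omega> \<and>
        filterlim (\<lambda>t. \<omega> t / t) at_top (at_right 0) \<longrightarrow>
        (\<exists>\<theta>::real. \<bar>\<theta>\<bar> \<le> 300 \<and>
           approx_error (C_class \<psi> \<beta> (H_class \<omega>)) n p =
           ereal (\<psi> (n - p + 1) / real p *
             (4 / pi\<^sup>2 * ((1 - q ^ (2 * p)) / (1 - q\<^sup>2)) * elliptic_K (q ^ p) *
                integral {0..pi/2} (\<lambda>t. \<omega> (2 * t / real (n - p + 1)) * sin t)
              + \<theta> * (\<omega> pi / ((1 - q) ^ gamma_exp p * real (n - p + 1))
                   + ratio_dev \<psi> q (n - p + 1) / (1 - q)\<^sup>2 * min (real p) (1 / (1 - q))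
                       * \<omega> (1 / real (n - p + 1)))))))"
  proof (rule exI[of _ "max N1 N2"], intro allI impI, elim conjE)
    fix n p :: nat and \<beta> :: real and \<omega> :: "real \<Rightarrow> real"
    assume np: "1 \<le> p" "p \<le> n" and large: "max N1 N2 \<le> n - p"
      and mod: "modulus_of_continuity \<omega>" and conc: "concave_on {0..} \<omega>"
      and lim: "filterlim (\<lambda>t. \<omega> t / t) at_top (at_right 0)"
    define N where "N = n - p + 1"
    define b where "b = 1 / (1 - q)"
    define \<epsilon> where "\<epsilon> = ratio_dev \<psi> q N"
    define X where "X = 4 / pi\<^sup>2 * ((1 - q ^ (2 * p)) / (1 - q\<^sup>2)) * elliptic_K (q ^ p) *
      integral {0..pi/2} (\<lambda>t. \<omega> (2 * t / real N) * sin t)"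
    define Y where "Y = \<omega> pi / ((1 - q) ^ gamma_exp p * real N)"
    define Z where "Z = \<epsilon> / (1 - q)\<^sup>2 * min (real p) (1 / (1 - q)) * \<omega> (1 / real N)"
    have N: "N1 \<le> N" "N2 \<le> N" "N \<ge> 1" using large by (auto simp: N_def)
    have pos: "\<psi> k > 0" if "k \<ge> 1" for k using \<psi> that by (simp add: D_set_def)
    have \<psi>N: "\<psi> N > 0" using pos N by simp
    have sm: "summable (\<lambda>k. \<psi> (Suc k))" by (rule D_set_summable[OF \<psi> q(2)])
    have bd: "\<bar>\<psi> (k + 1) / \<psi> k - q\<bar> \<le> (1 - q) / 2" if "k \<ge> N" for k
      using N1[of k] that N(1) by simp
    have e1: "\<bar>\<psi> (k + 1) / \<psi> k - q\<bar> \<le> \<epsilon>" if "k \<ge> N" for k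
      unfolding \<epsilon>_def ratio_dev_def using that bd
      by (intro cSUP_upper2[where x = k] bdd_aboveI[of _ "(1 - q) / 2"]) auto
    have e2: "\<epsilon> \<le> (1 - q) / 2"
      unfolding \<epsilon>_def ratio_dev_def using bd by (intro cSUP_least) auto
    have e0: "0 \<le> \<epsilon>" using e1[of N] by linarith
    have "6 / (1 - q) \<le> real N" using N2 N(2) by linarith
    then interpret K: oscillating_kernel "vp_factor q p" "vp_phase q p" "2 * b ^ gamma_exp p"
      "b ^ (gamma_exp p - 1)" "3 * b" "\<beta> * pi / 2" N
      unfolding b_def by (intro vp_oscillating_kernel q np(1))
    have kern: "K.kernel = vp_kernel q p (\<beta> * pi / 2) N" by (auto simp: K.kernel_def vp_kernel_def)
    have b0: "b > 0" using q by (simp add: b_def)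
    have Gk: "b ^ (gamma_exp p - 1) * (3 * b) = 3 * b ^ gamma_exp p"
      by (simp add: gamma_exp_def power2_eq_square power3_eq_cube)
    have w: "\<omega> pi \<ge> 0" "\<omega> (1 / real N) \<ge> 0" by (auto intro!: modulus_nonneg[OF mod])
    \<comment> \<open>One factor \<open>1 / pi\<close> comes from the convolution, the other from
      averaging the amplitudes over the periods; the 4 is that of
      \<open>integral_vp_factor\<close>.\<close>
    have main: "1 / pi * (K.main_integral \<omega> / pi * integral {-pi..pi} (\<lambda>t. cmod (vp_factor q p t))) = X"
      unfolding X_def integral_vp_factor[OF q np(1)] K.main_integral_def[OF mod conc]
      by (simp add: power2_eq_square mult_ac)
    \<comment> \<open>\<open>C\<close> is 4 in the upper and 8 in the lower estimate. The exact
      constant is \<open>8 + 60 * pi + 3 * C\<close>, and \<open>8 + 240 + 24 = 272\<close>.\<close>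
    have const: "1 / pi * (\<omega> pi * (4 * pi * (2 * b ^ gamma_exp p) + 30 * pi\<^sup>2 * (2 * b ^ gamma_exp p)
        + C * pi * (b ^ (gamma_exp p - 1) * (3 * b))) / real N) \<le> 272 * Y" if "C \<le> 8" for C
    proof -
      have Yb: "Y = \<omega> pi * b ^ gamma_exp p / real N" by (simp add: Y_def b_def power_divide)
      have "1 / pi * (\<omega> pi * (4 * pi * (2 * b ^ gamma_exp p) + 30 * pi\<^sup>2 * (2 * b ^ gamma_exp p)
        + C * pi * (b ^ (gamma_exp p - 1) * (3 * b))) / real N) = (8 + 60 * pi + 3 * C) * Y"
      proof -
        have "4 * pi * (2 * B) + 30 * pi\<^sup>2 * (2 * B) + C * pi * (3 * B) = pi * ((8 + 60 * pi + 3 * C) * B)" for B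
          by (simp add: power2_eq_square algebra_simps)
        then show ?thesis unfolding Gk Yb by simp
      qed
      also have "\<dots> \<le> 272 * Y"
      proof (rule mult_right_mono)
        show "8 + 60 * pi + 3 * C \<le> 272" using pi_less_4 that by linarith
        show "0 \<le> Y" unfolding Yb using w b0 by simp
      qed
      finally show ?thesis .
    qed
    \<comment> \<open>Since \<open>\<omega> t / t\<close> exceeds 1 somewhere in
      \<open>(0, pi)\<close>, monotonicity gives \<open>\<omega> pi > 0\<close>. This permits the
      division by \<open>Y + Z\<close> that defines \<theta>.\<close>
    have Y0: "Y > 0"
    proof -
      have "\<forall>\<^sub>F t in at_right 0. 1 \<le> \<omega> t / t" using lim unfolding filterlim_at_top by blast
      moreover have "\<forall>\<^sub>F t in at_right (0 :: real). 0 < t \<and> t < pi"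
        using eventually_at_right_real[OF pi_gt_zero] by (rule eventually_mono) auto
      ultimately have "\<forall>\<^sub>F t in at_right 0. 1 \<le> \<omega> t / t \<and> 0 < t \<and> t < pi" by (rule eventually_conj)
      then have "\<exists>t. 1 \<le> \<omega> t / t \<and> 0 < t \<and> t < pi" by (rule eventually_happens'[rotated]) simp
      then obtain t where t: "1 \<le> \<omega> t / t" "0 < t" "t < pi" by blast
      then have "0 < \<omega> t" by (simp add: pos_le_divide_eq)
      also have "\<omega> t \<le> \<omega> pi" using t by (intro modulus_mono[OF mod]) auto
      finally show ?thesis using q N by (simp add: Y_def)
    qed
    have Z0: "Z \<ge> 0" unfolding Z_def using e0 w q by simp
    define R where "R = (\<lambda>f x. f x - vallee_poussin n p f x)"
    have err: "\<bar>real p / \<psi> N * R f x - 1 / pi * integral {-pi..pi} (\<lambda>t. \<phi> (x + t) * K.kernel t)\<bar> \<le> 64 * Z"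
      if "f \<in> C_per" "\<phi> \<in> H_class \<omega>" "is_psi_beta_deriv \<psi> \<beta> f \<phi>" for f \<phi> x
      unfolding Z_def R_def kern unfolding N_def
      by (rule vallee_poussin_error[OF q \<psi> np mod _ e2 that]) (rule e1[unfolded N_def])
    have up: "\<bar>R f x\<bar> \<le> \<psi> N / real p * (X + 300 * (Y + Z))" if f: "f \<in> C_class \<psi> \<beta> (H_class \<omega>)" for f x
    proof -
      obtain \<phi> where \<phi>: "\<phi> \<in> H_class \<omega>" and d: "is_psi_beta_deriv \<psi> \<beta> f \<phi>" and fC: "f \<in> C_per"
        using f by (auto simp: C_class_def L_class_def)
      have \<phi>C: "\<phi> \<in> C_per" and \<phi>l: "\<And>x y. \<bar>\<phi> x - \<phi> y\<bar> \<le> \<omega> \<bar>x - y\<bar>"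
        using \<phi> H_class_iff[OF mod] by auto
      have "integral {-pi..pi} \<phi> = 0" using d by (simp add: is_psi_beta_deriv_def fourier_a_def)
      moreover have "integral {-pi..pi} (\<lambda>t. \<phi> (x + t)) = integral {-pi..pi} \<phi>"
        using harmonic_shift[OF \<phi>C, of 0 x 0] by (simp add: harmonic_def)
      ultimately have "\<bar>integral {-pi..pi} (\<lambda>t. \<phi> (x + t) * K.kernel t)\<bar> \<le>
        K.main_integral \<omega> / pi * integral {-pi..pi} (\<lambda>t. cmod (vp_factor q p t))
        + \<omega> pi * (4 * pi * (2 * b ^ gamma_exp p) + 30 * pi\<^sup>2 * (2 * b ^ gamma_exp p)
          + 4 * pi * (b ^ (gamma_exp p - 1) * (3 * b))) / real N"
        using \<phi>l[of "x + _" "x + _"]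
        by (intro K.integral_kernel_upper[OF mod conc C_per_shift[OF \<phi>C]]) auto
      then have "1 / pi * \<bar>integral {-pi..pi} (\<lambda>t. \<phi> (x + t) * K.kernel t)\<bar> \<le> 1 / pi * (
        K.main_integral \<omega> / pi * integral {-pi..pi} (\<lambda>t. cmod (vp_factor q p t))
        + \<omega> pi * (4 * pi * (2 * b ^ gamma_exp p) + 30 * pi\<^sup>2 * (2 * b ^ gamma_exp p)
          + 4 * pi * (b ^ (gamma_exp p - 1) * (3 * b))) / real N)"
        by (intro mult_left_mono) auto
      also have "\<dots> \<le> X + 272 * Y"
        unfolding distrib_left[of "1 / pi"] main using const[of 4] by simp
      finally have "\<bar>1 / pi * integral {-pi..pi} (\<lambda>t. \<phi> (x + t) * K.kernel t)\<bar> \<le> X + 272 * Y"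
        by (simp add: abs_mult)
      with err[OF fC \<phi> d, of x] have "\<bar>real p / \<psi> N * R f x\<bar> \<le> X + 272 * Y + 64 * Z"
        by linarith
      also have "\<dots> \<le> X + 300 * (Y + Z)" using Y0 Z0 by simp
      finally have "real p / \<psi> N * \<bar>R f x\<bar> \<le> X + 300 * (Y + Z)" using \<psi>N by (simp add: abs_mult)
      then show ?thesis using \<psi>N np by (simp add: field_simps)
    qed
    obtain \<phi> where \<phi>C: "\<phi> \<in> C_per" and \<phi>l: "\<And>x y. \<bar>\<phi> x - \<phi> y\<bar> \<le> \<omega> \<bar>x - y\<bar>"
      and \<phi>0: "integral {-pi..pi} \<phi> = 0" and low: "integral {-pi..pi} (\<lambda>t. \<phi> t * K.kernel t) \<ge>
        K.main_integral \<omega> / pi * integral {-pi..pi} (\<lambda>t. cmod (vp_factor q p t))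
        - \<omega> pi * (4 * pi * (2 * b ^ gamma_exp p) + 30 * pi\<^sup>2 * (2 * b ^ gamma_exp p)
          + 8 * pi * (b ^ (gamma_exp p - 1) * (3 * b))) / real N"
      using K.integral_kernel_lower[OF mod conc] by blast
    define f where "f = psi_beta_integral \<psi> \<beta> \<phi>"
    have a0: "fourier_a \<phi> 0 = 0" using \<phi>0 by (simp add: fourier_a_def)
    have fC: "f \<in> C_per"
      unfolding f_def by (rule is_psi_beta_deriv_integral(1)[OF \<phi>C a0 sm]) (rule pos)
    have fd: "is_psi_beta_deriv \<psi> \<beta> f \<phi>"
      unfolding f_def by (rule is_psi_beta_deriv_integral(2)[OF \<phi>C a0 sm]) (rule pos)
    have \<phi>H: "\<phi> \<in> H_class \<omega>" using \<phi>C \<phi>l H_class_iff[OF mod] by blast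
    have fc: "f \<in> C_class \<psi> \<beta> (H_class \<omega>)"
      using fC fd \<phi>H C_per_subset_L1_per by (auto simp: C_class_def L_class_def)
    have "X - 272 * Y \<le> 1 / pi * (K.main_integral \<omega> / pi * integral {-pi..pi} (\<lambda>t. cmod (vp_factor q p t))
        - \<omega> pi * (4 * pi * (2 * b ^ gamma_exp p) + 30 * pi\<^sup>2 * (2 * b ^ gamma_exp p)
          + 8 * pi * (b ^ (gamma_exp p - 1) * (3 * b))) / real N)"
      unfolding right_diff_distrib[of "1 / pi"] main using const[of 8] by simp
    also have "\<dots> \<le> 1 / pi * integral {-pi..pi} (\<lambda>t. \<phi> t * K.kernel t)"
      by (intro mult_left_mono low) auto
    finally have low': "X - 272 * Y \<le> 1 / pi * integral {-pi..pi} (\<lambda>t. \<phi> t * K.kernel t)" .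
    have "a - d \<le> c" if "\<bar>c - e\<bar> \<le> d" "a \<le> e" for a c d e :: real using that by linarith
    \<comment> \<open>At the point 0 the translated derivative is \<phi> itself, so the integral
      bounded from below is the remainder there up to \<open>64 * Z\<close>.\<close>
    from this[OF err[OF fC \<phi>H fd, of 0, unfolded add_0] low']
    have "X - 272 * Y - 64 * Z \<le> real p / \<psi> N * R f 0" .
    moreover have "X - 300 * (Y + Z) \<le> X - 272 * Y - 64 * Z" using Y0 Z0 by simp
    ultimately have "X - 300 * (Y + Z) \<le> real p / \<psi> N * R f 0" by linarith
    then have "\<psi> N / real p * (X - 300 * (Y + Z)) \<le> R f 0" using \<psi>N np by (simp add: field_simps)
    also have "\<dots> \<le> norm_C (R f)"
      unfolding norm_C_def using up[OF fc]
      by (intro cSUP_upper2[where x = 0] bdd_aboveI[of _ "\<psi> N / real p * (X + 300 * (Y + Z))"]) auto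
    finally have lo: "\<psi> N / real p * (X - 300 * (Y + Z)) \<le> norm_C (R f)" .
    have hi: "norm_C (R f) \<le> \<psi> N / real p * (X + 300 * (Y + Z))" if "f \<in> C_class \<psi> \<beta> (H_class \<omega>)" for f
      unfolding norm_C_def using up[OF that] by (intro cSUP_least) auto
    obtain v where v: "approx_error (C_class \<psi> \<beta> (H_class \<omega>)) n p = ereal v"
      "\<psi> N / real p * (X - 300 * (Y + Z)) \<le> v" "v \<le> \<psi> N / real p * (X + 300 * (Y + Z))"
      using ereal_SUP_between[of "C_class \<psi> \<beta> (H_class \<omega>)" "\<lambda>f. norm_C (R f)", OF hi fc lo]
      unfolding approx_error_def R_def by blast
    \<comment> \<open>Solves the claimed formula for \<theta>; the two-sided bound on
      \<open>v\<close> is the bound on \<open>\<bar>\<theta>\<bar>\<close>.\<close>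
    define \<theta> where "\<theta> = (v * real p / \<psi> N - X) / (Y + Z)"
    have YZ: "Y + Z > 0" using Y0 Z0 by simp
    have "X - 300 * (Y + Z) \<le> v * real p / \<psi> N" "v * real p / \<psi> N \<le> X + 300 * (Y + Z)"
      using v(2,3) \<psi>N np by (simp_all add: field_simps)
    then have "\<bar>v * real p / \<psi> N - X\<bar> \<le> 300 * (Y + Z)" by linarith
    then have "\<bar>\<theta>\<bar> \<le> 300" using YZ by (simp add: \<theta>_def pos_divide_le_eq)
    moreover have "v = \<psi> N / real p * (X + \<theta> * (Y + Z))"
      using YZ \<psi>N np by (simp add: \<theta>_def)
    ultimately show "\<exists>\<theta>::real. \<bar>\<theta>\<bar> \<le> 300 \<and>
           approx_error (C_class \<psi> \<beta> (H_class \<omega>)) n p =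
           ereal (\<psi> (n - p + 1) / real p *
             (4 / pi\<^sup>2 * ((1 - q ^ (2 * p)) / (1 - q\<^sup>2)) * elliptic_K (q ^ p) *
                integral {0..pi/2} (\<lambda>t. \<omega> (2 * t / real (n - p + 1)) * sin t)
              + \<theta> * (\<omega> pi / ((1 - q) ^ gamma_exp p * real (n - p + 1))
                   + ratio_dev \<psi> q (n - p + 1) / (1 - q)\<^sup>2 * min (real p) (1 / (1 - q))
                       * \<omega> (1 / real (n - p + 1)))))"
      unfolding v(1) X_def Y_def Z_def \<epsilon>_def N_def by blast
  qed
qed

end
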